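(* Let $N\ge2$ be an integer, $2\le p<N$, $p^*=\frac{Np}{N-p}$, and let $V:\mathbb{Z}^N\to\mathbb{R}$ and $f:\mathbb{Z}^N\times\mathbb{R}\to\mathbb{R}$ satisfy the following conditions, where $F(x,t)=\int_0^tf(x,s)\,ds$: (S1) there is a positive integer $T$ such that $V(x)$ and $f(x,t)$ are both $T$-periodic in $x$, and $\inf_{x\in\mathbb{Z}^N}V(x)\ge0$; (S2) $f(x,t)$ is continuous in $t$ for every $x\in\mathbb{Z}^N$, and $|f(x,t)|\le a(1+|t|^{q-1})$ for all $(x,t)$, for some constants $a>0$ and $q>p^*$; (S3) $f(x,t)=o(|t|^{p^*-1})$ uniformly in $x$ as $|t|\to0$; (S4) $t\mapsto\frac{f(x,t)}{|t|^{p-1}}$ is strictly increasing on $(-\infty,0)\cup(0,\infty)$ for each $x\in\mathbb{Z}^N$; (S5) $\frac{F(x,t)}{|t|^p}\to\infty$ uniformly in $x$ as $|t|\to\infty$. Suppose moreover that $f(x,u)$ is odd in $u$ for every $x\in\mathbb{Z}^N$. Then the equation $$-\Delta_pu+V(x)|u|^{p-2}u=f(x,u)\ \text{ on }\mathbb{Z}^N,\qquad u\in E,$$ admits infinitely many geometrically distinct solutions.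
   Context: The lattice graph $\mathbb{Z}^N$ has vertex set $\mathbb{Z}^N$, with $x\sim y$ iff $\sum_{i=1}^N|x_i-y_i|=1$. A function $h$ on $\mathbb{Z}^N$ is $T$-periodic if $h(x+Te_i)=h(x)$ for all $x$ and $1\le i\le N$ ($e_i$ the $i$-th unit vector). The $p$-Laplacian is $\Delta_pu(x)=\sum_{y\sim x}|u(y)-u(x)|^{p-2}(u(y)-u(x))$. The norm is $\|u\|=\Big(\sum_{x\sim y}\frac12|u(y)-u(x)|^p+\sum_xV(x)|u(x)|^p\Big)^{1/p}$ (first sum over ordered pairs), and $E$ is the completion, with respect to $\|\cdot\|$, of the space of finitely supported real functions on $\mathbb{Z}^N$, regarded as a space of functions. A solution is a $u\in E$ satisfying the equation at every $x\in\mathbb{Z}^N$. The orbit of $u\in E$ is $\mathcal{O}(u)=\{u(\cdot-kT):k\in\mathbb{Z}^N\}$; two solutions $u_1,u_2$ are geometrically distinct if $\mathcal{O}(u_1)$ and $\mathcal{O}(u_2)$ are disjoint. *)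

theory Defs
  imports "HOL-Analysis.Analysis"
begin

definition adj :: "int ^ 'n \<Rightarrow> int ^ 'n \<Rightarrow> bool" where
  "adj x y \<longleftrightarrow> (\<Sum>i\<in>UNIV. \<bar>x $ i - y $ i\<bar>) = 1"

definition lattice_periodic :: "int \<Rightarrow> (int ^ 'n \<Rightarrow> 'b) \<Rightarrow> bool" where
  "lattice_periodic T h \<longleftrightarrow> (\<forall>x i. h (x + axis i T) = h x)"

text \<open>Throughout, \<open>0 powr a = 0\<close>, so \<open>\<bar>t\<bar> powr (p - 2) * t\<close> is \<open>0\<close> at \<open>t = 0\<close>, also for \<open>p = 2\<close>.\<close>

definition p_laplacian :: "real \<Rightarrow> (int ^ 'n \<Rightarrow> real) \<Rightarrow> int ^ 'n \<Rightarrow> real" where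
  "p_laplacian p u x = (\<Sum>y\<in>{y. adj x y}. \<bar>u y - u x\<bar> powr (p - 2) * (u y - u x))"

text \<open>The infinite sums take the value \<open>0\<close> where they diverge; below, the norm is only
  applied to finitely supported functions, for which they have finitely many nonzero terms.\<close>

definition E_norm :: "real \<Rightarrow> (int ^ 'n \<Rightarrow> real) \<Rightarrow> (int ^ 'n \<Rightarrow> real) \<Rightarrow> real" where
  "E_norm p V u =
     ((\<Sum>\<^sub>\<infinity>(x, y)\<in>{(x, y). adj x y}. 1 / 2 * \<bar>u y - u x\<bar> powr p)
       + (\<Sum>\<^sub>\<infinity>x\<in>UNIV. V x * \<bar>u x\<bar> powr p)) powr (1 / p)"

definition fin_supp :: "(int ^ 'n \<Rightarrow> real) set" where
  "fin_supp = {u. finite {x. u x \<noteq> 0}}"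

text \<open>The completion of \<open>fin_supp\<close> realised as a space of functions: an element of the completion
  is identified with the pointwise limit of a Cauchy sequence representing it.  For \<open>1 \<le> p < N\<close>
  and \<open>V \<ge> 0\<close> the discrete Sobolev inequality makes every Cauchy sequence converge pointwise, and
  by Fatou's lemma Cauchy sequences with the same pointwise limit are equivalent.  (Norm convergence
  alone would not determine the limit: if \<open>V = 0\<close>, constants have zero energy.)\<close>

definition E_space :: "real \<Rightarrow> (int ^ 'n \<Rightarrow> real) \<Rightarrow> (int ^ 'n \<Rightarrow> real) set" where
  "E_space p V = {u. \<exists>\<phi> :: nat \<Rightarrow> int ^ 'n \<Rightarrow> real.
      (\<forall>k. \<phi> k \<in> fin_supp) \<and>
      (\<forall>\<epsilon>>0. \<exists>K. \<forall>k\<ge>K. \<forall>l\<ge>K. E_norm p V (\<lambda>x. \<phi> k x - \<phi> l x) < \<epsilon>) \<and>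
      (\<forall>x. (\<lambda>k. \<phi> k x) \<longlonglongrightarrow> u x)}"

definition solutions ::
  "real \<Rightarrow> (int ^ 'n \<Rightarrow> real) \<Rightarrow> (int ^ 'n \<Rightarrow> real \<Rightarrow> real) \<Rightarrow> (int ^ 'n \<Rightarrow> real) set" where
  "solutions p V f = {u \<in> E_space p V.
      \<forall>x. - p_laplacian p u x + V x * \<bar>u x\<bar> powr (p - 2) * u x = f x (u x)}"

definition orbit :: "int \<Rightarrow> (int ^ 'n \<Rightarrow> real) \<Rightarrow> (int ^ 'n \<Rightarrow> real) set" where
  "orbit T u = {(\<lambda>x. u (x - T *s k)) | k. True}"

definition geom_distinct :: "int \<Rightarrow> (int ^ 'n \<Rightarrow> real) \<Rightarrow> (int ^ 'n \<Rightarrow> real) \<Rightarrow> bool" where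
  "geom_distinct T u v \<longleftrightarrow> orbit T u \<inter> orbit T v = {}"

text \<open>The interval integral is oriented: for \<open>t < 0\<close> it is minus the integral over \<open>[t, 0]\<close>.\<close>

definition primitive :: "('a \<Rightarrow> real \<Rightarrow> real) \<Rightarrow> 'a \<Rightarrow> real \<Rightarrow> real" where
  "primitive f x t = (LBINT s=ereal 0..ereal t. f x s)"

end

theory Submission
  imports Defs "HOL-Homology.Homology"
begin

text \<open>Solutions are the critical points of the energy \<open>J u = En u / p - \<Sum>x. F x (u x)\<close>, where \<open>En\<close> is the
\<open>p\<close>-th power of the norm.  Everything takes place among finitely supported functions: by strict
monotonicity of \<open>f x t / \<bar>t\<bar> powr (p - 1)\<close> every nonzero ray meets the Nehari manifold in exactly one
point, the maximum of \<open>J\<close> along that ray, so \<open>proj\<close> maps nonzero functions to the manifold and \<open>J\<close> is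
positive there.  The growth of \<open>f\<close> below \<open>\<bar>t\<bar> powr (pstar - 1)\<close> at \<open>0\<close> together with the discrete
Sobolev inequality (\<open>discrete_Sobolev\<close>, proved by truncating at dyadic levels) makes sublevel sets of
\<open>J\<close> on the manifold bounded in energy and in sup norm, and bounded away from \<open>0\<close> in sup norm
(\<open>nehari_bounds\<close>).

Suppose there were only finitely many orbits of solutions.  Then the nonzero solutions have finitely
many energy levels, and by periodicity and decay at infinity any two distinct solutions differ by a
fixed \<open>\<kappa>\<close> somewhere (\<open>finitely_many_orbits_few_solutions\<close>).  Pointwise limits of functions with
residuals tending to \<open>0\<close> are solutions (\<open>limit_is_solution\<close>), so two almost critical functions at
distance at most \<open>\<kappa> / 2\<close> are in fact arbitrarily close (\<open>almost_critical_dichotomy\<close>).  This replaces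
the Palais-Smale condition, which fails because of translations: a descending flow that starts away
from the solutions at a level \<open>d\<close> cannot drift far, and it reaches a level below \<open>d\<close> (\<open>deformation\<close>).

Oddness of \<open>f\<close> makes the construction equivariant under \<open>u \<mapsto> -u\<close>.  Measure the size of a symmetric
parameter set by the number of closed sets \<open>B\<close>, each disjoint from its antipodal image, which with
their antipodal images cover it (\<open>index_le\<close>).  A family of functions close to solutions of level \<open>d\<close>
has index at most \<open>1\<close>, since these solutions are \<open>\<kappa>\<close>-separated and none equals its own negative.
Hence passing a level \<open>d\<close> raises the index by at most one, and only when \<open>d\<close> is the energy of a
solution, so a family of bounded energy has index at most the number of levels
(\<open>index_le_card_levels\<close>).  But spheres of every dimension map oddly into the Nehari manifold, and
the \<open>m\<close>-sphere has index greater than \<open>m\<close> by the theorem of Lusternik and Schnirelmann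
(\<open>Lusternik_Schnirelmann_nsphere\<close>).  That theorem is proved by a parity count in the style of Ky Fan's
lemma on iterated subdivisions of singular chains representing hemispheres.\<close>

text \<open>The rule rewrites \<open>finite A\<close> along \<open>\<bar>A\<bar> =o \<bar>B\<bar>\<close> with \<open>B\<close> free, which reflexivity of \<open>=o\<close> can instantiate
  to \<open>A\<close> itself; the simplifier may then loop.\<close>
declare card_of_ordIso_finite [simp del]

section \<open>The discrete Sobolev inequality\<close>

lemma card_int_box:
  "card {z :: int ^ 'n. \<forall>i. a \<le> z $ i \<and> z $ i < b} = nat (b - a) ^ CARD('n)"
  "finite {z :: int ^ 'n. \<forall>i. a \<le> z $ i \<and> z $ i < b}"
proof -
  have bij: "bij_betw (\<lambda>g. \<chi> i. g i) (PiE (UNIV :: 'n set) (\<lambda>_. {a..<b})) {z :: int ^ 'n. \<forall>i. a \<le> z $ i \<and> z $ i < b}"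
    by (rule bij_betw_byWitness[where f' = "\<lambda>z i. z $ i"]) (auto simp: vec_eq_iff)
  show "card {z :: int ^ 'n. \<forall>i. a \<le> z $ i \<and> z $ i < b} = nat (b - a) ^ CARD('n)"
    unfolding bij_betw_same_card[OF bij, symmetric] by (simp add: card_PiE)
  show "finite {z :: int ^ 'n. \<forall>i. a \<le> z $ i \<and> z $ i < b}"
    unfolding bij_betw_finite[OF bij, symmetric] by (rule finite_PiE) auto
qed

lemma adj_sym: "adj x y \<longleftrightarrow> adj y x"
  by (simp add: adj_def abs_minus_commute)

lemma adj_translate: "adj (x + z) (y + z) \<longleftrightarrow> adj x y"
  by (simp add: adj_def)

lemma finite_adj: "finite {y. adj x y}"
proof -
  have "{y. adj x y} \<subseteq> (\<lambda>z. x + z) ` {z. \<forall>i. -1 \<le> z $ i \<and> z $ i < 2}"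
  proof
    fix y assume "y \<in> {y. adj x y}"
    then have s: "(\<Sum>i\<in>UNIV. \<bar>x $ i - y $ i\<bar>) = 1" by (simp add: adj_def)
    have "\<bar>x $ i - y $ i\<bar> \<le> 1" for i
      using member_le_sum[of i UNIV "\<lambda>i. \<bar>x $ i - y $ i\<bar>"] s by simp
    then have "-1 \<le> (y - x) $ i \<and> (y - x) $ i < 2" for i
      unfolding vector_minus_component by (smt (verit))
    then have mem: "y - x \<in> {z. \<forall>i. -1 \<le> z $ i \<and> z $ i < 2}" by blast
    have "y = x + (y - x)" by simp
    then show "y \<in> (\<lambda>z. x + z) ` {z. \<forall>i. -1 \<le> z $ i \<and> z $ i < 2}"
      by (rule image_eqI[OF _ mem])
  qed
  then show ?thesis by (rule finite_subset) (intro finite_imageI card_int_box)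
qed

lemma finite_edges: assumes "finite B" shows "finite {(x, y). adj x y \<and> (x \<in> B \<or> y \<in> B)}"
proof -
  have "{(x, y). adj x y \<and> (x \<in> B \<or> y \<in> B)} \<subseteq> (\<Union>x\<in>B. {x} \<times> {y. adj x y}) \<union> (\<Union>y\<in>B. {x. adj y x} \<times> {y})"
    using adj_sym by blast
  then show ?thesis by (rule finite_subset) (intro finite_UnI finite_UN_I assms finite_cartesian_product finite_adj finite.intros)
qed

text \<open>Convexity of \<open>t powr p\<close>, applied to \<open>(a + b) / (n + 1)\<close> as an average of \<open>n\<close> copies of \<open>a / n\<close> and one
  copy of \<open>b\<close>.  The weights are exactly those for which the cost of a path grows like the \<open>p\<close>-th power of
  its length in \<open>increment_path\<close>.\<close>
lemma powr_add_split:
  fixes a b p n :: real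
  assumes "0 \<le> a" "0 \<le> b" "1 \<le> p" "0 < n"
  shows "(a + b) powr p \<le> (n + 1) powr (p - 1) * (n powr (1 - p) * a powr p + b powr p)"
proof -
  consider "a = 0" | "b = 0" | "a > 0" "b > 0" using assms by linarith
  then show ?thesis
  proof cases
    case 1
    have "1 \<le> (n + 1) powr (p - 1)" using assms by (intro ge_one_powr_ge_zero) auto
    then have "1 * b powr p \<le> (n + 1) powr (p - 1) * b powr p" by (intro mult_right_mono) auto
    then show ?thesis using 1 by simp
  next
    case 2
    have "1 \<le> ((n + 1) / n) powr (p - 1)" using assms by (intro ge_one_powr_ge_zero) (auto simp: field_simps)
    then have "1 \<le> (n + 1) powr (p - 1) * n powr (1 - p)"
      using assms by (simp add: powr_divide powr_diff field_simps)
    then have "1 * a powr p \<le> (n + 1) powr (p - 1) * n powr (1 - p) * a powr p" by (intro mult_right_mono) auto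
    then show ?thesis using 2 by (simp add: mult.assoc)
  next
    case 3
    have conv: "convex_on {0<..} (\<lambda>x::real. x powr p)" by (rule powr_convex) (use assms in auto)
    have "((1 / (n + 1)) *\<^sub>R b + (n / (n + 1)) *\<^sub>R (a / n)) powr p
        \<le> (1 / (n + 1)) * b powr p + (n / (n + 1)) * (a / n) powr p"
    proof -
      have "1 - 1 / (n + 1) = n / (n + 1)" using assms by (simp add: field_simps)
      then show ?thesis
        using convex_onD[OF conv, of "1 / (n + 1)" "a / n" b] 3 assms by (simp add: add.commute)
    qed
    moreover have "(1 / (n + 1)) *\<^sub>R b + (n / (n + 1)) *\<^sub>R (a / n) = (a + b) / (n + 1)"
      using assms by (simp add: add_divide_distrib)
    ultimately have "((a + b) / (n + 1)) powr p \<le> (1 / (n + 1)) * b powr p + (n / (n + 1)) * (a / n) powr p"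
      by simp
    also have "\<dots> = (n powr (1 - p) * a powr p + b powr p) / (n + 1)"
      using assms 3 by (simp add: powr_divide powr_diff add_divide_distrib)
    finally have "(n + 1) powr (p - 1) * (n + 1) * ((a + b) / (n + 1)) powr p
       \<le> (n + 1) powr (p - 1) * (n + 1) * ((n powr (1 - p) * a powr p + b powr p) / (n + 1))"
      using assms by (intro mult_left_mono) auto
    moreover have "(n + 1) powr (p - 1) * (n + 1) * ((a + b) / (n + 1)) powr p = (a + b) powr p"
      using assms by (simp add: powr_divide powr_diff)
    ultimately show ?thesis using assms by simp
  qed
qed

lemma powr_superadd:
  fixes a b p :: real
  assumes "0 \<le> a" "0 \<le> b" "1 \<le> p"
  shows "a powr p + b powr p \<le> (a + b) powr p"
proof -
  have *: "c powr p = c * c powr (p - 1)" if "0 \<le> c" for c :: real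
    using that by (cases "c = 0") (auto simp: powr_diff)
  have "a * a powr (p - 1) \<le> a * (a + b) powr (p - 1)" "b * b powr (p - 1) \<le> b * (a + b) powr (p - 1)"
    using assms by (auto intro!: mult_left_mono powr_mono2)
  then show ?thesis using *[of a] *[of b] *[of "a + b"] assms by (simp add: algebra_simps)
qed

lemma sum_powr_superadd:
  fixes g :: "'a \<Rightarrow> real"
  assumes "finite K" "\<And>k. k \<in> K \<Longrightarrow> 0 \<le> g k" "1 \<le> p"
  shows "(\<Sum>k\<in>K. g k powr p) \<le> (\<Sum>k\<in>K. g k) powr p"
  using assms(1,2)
proof (induction K rule: finite_induct)
  case (insert x F)
  have "g x powr p + (\<Sum>k\<in>F. g k powr p) \<le> g x powr p + (\<Sum>k\<in>F. g k) powr p" using insert by auto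
  also have "\<dots> \<le> (g x + (\<Sum>k\<in>F. g k)) powr p"
    using insert assms by (intro powr_superadd) (auto intro: sum_nonneg)
  finally show ?case using insert by simp
qed (use assms in auto)

definition edge_energy :: "real \<Rightarrow> (int ^ 'n \<Rightarrow> real) \<Rightarrow> real" where
  "edge_energy p u = (\<Sum>\<^sub>\<infinity>(x, y)\<in>{(x, y). adj x y}. \<bar>u y - u x\<bar> powr p)"

definition increment_energy :: "real \<Rightarrow> (int ^ 'n \<Rightarrow> real) \<Rightarrow> int ^ 'n \<Rightarrow> real" where
  "increment_energy p u z = (\<Sum>\<^sub>\<infinity>x\<in>UNIV. \<bar>u (x + z) - u x\<bar> powr p)"

lemma fin_supp_shift: assumes "u \<in> fin_supp" shows "finite {x. u (x + z) \<noteq> 0}"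
proof -
  have "finite ((\<lambda>x. x + z) -` {x. u x \<noteq> 0})"
    by (rule finite_vimageI) (use assms in \<open>auto simp: fin_supp_def inj_on_def\<close>)
  then show ?thesis by (simp add: vimage_def)
qed

lemma increment_summable:
  assumes "u \<in> fin_supp"
  shows "(\<lambda>x. \<bar>u (x + z) - u (x + w)\<bar> powr p) summable_on UNIV"
proof (rule finite_nonzero_values_imp_summable_on)
  have "{x \<in> UNIV. \<bar>u (x + z) - u (x + w)\<bar> powr p \<noteq> 0} \<subseteq> {x. u (x + z) \<noteq> 0} \<union> {x. u (x + w) \<noteq> 0}" by auto
  then show "finite {x \<in> UNIV. \<bar>u (x + z) - u (x + w)\<bar> powr p \<noteq> 0}"
    using fin_supp_shift[OF assms] by (meson finite_Un finite_subset)
qed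

lemma edge_summable:
  assumes "u \<in> fin_supp"
  shows "(\<lambda>(x, y). \<bar>u y - u x\<bar> powr p) summable_on {(x, y). adj x y}"
proof (rule finite_nonzero_values_imp_summable_on)
  have "{e \<in> {(x, y). adj x y}. (case e of (x, y) \<Rightarrow> \<bar>u y - u x\<bar> powr p) \<noteq> 0}
     \<subseteq> {(x, y). adj x y \<and> (x \<in> {x. u x \<noteq> 0} \<or> y \<in> {x. u x \<noteq> 0})}" by auto
  then show "finite {e \<in> {(x, y). adj x y}. (case e of (x, y) \<Rightarrow> \<bar>u y - u x\<bar> powr p) \<noteq> 0}"
    using finite_edges[of "{x. u x \<noteq> 0}"] assms by (simp add: fin_supp_def finite_subset)
qed

lemma edge_energy_nonneg: "0 \<le> edge_energy p u"
  unfolding edge_energy_def by (rule infsum_nonneg) auto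

lemma increment_unit:
  assumes u: "u \<in> fin_supp" and e: "adj 0 e"
  shows "increment_energy p u e \<le> edge_energy p u"
proof -
  have inj: "inj_on (\<lambda>x. (x, x + e)) UNIV" by (auto simp: inj_on_def)
  have sub: "range (\<lambda>x. (x, x + e)) \<subseteq> {(x, y). adj x y}"
    using e adj_translate[of 0 _ e] by (auto simp: add.commute)
  have "increment_energy p u e = infsum (\<lambda>(x, y). \<bar>u y - u x\<bar> powr p) (range (\<lambda>x. (x, x + e)))"
    unfolding increment_energy_def by (subst infsum_reindex[OF inj]) (simp add: o_def)
  also have "\<dots> \<le> edge_energy p u"
    unfolding edge_energy_def
    by (rule infsum_mono2) (use edge_summable[OF u] sub summable_on_subset_banach[OF edge_summable[OF u] sub] in auto)
  finally show ?thesis .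
qed

text \<open>A displacement of length \<open>n\<close> splits into \<open>n - 1\<close> steps and one more step, each unit step costing at most
  the whole edge energy; \<open>powr_add_split\<close> adds up the costs without losing a constant.\<close>
lemma increment_path:
  assumes u: "u \<in> fin_supp" and p: "1 \<le> p"
  shows "(\<Sum>i\<in>UNIV. \<bar>z $ i\<bar>) = int n \<Longrightarrow> increment_energy p u z \<le> real n powr p * edge_energy p u"
proof (induction n arbitrary: z)
  case 0
  then have "z = 0" by (simp add: sum_nonneg_eq_0_iff vec_eq_iff)
  then show ?case by (simp add: increment_energy_def)
next
  case (Suc n)
  have "\<exists>i. z $ i \<noteq> 0"
  proof (rule ccontr)
    assume "\<nexists>i. z $ i \<noteq> 0"
    then have "(\<Sum>i\<in>UNIV. \<bar>z $ i\<bar>) = 0" by simp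
    with Suc.prems show False by simp
  qed
  then obtain i where i: "z $ i \<noteq> 0" by blast
  define e where "e = axis i (sgn (z $ i))"
  define z' where "z' = z - e"
  have ei: "e $ j = (if j = i then sgn (z $ i) else 0)" for j by (simp add: e_def axis_def)
  have e1: "adj 0 e"
  proof -
    have "(\<Sum>j\<in>UNIV. \<bar>0 $ j - e $ j\<bar>) = (\<Sum>j\<in>UNIV. if j = i then 1 else 0)"
      by (rule sum.cong) (use i in \<open>auto simp: ei sgn_if\<close>)
    then show ?thesis by (simp add: adj_def)
  qed
  have "\<bar>z' $ j\<bar> = \<bar>z $ j\<bar> - (if j = i then 1 else 0)" for j
    using i by (auto simp: z'_def ei sgn_if)
  then have "(\<Sum>j\<in>UNIV. \<bar>z' $ j\<bar>) = int n" using Suc.prems by (simp add: sum_subtractf)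
  then have IH: "increment_energy p u z' \<le> real n powr p * edge_energy p u" by (rule Suc.IH)
  show ?case
  proof (cases "n = 0")
    case True
    then have "z' = 0" using \<open>(\<Sum>j\<in>UNIV. \<bar>z' $ j\<bar>) = int n\<close> by (simp add: sum_nonneg_eq_0_iff vec_eq_iff)
    then show ?thesis using increment_unit[OF u e1, of p] True by (simp add: z'_def)
  next
    case False
    define c where "c = (real n + 1) powr (p - 1)"
    have "increment_energy p u z \<le> (\<Sum>\<^sub>\<infinity>x\<in>UNIV. c * (real n powr (1 - p) * \<bar>u (x + z') - u x\<bar> powr p
         + \<bar>u (x + z' + e) - u (x + z')\<bar> powr p))"
      unfolding increment_energy_def
    proof (rule infsum_mono)
      show "(\<lambda>x. \<bar>u (x + z) - u x\<bar> powr p) summable_on UNIV" using increment_summable[OF u, of z 0] by simp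
      show "(\<lambda>x. c * (real n powr (1 - p) * \<bar>u (x + z') - u x\<bar> powr p
         + \<bar>u (x + z' + e) - u (x + z')\<bar> powr p)) summable_on UNIV"
        using increment_summable[OF u, of z' 0 p] increment_summable[OF u, of "z' + e" z' p]
        by (intro summable_on_cmult_right summable_on_add) (simp_all add: add.assoc)
      fix x
      have "\<bar>u (x + z) - u x\<bar> \<le> \<bar>u (x + z') - u x\<bar> + \<bar>u (x + z' + e) - u (x + z')\<bar>"
        by (simp add: z'_def)
      then have "\<bar>u (x + z) - u x\<bar> powr p \<le> (\<bar>u (x + z') - u x\<bar> + \<bar>u (x + z' + e) - u (x + z')\<bar>) powr p"
        using p by (intro powr_mono2) auto
      also have "\<dots> \<le> c * (real n powr (1 - p) * \<bar>u (x + z') - u x\<bar> powr p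
         + \<bar>u (x + z' + e) - u (x + z')\<bar> powr p)"
        unfolding c_def by (rule powr_add_split) (use p False in auto)
      finally show "\<bar>u (x + z) - u x\<bar> powr p \<le> c * (real n powr (1 - p) * \<bar>u (x + z') - u x\<bar> powr p
         + \<bar>u (x + z' + e) - u (x + z')\<bar> powr p)" .
    qed
    also have "\<dots> = c * (real n powr (1 - p) * increment_energy p u z' + increment_energy p u e)"
    proof -
      have "(\<Sum>\<^sub>\<infinity>x\<in>UNIV. \<bar>u (x + z' + e) - u (x + z')\<bar> powr p) = increment_energy p u e"
        unfolding increment_energy_def
        by (rule infsum_reindex_bij_betw[where g = "\<lambda>x. x + z'" and f = "\<lambda>x. \<bar>u (x + e) - u x\<bar> powr p"])
           (rule bij_plus_right)
      then show ?thesis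
        using increment_summable[OF u, of z' 0 p] increment_summable[OF u, of "z' + e" z' p]
        by (simp add: infsum_cmult_right' infsum_add summable_on_cmult_right increment_energy_def add.assoc)
    qed
    also have "\<dots> \<le> c * (real n powr (1 - p) * (real n powr p * edge_energy p u) + edge_energy p u)"
      unfolding c_def using IH increment_unit[OF u e1, of p]
      by (intro mult_left_mono add_mono) auto
    also have "\<dots> = c * (real n + 1) * edge_energy p u"
    proof -
      have "real n powr (1 - p) * real n powr p = real n" using False by (simp flip: powr_add)
      then have "real n powr (1 - p) * (real n powr p * edge_energy p u) = real n * edge_energy p u"
        by (simp only: mult.assoc[symmetric])
      then show ?thesis by (simp add: algebra_simps)
    qed
    also have "c * (real n + 1) = (real n + 1) powr p" by (simp add: c_def powr_diff)
    finally show ?thesis by (simp add: add.commute)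
  qed
qed

text \<open>The part of \<open>\<bar>t\<bar>\<close> between the heights \<open>l\<close> and \<open>2 * l\<close>.  Over the dyadic heights \<open>l * 2 ^ k\<close> these
  slices are stacked on each other, so that their energies add up to at most the energy of the function.\<close>
definition level_clip :: "real \<Rightarrow> real \<Rightarrow> real" where
  "level_clip l t = min (max (\<bar>t\<bar> - l) 0) l"

lemma level_clip_telescope:
  "0 < l \<Longrightarrow> (\<Sum>k<K. level_clip (l * 2 ^ k) t) = min (max (\<bar>t\<bar> - l) 0) (l * 2 ^ K - l)"
proof (induction K)
  case (Suc K)
  have "1 \<le> (2::real) ^ K" by simp
  then have M: "l \<le> l * 2 ^ K" using Suc.prems by (simp add: mult_le_cancel_left1)
  have *: "min (max (\<bar>t\<bar> - l) 0) (M - l) + min (max (\<bar>t\<bar> - M) 0) M = min (max (\<bar>t\<bar> - l) 0) (2 * M - l)"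
    if "l \<le> M" "0 < l" for M
    using that by (auto simp: min_def max_def)
  have "(\<Sum>k<Suc K. level_clip (l * 2 ^ k) t)
     = min (max (\<bar>t\<bar> - l) 0) (l * 2 ^ K - l) + min (max (\<bar>t\<bar> - l * 2 ^ K) 0) (l * 2 ^ K)"
    unfolding sum.lessThan_Suc Suc.IH[OF Suc.prems] by (simp only: level_clip_def)
  then show ?case using *[OF M Suc.prems] by (simp only: power_Suc mult.left_commute)
qed auto

lemma level_clip_mono: "\<bar>s\<bar> \<le> \<bar>t\<bar> \<Longrightarrow> level_clip l s \<le> level_clip l t"
  by (auto simp: level_clip_def min_def max_def)

lemma level_clip_sum_le:
  assumes l: "0 < l" and p: "1 \<le> p"
  shows "(\<Sum>k<K. \<bar>level_clip (l * 2 ^ k) s - level_clip (l * 2 ^ k) t\<bar> powr p) \<le> \<bar>s - t\<bar> powr p"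
proof -
  have *: "(\<Sum>k<K. \<bar>level_clip (l * 2 ^ k) s - level_clip (l * 2 ^ k) t\<bar> powr p) \<le> \<bar>s - t\<bar> powr p"
    if st: "\<bar>s\<bar> \<le> \<bar>t\<bar>" for s t
  proof -
    have "(\<Sum>k<K. \<bar>level_clip (l * 2 ^ k) s - level_clip (l * 2 ^ k) t\<bar> powr p)
        = (\<Sum>k<K. (level_clip (l * 2 ^ k) t - level_clip (l * 2 ^ k) s) powr p)"
      using level_clip_mono[OF st] by (intro sum.cong) (auto simp: abs_minus_commute)
    also have "\<dots> \<le> (\<Sum>k<K. level_clip (l * 2 ^ k) t - level_clip (l * 2 ^ k) s) powr p"
      using level_clip_mono[OF st] p by (intro sum_powr_superadd) auto
    also have "\<dots> \<le> \<bar>s - t\<bar> powr p"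
    proof (rule powr_mono2)
      show "(\<Sum>k<K. level_clip (l * 2 ^ k) t - level_clip (l * 2 ^ k) s) \<le> \<bar>s - t\<bar>"
        unfolding sum_subtractf level_clip_telescope[OF l] using st by (auto simp: min_def max_def)
      show "0 \<le> (\<Sum>k<K. level_clip (l * 2 ^ k) t - level_clip (l * 2 ^ k) s)"
        using level_clip_mono[OF st] by (intro sum_nonneg) auto
    qed (use p in auto)
    finally show ?thesis .
  qed
  show ?thesis
  proof (cases "\<bar>s\<bar> \<le> \<bar>t\<bar>")
    case True then show ?thesis by (rule *)
  next
    case False
    then show ?thesis using *[of t s] by (simp add: abs_minus_commute)
  qed
qed

text \<open>A capacity estimate.  The slice at height \<open>l\<close> equals \<open>l\<close> on the upper level set \<open>A'\<close> and \<open>0\<close> outside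
  the lower one \<open>A\<close>.  A box with at least \<open>2 * card A\<close> points carries every point of \<open>A'\<close> out of \<open>A\<close> for at
  least half of its displacements, so the increments over the box are large; they are also bounded by the
  energy through \<open>increment_path\<close>.\<close>
lemma level_capacity:
  fixes u :: "int ^ 'n \<Rightarrow> real"
  assumes u: "u \<in> fin_supp" and p: "1 \<le> p" and l: "0 < l"
  defines "a \<equiv> real (card {x. l \<le> \<bar>u x\<bar>})" and "N \<equiv> real CARD('n)"
  shows "l powr p * real (card {x. 2 * l \<le> \<bar>u x\<bar>})
    \<le> 2 * (2 * N) powr p * 2 powr (p / N) * a powr (p / N) * edge_energy p (\<lambda>x. level_clip l (u x))"
proof (cases "{x. l \<le> \<bar>u x\<bar>} = {}")
  case True
  have "{x. 2 * l \<le> \<bar>u x\<bar>} \<subseteq> {x. l \<le> \<bar>u x\<bar>}" using l by auto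
  then have "{x. 2 * l \<le> \<bar>u x\<bar>} = {}" using True by blast
  moreover have "0 \<le> 2 * (2 * N) powr p * 2 powr (p / N) * a powr (p / N) * edge_energy p (\<lambda>x. level_clip l (u x))"
    by (intro mult_nonneg_nonneg edge_energy_nonneg) auto
  ultimately show ?thesis by simp
next
  case False
  define A where "A = {x. l \<le> \<bar>u x\<bar>}"
  define A' where "A' = {x. 2 * l \<le> \<bar>u x\<bar>}"
  define w where "w = (\<lambda>x. level_clip l (u x))"
  have finA: "finite A"
    by (rule finite_subset[of _ "{x. u x \<noteq> 0}"]) (use u l in \<open>auto simp: A_def fin_supp_def\<close>)
  have A'A: "A' \<subseteq> A" using l by (auto simp: A_def A'_def)
  have finA': "finite A'" using finite_subset[OF A'A finA] .
  have "card A \<noteq> 0" using False finA by (simp add: A_def)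
  then have a1: "1 \<le> a" by (simp add: a_def A_def)
  have N1: "1 \<le> N" by (simp add: N_def)
  have w: "w \<in> fin_supp"
  proof -
    have "{x. w x \<noteq> 0} \<subseteq> {x. u x \<noteq> 0}" using l by (auto simp: w_def level_clip_def)
    then show ?thesis using u by (auto simp: fin_supp_def intro: finite_subset)
  qed
  have w1: "w x = l" if "x \<in> A'" for x using that l by (simp add: w_def A'_def level_clip_def)
  have w0: "w x = 0" if "x \<notin> A" for x using that l by (simp add: w_def A_def level_clip_def)
  \<comment> \<open>The side \<open>r\<close> of the box is the least integer with \<open>r ^ N \<ge> 2 * a\<close>; it is at most \<open>2 * t\<close> as \<open>t \<ge> 1\<close>.\<close>
  define t where "t = (2 * a) powr (1 / N)"
  have t1: "1 \<le> t" unfolding t_def using a1 N1 by (intro ge_one_powr_ge_zero) auto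
  define r where "r = nat \<lceil>t\<rceil>"
  have r: "t \<le> real r" "real r \<le> 2 * t" "1 \<le> r" using t1 unfolding r_def by linarith+
  have tN: "t powr N = 2 * a" unfolding t_def using a1 N1 by (simp add: powr_powr)
  have rN: "2 * a \<le> real r ^ CARD('n)"
  proof -
    have "2 * a \<le> real r powr N" unfolding tN[symmetric] using r t1 N1 by (intro powr_mono2) auto
    then show ?thesis using r by (simp add: N_def powr_realpow)
  qed
  define Q where "Q = {z :: int ^ 'n. \<forall>i. 0 \<le> z $ i \<and> z $ i < int r}"
  have cQ: "card Q = r ^ CARD('n)" and fQ: "finite Q"
    unfolding Q_def using card_int_box[where a = 0 and b = "int r" and 'n = 'n] by auto
  have upper: "increment_energy p w z \<le> (N * real r) powr p * edge_energy p w" if "z \<in> Q" for z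
  proof -
    define n where "n = nat (\<Sum>i\<in>UNIV. \<bar>z $ i\<bar>)"
    have n: "(\<Sum>i\<in>UNIV. \<bar>z $ i\<bar>) = int n" unfolding n_def by (simp add: sum_nonneg)
    have "(\<Sum>i\<in>UNIV. \<bar>z $ i\<bar>) \<le> (\<Sum>i\<in>(UNIV::'n set). int r)"
      using that by (intro sum_mono) (auto simp: Q_def intro: less_imp_le)
    then have "int n \<le> int (CARD('n) * r)" using n by simp
    then have "n \<le> CARD('n) * r" by (simp only: of_nat_le_iff)
    then have "real n \<le> N * real r" unfolding N_def by (metis of_nat_le_iff of_nat_mult)
    then have "real n powr p * edge_energy p w \<le> (N * real r) powr p * edge_energy p w"
      using p by (intro mult_right_mono powr_mono2 edge_energy_nonneg) auto
    then show ?thesis using increment_path[OF w p n] by linarith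
  qed
  have "l powr p * real (card A') * (real r ^ CARD('n) / 2)
     = (\<Sum>x\<in>A'. l powr p * (real r ^ CARD('n) / 2))" by simp
  also have "\<dots> \<le> (\<Sum>x\<in>A'. l powr p * (real r ^ CARD('n) - a))"
    using rN by (intro sum_mono mult_left_mono) auto
  also have "\<dots> \<le> (\<Sum>x\<in>A'. \<Sum>z\<in>Q. \<bar>w (x + z) - w x\<bar> powr p)"
  proof (rule sum_mono)
    fix x assume x: "x \<in> A'"
    define Z where "Z = {z \<in> Q. x + z \<in> A}"
    have "card Z = card ((\<lambda>z. x + z) ` Z)" by (rule card_image[symmetric]) (auto simp: inj_on_def)
    also have "\<dots> \<le> card A" by (rule card_mono[OF finA]) (auto simp: Z_def)
    finally have cZ: "real (card Z) \<le> a" by (simp add: a_def A_def)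
    have "real (card (Q - Z)) = real (card Q) - real (card Z)"
      using fQ by (subst card_Diff_subset) (auto simp: Z_def intro!: of_nat_diff card_mono)
    then have "l powr p * (real r ^ CARD('n) - a) \<le> l powr p * real (card (Q - Z))"
      using cZ cQ by (intro mult_left_mono) auto
    also have "\<dots> = (\<Sum>z\<in>Q - Z. \<bar>w (x + z) - w x\<bar> powr p)"
      using w1[OF x] w0 l by (simp add: Z_def)
    also have "\<dots> \<le> (\<Sum>z\<in>Q. \<bar>w (x + z) - w x\<bar> powr p)" by (rule sum_mono2) (use fQ in auto)
    finally show "l powr p * (real r ^ CARD('n) - a) \<le> (\<Sum>z\<in>Q. \<bar>w (x + z) - w x\<bar> powr p)" .
  qed
  also have "\<dots> = (\<Sum>z\<in>Q. \<Sum>x\<in>A'. \<bar>w (x + z) - w x\<bar> powr p)" by (rule sum.swap)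
  also have "\<dots> \<le> (\<Sum>z\<in>Q. (N * real r) powr p * edge_energy p w)"
  proof (rule sum_mono)
    fix z assume z: "z \<in> Q"
    have "(\<Sum>x\<in>A'. \<bar>w (x + z) - w x\<bar> powr p) \<le> increment_energy p w z"
      unfolding increment_energy_def
      using increment_summable[OF w, of z 0 p] finA' by (intro finite_sum_le_infsum) auto
    then show "(\<Sum>x\<in>A'. \<bar>w (x + z) - w x\<bar> powr p) \<le> (N * real r) powr p * edge_energy p w"
      using upper[OF z] by linarith
  qed
  also have "\<dots> = real r ^ CARD('n) * ((N * real r) powr p * edge_energy p w)" by (simp add: cQ)
  finally have "real r ^ CARD('n) * (l powr p * real (card A')) \<le> real r ^ CARD('n) * (2 * ((N * real r) powr p * edge_energy p w))"
    by (simp add: algebra_simps)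
  then have "l powr p * real (card A') \<le> 2 * ((N * real r) powr p * edge_energy p w)"
    using r by (simp add: mult_le_cancel_left)
  also have "\<dots> \<le> 2 * ((N * (2 * t)) powr p * edge_energy p w)"
    using r N1 p by (intro mult_left_mono mult_right_mono powr_mono2 edge_energy_nonneg) auto
  also have "(N * (2 * t)) powr p = (2 * N) powr p * t powr p"
    using N1 t1 by (simp add: powr_mult mult_ac)
  also have "t powr p = 2 powr (p / N) * a powr (p / N)"
    unfolding t_def using a1 N1 by (simp add: powr_powr powr_mult)
  finally show ?thesis by (simp add: A'_def w_def mult_ac)
qed

text \<open>With \<open>b k = (l * 2 ^ k) powr pstar * card {x. l * 2 ^ k \<le> \<bar>u x\<bar>}\<close>, written \<open>be k\<close> below, the sum \<open>S\<close> of the \<open>b k\<close> is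
  comparable to the left-hand side.  Since \<open>pstar * (p / N) = pstar - p\<close>, the capacity estimate reads
  \<open>b (k + 1) \<le> c * b k powr (p / N) * E k\<close> with the slice energies \<open>E k\<close>, whose sum is at most the edge
  energy.  Summing gives \<open>S \<le> b 0 + c * S powr (p / N) * energy\<close>, and \<open>p < N\<close> allows to divide by the power.\<close>
theorem discrete_Sobolev:
  fixes p pstar :: real
  assumes p: "1 \<le> p" "p < real CARD('n)" and pstar: "pstar = real CARD('n) * p / (real CARD('n) - p)"
  obtains C where "0 < C" "\<And>u :: int ^ 'n \<Rightarrow> real. u \<in> fin_supp \<Longrightarrow>
    (\<Sum>x | u x \<noteq> 0. \<bar>u x\<bar> powr pstar) \<le> C * edge_energy p u powr (pstar / p)"
proof -
  define N where "N = real CARD('n)"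
  define C1 where "C1 = 2 * (2 * N) powr p * 2 powr (p / N)"
  define C2 where "C2 = 2 * (2 powr pstar * C1)"
  define C where "C = 2 powr pstar * C2 powr (pstar / p)"
  have Np: "0 < N - p" "0 < N" using p by (auto simp: N_def)
  have ps: "0 < pstar" "pstar * (p / N) = pstar - p" "1 - p / N = p / pstar"
    using p Np by (auto simp: pstar N_def[symmetric] field_simps power2_eq_square)
  have C1: "0 < C1" using Np by (simp add: C1_def)
  have C2: "0 < C2" using C1 by (simp add: C2_def)
  have C: "0 < C" using C2 by (simp add: C_def)
  have main: "(\<Sum>x | u x \<noteq> 0. \<bar>u x\<bar> powr pstar) \<le> C * edge_energy p u powr (pstar / p)"
    if u: "u \<in> fin_supp" for u :: "int ^ 'n \<Rightarrow> real"
  proof (cases "{x. u x \<noteq> 0} = {}")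
    case True
    have "0 \<le> C * edge_energy p u powr (pstar / p)" using C by simp
    then show ?thesis unfolding True by simp
  next
    case False
    define B where "B = {x. u x \<noteq> 0}"
    define U where "U = (\<Sum>x\<in>B. \<bar>u x\<bar> powr pstar)"
    have finB: "finite B" and B0: "B \<noteq> {}" using u False by (auto simp: B_def fin_supp_def)
    have U: "0 < U" unfolding U_def by (rule sum_pos) (use finB B0 in \<open>auto simp: B_def\<close>)
    define b where "b = real (card B)"
    have b: "0 < b" using finB B0 by (simp add: b_def card_gt_0_iff)
    define m where "m = Min ((\<lambda>x. \<bar>u x\<bar>) ` B)"
    have m: "0 < m" "\<And>x. x \<in> B \<Longrightarrow> m \<le> \<bar>u x\<bar>"
      unfolding m_def using finB B0 by (auto simp: B_def)
    \<comment> \<open>The lowest height exceeds no nonzero value of \<open>\<bar>u\<bar>\<close>, and is so low that \<open>be 0 \<le> S / 2\<close> can be absorbed.\<close>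
    define l where "l = min m ((U / (2 * 2 powr pstar * b)) powr (1 / pstar))"
    have l: "0 < l" "l \<le> m" "l powr pstar * b \<le> U / (2 * 2 powr pstar)"
    proof -
      show "0 < l" "l \<le> m" using m(1) U b by (auto simp: l_def)
      have "l powr pstar \<le> ((U / (2 * 2 powr pstar * b)) powr (1 / pstar)) powr pstar"
        using \<open>0 < l\<close> ps(1) by (intro powr_mono2) (auto simp: l_def)
      also have "\<dots> = U / (2 * 2 powr pstar * b)" using ps(1) U b by (simp add: powr_powr)
      finally show "l powr pstar * b \<le> U / (2 * 2 powr pstar)" using b by (simp add: field_simps)
    qed
    define a where "a k = real (card {x. l * 2 ^ k \<le> \<bar>u x\<bar>})" for k
    define E where "E k = edge_energy p (\<lambda>x. level_clip (l * 2 ^ k) (u x))" for k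
    have E0: "0 \<le> E k" for k by (simp add: E_def edge_energy_nonneg)
    have lev0: "\<not> l * 2 ^ k \<le> 0" for k :: nat using l(1) by (simp add: not_le)
    have finlev: "finite {x. l * 2 ^ k \<le> \<bar>u x\<bar>}" for k
      by (rule finite_subset[OF _ finB]) (auto simp: B_def lev0)
    have cap: "(l * 2 ^ k) powr p * a (Suc k) \<le> C1 * a k powr (p / N) * E k" for k
      using level_capacity[OF u p(1), of "l * 2 ^ k"] l(1) by (simp add: a_def E_def C1_def N_def mult_ac)
    define be where "be k = (l * 2 ^ k) powr pstar * a k" for k
    have be0: "0 \<le> be k" for k by (simp add: be_def a_def)
    have step: "be (Suc k) \<le> 2 powr pstar * C1 * be k powr (p / N) * E k" for k
    proof -
      have lk: "0 < l * 2 ^ k" using l by simp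
      have "(l * 2 ^ Suc k) powr pstar = (2 * (l * 2 ^ k)) powr pstar" by (simp add: mult_ac)
      also have "(2 * c) powr pstar = 2 powr pstar * (c powr (pstar - p) * c powr p)" if "0 < c" for c :: real
        using that by (simp add: powr_mult flip: powr_add)
      note this[OF lk]
      finally have "be (Suc k) = 2 powr pstar * (l * 2 ^ k) powr (pstar - p) * ((l * 2 ^ k) powr p * a (Suc k))"
        by (simp add: be_def)
      also have "\<dots> \<le> 2 powr pstar * (l * 2 ^ k) powr (pstar - p) * (C1 * a k powr (p / N) * E k)"
        by (intro mult_left_mono cap) auto
      also have "(l * 2 ^ k) powr (pstar - p) = ((l * 2 ^ k) powr pstar) powr (p / N)"
        by (simp only: powr_powr ps(2))
      finally show ?thesis
        by (simp add: be_def powr_mult a_def mult_ac)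
    qed
    obtain K where K: "\<And>x. x \<in> B \<Longrightarrow> \<bar>u x\<bar> < l * 2 ^ K"
    proof -
      define M where "M = Max ((\<lambda>x. \<bar>u x\<bar>) ` B)"
      obtain K where "M / l < 2 ^ K" using real_arch_pow[of 2 "M / l"] by auto
      then have "M < l * 2 ^ K" using l(1) by (simp add: field_simps)
      moreover have "\<bar>u x\<bar> \<le> M" if "x \<in> B" for x unfolding M_def using finB that by auto
      ultimately show thesis using that by (meson le_less_trans)
    qed
    define S where "S = (\<Sum>k<Suc K. be k)"
    \<comment> \<open>Each nonzero value lies between two consecutive heights, hence is at most twice a height that it exceeds.\<close>
    have US: "U \<le> 2 powr pstar * S"
    proof -
      have "\<bar>u x\<bar> powr pstar \<le> (\<Sum>k<Suc K. if l * 2 ^ k \<le> \<bar>u x\<bar> then 2 powr pstar * (l * 2 ^ k) powr pstar else 0)"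
        if x: "x \<in> B" for x
      proof -
        have ex: "\<bar>u x\<bar> < l * 2 ^ K" using K[OF x] .
        define j where "j = (LEAST j. \<bar>u x\<bar> < l * 2 ^ j)"
        have j: "\<bar>u x\<bar> < l * 2 ^ j" unfolding j_def by (rule LeastI[of "\<lambda>j. \<bar>u x\<bar> < l * 2 ^ j", OF ex])
        have jK: "j \<le> K" unfolding j_def by (rule Least_le[of "\<lambda>j. \<bar>u x\<bar> < l * 2 ^ j", OF ex])
        have "j \<noteq> 0" using j m(2)[OF x] l(2) by (auto intro: gr0I)
        then obtain i where i: "j = Suc i" using not0_implies_Suc by blast
        have "\<not> \<bar>u x\<bar> < l * 2 ^ i" using not_less_Least[of i "\<lambda>j. \<bar>u x\<bar> < l * 2 ^ j"] i j_def by simp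
        then have li: "l * 2 ^ i \<le> \<bar>u x\<bar>" by simp
        have "\<bar>u x\<bar> powr pstar \<le> (2 * (l * 2 ^ i)) powr pstar"
          using j ps(1) by (intro powr_mono2) (auto simp: i mult_ac)
        also have "\<dots> = (if l * 2 ^ i \<le> \<bar>u x\<bar> then 2 powr pstar * (l * 2 ^ i) powr pstar else 0)"
          using l(1) li by (simp add: powr_mult)
        also have "\<dots> \<le> (\<Sum>k<Suc K. if l * 2 ^ k \<le> \<bar>u x\<bar> then 2 powr pstar * (l * 2 ^ k) powr pstar else 0)"
          by (rule member_le_sum) (use jK i in auto)
        finally show ?thesis .
      qed
      then have "U \<le> (\<Sum>x\<in>B. \<Sum>k<Suc K. if l * 2 ^ k \<le> \<bar>u x\<bar> then 2 powr pstar * (l * 2 ^ k) powr pstar else 0)"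
        unfolding U_def by (rule sum_mono)
      also have "\<dots> = (\<Sum>k<Suc K. \<Sum>x\<in>B. if l * 2 ^ k \<le> \<bar>u x\<bar> then 2 powr pstar * (l * 2 ^ k) powr pstar else 0)"
        by (rule sum.swap)
      also have "\<dots> = (\<Sum>k<Suc K. 2 powr pstar * be k)"
      proof (rule sum.cong)
        fix k
        have "B \<inter> {x. l * 2 ^ k \<le> \<bar>u x\<bar>} = {x. l * 2 ^ k \<le> \<bar>u x\<bar>}" by (auto simp: B_def lev0)
        then show "(\<Sum>x\<in>B. if l * 2 ^ k \<le> \<bar>u x\<bar> then 2 powr pstar * (l * 2 ^ k) powr pstar else 0) = 2 powr pstar * be k"
          using finB by (simp add: sum.If_cases be_def a_def)
      qed simp
      finally show ?thesis by (simp add: S_def sum_distrib_left del: sum.lessThan_Suc)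
    qed
    have S: "0 < S" using US U by (smt (verit) mult_nonneg_nonpos powr_ge_zero)
    have beS: "be k \<le> S" if "k < Suc K" for k
      unfolding S_def by (rule member_le_sum) (use that be0 in auto)
    have Esum: "(\<Sum>k<K. E k) \<le> edge_energy p u"
    proof -
      define P where "P = {(x, y). adj x y \<and> (x \<in> B \<or> y \<in> B)}"
      have finP: "finite P" unfolding P_def by (rule finite_edges[OF finB])
      have red: "edge_energy p g = (\<Sum>(x, y)\<in>P. \<bar>g y - g x\<bar> powr p)" if g: "\<And>x. x \<notin> B \<Longrightarrow> g x = 0" for g :: "int ^ 'n \<Rightarrow> real"
      proof -
        have "edge_energy p g = infsum (\<lambda>(x, y). \<bar>g y - g x\<bar> powr p) P"
          unfolding edge_energy_def
        proof (rule infsum_cong_neutral)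
          fix e assume e: "e \<in> {(x, y). adj x y} - P"
          then obtain x y where "e = (x, y)" "x \<notin> B" "y \<notin> B" by (auto simp: P_def)
          then show "(case e of (x, y) \<Rightarrow> \<bar>g y - g x\<bar> powr p) = 0" using g by simp
        qed (auto simp: P_def)
        then show ?thesis using finP by simp
      qed
      have "(\<Sum>k<K. E k) = (\<Sum>k<K. \<Sum>(x, y)\<in>P. \<bar>level_clip (l * 2 ^ k) (u y) - level_clip (l * 2 ^ k) (u x)\<bar> powr p)"
        unfolding E_def using l(1) by (intro sum.cong refl red) (auto simp: B_def level_clip_def)
      also have "\<dots> = (\<Sum>(x, y)\<in>P. \<Sum>k<K. \<bar>level_clip (l * 2 ^ k) (u y) - level_clip (l * 2 ^ k) (u x)\<bar> powr p)"
        by (subst sum.swap) (simp add: case_prod_unfold)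
      also have "\<dots> \<le> (\<Sum>(x, y)\<in>P. \<bar>u y - u x\<bar> powr p)"
        using level_clip_sum_le[OF l(1) p(1)] by (intro sum_mono) auto
      also have "\<dots> = edge_energy p u" by (rule red[symmetric]) (simp add: B_def)
      finally show ?thesis .
    qed
    have "S = be 0 + (\<Sum>k<K. be (Suc k))" unfolding S_def by (rule sum.lessThan_Suc_shift)
    also have "(\<Sum>k<K. be (Suc k)) \<le> (\<Sum>k<K. 2 powr pstar * C1 * S powr (p / N) * E k)"
    proof (rule sum_mono)
      fix k assume k: "k \<in> {..<K}"
      have "be k powr (p / N) \<le> S powr (p / N)"
        using beS[of k] k be0 p Np by (intro powr_mono2) auto
      then have "2 powr pstar * C1 * be k powr (p / N) * E k \<le> 2 powr pstar * C1 * S powr (p / N) * E k"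
        using C1 E0 by (intro mult_right_mono mult_left_mono) auto
      then show "be (Suc k) \<le> 2 powr pstar * C1 * S powr (p / N) * E k" using step[of k] by linarith
    qed
    also have "\<dots> = 2 powr pstar * C1 * S powr (p / N) * (\<Sum>k<K. E k)" by (simp add: sum_distrib_left)
    also have "\<dots> \<le> 2 powr pstar * C1 * S powr (p / N) * edge_energy p u"
      using C1 by (intro mult_left_mono Esum) auto
    finally have S1: "S \<le> be 0 + 2 powr pstar * C1 * S powr (p / N) * edge_energy p u" by simp
    have "be 0 \<le> l powr pstar * b"
    proof -
      have "{x. l \<le> \<bar>u x\<bar>} \<subseteq> B" using l(1) by (auto simp: B_def)
      then have "a 0 \<le> b" unfolding a_def b_def using finB by (simp add: card_mono)
      then show ?thesis by (simp add: be_def mult_left_mono)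
    qed
    also have "\<dots> \<le> U / (2 * 2 powr pstar)" by (rule l(3))
    also have "\<dots> \<le> S / 2" using US by (simp add: field_simps)
    finally have "S \<le> C2 * S powr (p / N) * edge_energy p u" using S1 by (simp add: C2_def)
    then have "S powr 1 / S powr (p / N) \<le> C2 * edge_energy p u"
      using S by (simp add: field_simps)
    then have "S powr (p / pstar) \<le> C2 * edge_energy p u"
      by (simp only: powr_diff[symmetric] ps(3))
    then have "(S powr (p / pstar)) powr (pstar / p) \<le> (C2 * edge_energy p u) powr (pstar / p)"
      using ps(1) p by (intro powr_mono2) auto
    then have "S \<le> C2 powr (pstar / p) * edge_energy p u powr (pstar / p)"
      using S ps(1) p C2 by (simp add: powr_powr powr_mult edge_energy_nonneg)
    then have "2 powr pstar * S \<le> C * edge_energy p u powr (pstar / p)"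
      by (simp add: C_def mult.assoc)
    then show ?thesis using US by (simp add: U_def B_def)
  qed
  show thesis using that[OF C main] .
qed

section \<open>The nonlinearity\<close>

locale periodic_problem =
  fixes T :: int and p pstar :: real
    and V :: "int ^ 'n \<Rightarrow> real" and f :: "int ^ 'n \<Rightarrow> real \<Rightarrow> real"
  assumes p2: "2 \<le> p" and pN: "p < real CARD('n)"
    and pstar: "pstar = real CARD('n) * p / (real CARD('n) - p)"
    and T_pos: "0 < T" and V_per: "lattice_periodic T V" and f_per: "\<forall>t. lattice_periodic T (\<lambda>x. f x t)"
    and V_INF: "0 \<le> (INF x. V x)"
    and f_cont: "\<forall>x. continuous_on UNIV (f x)"
    and f_growth: "\<exists>a q. a > 0 \<and> q > pstar \<and> (\<forall>x t. \<bar>f x t\<bar> \<le> a * (1 + \<bar>t\<bar> powr (q - 1)))"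
    and f_zero: "uniform_limit UNIV (\<lambda>t x. f x t / \<bar>t\<bar> powr (pstar - 1)) (\<lambda>x. 0) (at 0)"
    and f_mono: "\<forall>x. strict_mono_on ({..<0} \<union> {0<..}) (\<lambda>t. f x t / \<bar>t\<bar> powr (p - 1))"
    and f_super: "\<forall>M. \<forall>\<^sub>F t in at_infinity. \<forall>x. primitive f x t / \<bar>t\<bar> powr p \<ge> M"
    and f_odd: "\<forall>x u. f x (- u) = - f x u"
begin

lemma pstar_gt: "p < pstar"
  using p2 pN by (simp add: pstar field_simps)

lemma f_0 [simp]: "f x 0 = 0"
  using f_odd[rule_format, of x 0] by simp

lemma f_minus: "f x (- t) = - f x t"
  using f_odd by blast

lemma lattice_periodic_shift:
  fixes h :: "int ^ 'n \<Rightarrow> 'b"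
  assumes per: "lattice_periodic T h"
  shows "h (x + T *s k) = h x"
proof -
  have nat_step: "h (x + int m *s axis i T) = h x" for m x and i :: 'n
  proof (induction m)
    case (Suc m)
    have "x + int (Suc m) *s axis i T = (x + int m *s axis i T) + axis i T"
      by (simp add: vec_eq_iff algebra_simps)
    moreover have "h ((x + int m *s axis i T) + axis i T) = h (x + int m *s axis i T)"
      using per by (simp only: lattice_periodic_def)
    ultimately show ?case using Suc by (simp only:)
  qed simp
  have int_step: "h (x + m *s axis i T) = h x" for m x and i :: 'n
  proof (cases "m \<ge> 0")
    case True
    then show ?thesis using nat_step[of x "nat m" i] by simp
  next
    case False
    then have "(x + m *s axis i T) + int (nat (- m)) *s axis i T = x"
      by (simp add: vec_eq_iff)
    then show ?thesis using nat_step[of "x + m *s axis i T" "nat (- m)" i] by (simp only:)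
  qed
  have "h (x + (\<Sum>i\<in>I. (k $ i) *s axis i T)) = h x" if "finite I" for I
    using that
  proof (induction I rule: finite_induct)
    case (insert i I)
    have "x + (\<Sum>i\<in>insert i I. (k $ i) *s axis i T) = (x + (\<Sum>i\<in>I. (k $ i) *s axis i T)) + (k $ i) *s axis i T"
      using insert by (simp add: algebra_simps)
    then show ?case using insert.IH int_step by (simp only:)
  qed simp
  moreover have "(\<Sum>i\<in>UNIV. (k $ i) *s axis i T) = T *s k"
    by (simp add: vec_eq_iff axis_def if_distrib sum.If_cases cong: if_cong)
  ultimately show ?thesis by (metis finite)
qed

lemma V_shift [simp]: "V (x + T *s k) = V x"
  by (rule lattice_periodic_shift[OF V_per])

lemma f_shift [simp]: "f (x + T *s k) = f x"
  using lattice_periodic_shift[of "\<lambda>x. f x t" for t] f_per by blast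

text \<open>A fundamental domain of the periods.  Suprema and moduli over all sites reduce to finitely many sites.\<close>
definition cell :: "(int ^ 'n) set" where "cell = {z. \<forall>i. 0 \<le> z $ i \<and> z $ i < T}"

lemma finite_cell: "finite cell"
  unfolding cell_def by (rule card_int_box)

lemma to_cell: obtains k where "x + T *s k \<in> cell"
proof -
  have "x + T *s (\<chi> i. - (x $ i div T)) \<in> cell"
  proof -
    have "x $ i + T * (- (x $ i div T)) = x $ i mod T" for i
      by (simp add: minus_mult_div_eq_mod flip: minus_div_mult_eq_mod)
    then show ?thesis using T_pos by (simp add: cell_def)
  qed
  then show thesis by (rule that)
qed

text \<open>The infimum bounds \<open>V\<close> from below only because periodicity makes the range of \<open>V\<close> finite.\<close>
lemma V_nonneg: "0 \<le> V x"
proof -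
  have "range V \<subseteq> V ` cell"
  proof clarify
    fix x obtain k where "x + T *s k \<in> cell" by (rule to_cell)
    then show "V x \<in> V ` cell" by (metis V_shift image_eqI)
  qed
  then have "finite (range V)" using finite_cell finite_subset by blast
  then have "bdd_below (range V)" by simp
  then have "(INF x. V x) \<le> V x" by (rule cINF_lower) simp
  then show ?thesis using V_INF by linarith
qed

lemma V_bounded: obtains K where "0 \<le> K" "\<And>x. V x \<le> K"
proof -
  define K where "K = (\<Sum>x\<in>cell. V x)"
  have "V x \<le> K" for x
  proof -
    obtain k where k: "x + T *s k \<in> cell" by (rule to_cell)
    have "V (x + T *s k) \<le> K" unfolding K_def by (rule member_le_sum) (use k finite_cell V_nonneg in auto)
    then show ?thesis by simp
  qed
  moreover have "0 \<le> K" unfolding K_def by (intro sum_nonneg V_nonneg)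
  ultimately show thesis using that by blast
qed

lemma f_small:
  assumes "0 < e" obtains d where "0 < d" "\<And>x t. \<bar>t\<bar> \<le> d \<Longrightarrow> \<bar>f x t\<bar> \<le> e * \<bar>t\<bar> powr (pstar - 1)"
proof -
  have "\<forall>\<^sub>F t in at 0. \<forall>x\<in>UNIV. dist (f x t / \<bar>t\<bar> powr (pstar - 1)) 0 < e"
    by (rule uniform_limitD[OF f_zero assms])
  then obtain d where d: "0 < d" "\<And>t x. t \<noteq> 0 \<Longrightarrow> \<bar>t\<bar> < d \<Longrightarrow> \<bar>f x t / \<bar>t\<bar> powr (pstar - 1)\<bar> < e"
    by (auto simp: eventually_at dist_real_def)
  have "\<bar>f x t\<bar> \<le> e * \<bar>t\<bar> powr (pstar - 1)" if "\<bar>t\<bar> \<le> d / 2" for x t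
  proof (cases "t = 0")
    case False
    then have "\<bar>f x t / \<bar>t\<bar> powr (pstar - 1)\<bar> < e" using d that by auto
    then show ?thesis using False by (simp add: abs_divide field_simps)
  qed simp
  then show thesis using that[of "d / 2"] d(1) by simp
qed

lemma f_ratio_mono: "0 < s \<Longrightarrow> s < t \<Longrightarrow> f x s / s powr (p - 1) < f x t / t powr (p - 1)"
  using strict_mono_onD[OF f_mono[rule_format, of x], of s t] by simp

text \<open>The quotient \<open>f x t / t powr (p - 1)\<close> increases strictly in \<open>t > 0\<close>, and it tends to \<open>0\<close> as \<open>t\<close> tends to \<open>0\<close> because
  \<open>f x t\<close> is small compared with \<open>t powr (pstar - 1)\<close> and \<open>pstar > p\<close>.  A nonpositive value would make the
  quotient bounded away from \<open>0\<close> near \<open>0\<close>.\<close>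
lemma f_pos: assumes t: "0 < t" shows "0 < f x t"
proof (rule ccontr)
  assume "\<not> 0 < f x t"
  then have nonpos: "f x t / t powr (p - 1) \<le> 0" by (simp add: divide_nonpos_nonneg)
  define c where "c = - (f x (t / 2) / (t / 2) powr (p - 1))"
  have c: "0 < c" using f_ratio_mono[of "t / 2" t x] t nonpos by (simp add: c_def)
  obtain d where d: "0 < d" "\<And>x t. \<bar>t\<bar> \<le> d \<Longrightarrow> \<bar>f x t\<bar> \<le> 1 * \<bar>t\<bar> powr (pstar - 1)" using f_small[of 1] by auto
  define s where "s = Min {d, t / 4, c powr (1 / (pstar - p))}"
  have s: "0 < s" "s \<le> d" "s < t / 2" "s \<le> c powr (1 / (pstar - p))"
    using d(1) t c by (auto simp: s_def)
  have "f x s / s powr (p - 1) < - c" using f_ratio_mono[of s "t / 2" x] s by (simp add: c_def)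
  moreover have "- (f x s / s powr (p - 1)) \<le> s powr (pstar - 1) / s powr (p - 1)"
  proof -
    have "- f x s \<le> s powr (pstar - 1)" using d(2)[of s x] s by simp
    then have "- f x s / s powr (p - 1) \<le> s powr (pstar - 1) / s powr (p - 1)" by (rule divide_right_mono) simp
    then show ?thesis by simp
  qed
  moreover have "s powr (pstar - 1) / s powr (p - 1) = s powr (pstar - p)" by (simp flip: powr_diff)
  moreover have "s powr (pstar - p) \<le> (c powr (1 / (pstar - p))) powr (pstar - p)"
    using s pstar_gt by (intro powr_mono2) auto
  moreover have "(c powr (1 / (pstar - p))) powr (pstar - p) = c" using c pstar_gt by (simp add: powr_powr)
  ultimately show False by linarith
qed

lemma f_times_pos: assumes "t \<noteq> 0" shows "0 < f x t * t"
proof (cases "0 < t")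
  case True then show ?thesis using f_pos by simp
next
  case False
  then have "0 < f x (- t)" using assms by (intro f_pos) auto
  then show ?thesis using False assms by (simp add: f_minus mult_neg_neg)
qed

lemma f_times_nonneg: "0 \<le> f x t * t"
  using f_times_pos[of t x] by (cases "t = 0") auto

lemma f_bounded: obtains K where "0 \<le> K" "\<And>x t. \<bar>t\<bar> \<le> M \<Longrightarrow> \<bar>f x t\<bar> \<le> K"
proof -
  obtain a q where aq: "a > 0" "q > pstar" "\<And>x t. \<bar>f x t\<bar> \<le> a * (1 + \<bar>t\<bar> powr (q - 1))" using f_growth by blast
  have "\<bar>f x t\<bar> \<le> a * (1 + M powr (q - 1))" if "\<bar>t\<bar> \<le> M" for x t
  proof -
    have "\<bar>t\<bar> powr (q - 1) \<le> M powr (q - 1)" using that aq(2) pstar_gt p2 by (intro powr_mono2) auto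
    then have "a * (1 + \<bar>t\<bar> powr (q - 1)) \<le> a * (1 + M powr (q - 1))" using aq(1) by simp
    then show ?thesis using aq(3)[of x t] by linarith
  qed
  moreover have "0 \<le> a * (1 + M powr (q - 1))" using aq by simp
  ultimately show thesis using that by blast
qed

lemma f_equicontinuous:
  assumes e: "0 < e"
  obtains r where "0 < r" "\<And>x s t. \<bar>s\<bar> \<le> M \<Longrightarrow> \<bar>t\<bar> \<le> M \<Longrightarrow> \<bar>s - t\<bar> < r \<Longrightarrow> \<bar>f x s - f x t\<bar> < e"
proof -
  have "\<exists>r>0. \<forall>s t. \<bar>s\<bar> \<le> M \<longrightarrow> \<bar>t\<bar> \<le> M \<longrightarrow> \<bar>s - t\<bar> < r \<longrightarrow> \<bar>f x s - f x t\<bar> < e" for x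
  proof -
    have "continuous_on {-M..M} (f x)" using f_cont continuous_on_subset by blast
    then have "uniformly_continuous_on {-M..M} (f x)" by (intro compact_uniformly_continuous) auto
    then obtain r where "0 < r" "\<forall>s\<in>{-M..M}. \<forall>t\<in>{-M..M}. dist t s < r \<longrightarrow> dist (f x t) (f x s) < e"
      using e unfolding uniformly_continuous_on_def by blast
    then show ?thesis by (intro exI[of _ r]) (auto simp: dist_real_def abs_le_iff)
  qed
  then obtain r where r: "\<And>x. 0 < r x" "\<And>x s t. \<bar>s\<bar> \<le> M \<Longrightarrow> \<bar>t\<bar> \<le> M \<Longrightarrow> \<bar>s - t\<bar> < r x \<Longrightarrow> \<bar>f x s - f x t\<bar> < e"
    by metis
  define R where "R = Min (insert 1 (r ` cell))"
  have R: "0 < R" "\<And>x. x \<in> cell \<Longrightarrow> R \<le> r x" unfolding R_def using finite_cell r(1) by auto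
  have "\<bar>f x s - f x t\<bar> < e" if "\<bar>s\<bar> \<le> M" "\<bar>t\<bar> \<le> M" "\<bar>s - t\<bar> < R" for x s t
  proof -
    obtain k where k: "x + T *s k \<in> cell" by (rule to_cell)
    then show ?thesis using r(2)[of s t "x + T *s k"] R(2)[OF k] that by simp
  qed
  then show thesis using that R(1) by blast
qed

abbreviation F where "F \<equiv> primitive f"

lemma F_deriv: "(F x has_real_derivative f x t) (at t)"
proof -
  define M where "M = \<bar>t\<bar> + 1"
  have "((\<lambda>u. LBINT y=ereal 0..ereal u. f x y) has_vector_derivative f x t) (at t within {-M..M})"
    using f_cont by (intro interval_integral_FTC2) (auto simp: M_def intro: continuous_on_subset)
  moreover have "at t within {-M..M} = at t" by (rule at_within_interior) (auto simp: M_def)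
  ultimately show ?thesis
    by (simp add: has_real_derivative_iff_has_vector_derivative primitive_def[abs_def])
qed

lemma F_0 [simp]: "F x 0 = 0"
  by (simp add: primitive_def)

lemma F_cont: "continuous_on S (F x)"
  using F_deriv DERIV_continuous_on by (metis DERIV_subset UNIV_I subset_UNIV)

lemma F_shift [simp]: "F (x + T *s k) = F x"
  by (simp add: primitive_def[abs_def])

lemma F_minus: "F x (- t) = F x t"
proof -
  have "((\<lambda>t. F x (- t) - F x t) has_real_derivative 0) (at t)" for t
  proof -
    have "((\<lambda>t. F x (- t)) has_real_derivative (f x (- t) * - 1)) (at t)"
      by (rule DERIV_chain2[OF F_deriv]) (auto intro!: derivative_eq_intros)
    from DERIV_diff[OF this F_deriv[of x t]] show ?thesis by (simp add: f_minus)
  qed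
  then have "(\<lambda>t. F x (- t) - F x t) t = (\<lambda>t. F x (- t) - F x t) 0"
    by (intro DERIV_isconst_all) auto
  then show ?thesis by simp
qed

lemma F_abs: "F x \<bar>t\<bar> = F x t"
  by (simp add: abs_if F_minus)

lemma F_mvt: assumes "0 < t" obtains s where "0 < s" "s < t" "F x t = t * f x s"
  using MVT2[OF assms, of "F x" "f x"] F_deriv by auto

lemma F_nonneg: "0 \<le> F x t"
proof (cases "t = 0")
  case False
  then obtain s where "0 < s" "F x \<bar>t\<bar> = \<bar>t\<bar> * f x s" using F_mvt[of "\<bar>t\<bar>" x] by auto
  then show ?thesis using f_pos[of s x] by (simp add: F_abs)
qed simp

lemma F_small:
  assumes "0 < e" obtains d where "0 < d" "\<And>x t. \<bar>t\<bar> \<le> d \<Longrightarrow> F x t \<le> e * \<bar>t\<bar> powr pstar"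
    "\<And>x t. \<bar>t\<bar> \<le> d \<Longrightarrow> f x t * t \<le> e * \<bar>t\<bar> powr pstar"
proof -
  obtain d where d: "0 < d" "\<And>x t. \<bar>t\<bar> \<le> d \<Longrightarrow> \<bar>f x t\<bar> \<le> e * \<bar>t\<bar> powr (pstar - 1)" using f_small[OF assms] by blast
  have mul: "\<bar>t\<bar> * (e * \<bar>t\<bar> powr (pstar - 1)) = e * \<bar>t\<bar> powr pstar" for t
    by (cases "t = 0") (auto simp: powr_diff)
  have 1: "F x t \<le> e * \<bar>t\<bar> powr pstar" if t: "\<bar>t\<bar> \<le> d" for x t
  proof (cases "t = 0")
    case False
    then obtain s where s: "0 < s" "s < \<bar>t\<bar>" "F x \<bar>t\<bar> = \<bar>t\<bar> * f x s" using F_mvt[of "\<bar>t\<bar>" x] by auto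
    have "f x s \<le> e * s powr (pstar - 1)" using d(2)[of s x] s t by simp
    also have "\<dots> \<le> e * \<bar>t\<bar> powr (pstar - 1)"
      using s assms pstar_gt p2 by (intro mult_left_mono powr_mono2) auto
    finally have "\<bar>t\<bar> * f x s \<le> \<bar>t\<bar> * (e * \<bar>t\<bar> powr (pstar - 1))" by (rule mult_left_mono) auto
    then show ?thesis using s by (simp add: F_abs mul)
  qed simp
  have 2: "f x t * t \<le> e * \<bar>t\<bar> powr pstar" if t: "\<bar>t\<bar> \<le> d" for x t
  proof -
    have "f x t * t \<le> \<bar>t\<bar> * \<bar>f x t\<bar>" by (metis abs_ge_self abs_mult mult.commute)
    also have "\<dots> \<le> \<bar>t\<bar> * (e * \<bar>t\<bar> powr (pstar - 1))" using d(2)[OF t] by (intro mult_left_mono) auto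
    finally show ?thesis by (simp add: mul)
  qed
  show thesis using that[OF d(1) 1 2] .
qed

lemma F_superlinear: obtains B where "0 < B" "\<And>x t. B \<le> \<bar>t\<bar> \<Longrightarrow> M * \<bar>t\<bar> powr p \<le> F x t"
proof -
  obtain b where b: "\<And>t x. b \<le> \<bar>t\<bar> \<Longrightarrow> M \<le> F x t / \<bar>t\<bar> powr p"
    using f_super[rule_format, of M] unfolding eventually_at_infinity by (metis real_norm_def)
  have "M * \<bar>t\<bar> powr p \<le> F x t" if "max b 1 \<le> \<bar>t\<bar>" for x t
  proof -
    have "0 < \<bar>t\<bar> powr p" using that by auto
    then show ?thesis using b[of t x] that by (simp add: field_simps)
  qed
  then show thesis using that[of "max b 1"] by auto
qed

text \<open>If \<open>u\<close> lies on the Nehari manifold, then \<open>J (t * u) - J u\<close> is the sum over the sites of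
  \<open>ray_defect x (u x) t\<close>: the energy term \<open>(t powr p - 1) / p * En u\<close> is distributed over the sites by means
  of the Nehari identity (\<open>J_ray\<close>).\<close>
definition ray_defect :: "int ^ 'n \<Rightarrow> real \<Rightarrow> real \<Rightarrow> real" where
  "ray_defect x a t = (t powr p - 1) / p * (f x a * a) - F x (t * a) + F x a"

lemma ray_defect_minus: "ray_defect x (- a) t = ray_defect x a t"
  by (simp add: ray_defect_def f_minus F_minus)

lemma ray_defect_1 [simp]: "ray_defect x a 1 = 0"
  by (simp add: ray_defect_def)

lemma ray_defect_cont: "continuous_on {0..} (ray_defect x a)"
  unfolding ray_defect_def
  by (intro continuous_intros continuous_on_powr' continuous_on_compose2[OF F_cont[of UNIV]]) (use p2 in auto)

lemma ray_defect_deriv: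
  assumes "0 < t"
  shows "(ray_defect x a has_real_derivative (t powr (p - 1) * (f x a * a) - f x (t * a) * a)) (at t)"
  unfolding ray_defect_def
  using p2 assms by (auto intro!: derivative_eq_intros DERIV_chain2[OF F_deriv])

text \<open>The derivative in \<open>t\<close> is a positive multiple of
  \<open>f x a / a powr (p - 1) - f x (t * a) / (t * a) powr (p - 1)\<close> when \<open>a > 0\<close>, whose sign changes exactly at
  \<open>t = 1\<close>; negative \<open>a\<close> follow by symmetry.\<close>
lemma ray_defect_strict:
  assumes a: "a \<noteq> 0"
  shows "0 \<le> s \<Longrightarrow> s < t \<Longrightarrow> t \<le> 1 \<Longrightarrow> ray_defect x a s < ray_defect x a t"
    and "1 \<le> s \<Longrightarrow> s < t \<Longrightarrow> ray_defect x a t < ray_defect x a s"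
proof -
  have sgn: "(t powr (p - 1) * (f x b * b) - f x (t * b) * b)
      = t powr (p - 1) * b * b powr (p - 1) * (f x b / b powr (p - 1) - f x (t * b) / (t * b) powr (p - 1))"
    if "0 < b" "0 < t" for b t
    using that by (simp add: powr_mult field_simps)
  have up: "ray_defect x b s < ray_defect x b t" if "0 < b" "0 \<le> s" "s < t" "t \<le> 1" for b s t
  proof (rule DERIV_pos_imp_increasing_open[OF that(3)])
    show "continuous_on {s..t} (ray_defect x b)" by (rule continuous_on_subset[OF ray_defect_cont]) (use that in auto)
    fix r assume r: "s < r" "r < t"
    have "f x (r * b) / (r * b) powr (p - 1) < f x b / b powr (p - 1)"
      by (rule f_ratio_mono) (use that r in auto)
    then have "0 < r powr (p - 1) * (f x b * b) - f x (r * b) * b"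
      using that r by (subst sgn) auto
    then show "\<exists>y. (ray_defect x b has_real_derivative y) (at r) \<and> 0 < y"
      using ray_defect_deriv[of r x b] that r by (intro exI) auto
  qed
  have down: "ray_defect x b t < ray_defect x b s" if "0 < b" "1 \<le> s" "s < t" for b s t
  proof (rule DERIV_neg_imp_decreasing_open[OF that(3)])
    show "continuous_on {s..t} (ray_defect x b)" by (rule continuous_on_subset[OF ray_defect_cont]) (use that in auto)
    fix r assume r: "s < r" "r < t"
    have "f x b / b powr (p - 1) < f x (r * b) / (r * b) powr (p - 1)"
      by (rule f_ratio_mono) (use that r in auto)
    then have "r powr (p - 1) * (f x b * b) - f x (r * b) * b < 0"
      using that r by (subst sgn) (auto simp: mult_pos_neg)
    then show "\<exists>y. (ray_defect x b has_real_derivative y) (at r) \<and> y < 0"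
      using ray_defect_deriv[of r x b] that r by (intro exI) auto
  qed
  show "0 \<le> s \<Longrightarrow> s < t \<Longrightarrow> t \<le> 1 \<Longrightarrow> ray_defect x a s < ray_defect x a t"
    using up[of a s t] up[of "- a" s t] a by (cases "0 < a") (auto simp: ray_defect_minus)
  show "1 \<le> s \<Longrightarrow> s < t \<Longrightarrow> ray_defect x a t < ray_defect x a s"
    using down[of a s t] down[of "- a" s t] a by (cases "0 < a") (auto simp: ray_defect_minus)
qed

lemma ray_defect_zero [simp]: "ray_defect x 0 t = 0"
  by (simp add: ray_defect_def)

lemma ray_defect_mono:
  shows "0 \<le> s \<Longrightarrow> s \<le> t \<Longrightarrow> t \<le> 1 \<Longrightarrow> ray_defect x a s \<le> ray_defect x a t"
    and "1 \<le> s \<Longrightarrow> s \<le> t \<Longrightarrow> ray_defect x a t \<le> ray_defect x a s"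
  using ray_defect_strict[of a s t x] by (cases "a = 0"; cases "s = t"; simp add: less_imp_le)+

lemma ray_defect_nonpos: "0 \<le> t \<Longrightarrow> ray_defect x a t \<le> 0"
  using ray_defect_mono[of t 1 x a] ray_defect_mono(2)[of 1 t x a] by (cases "t \<le> 1") auto

text \<open>The density of \<open>J\<close> on the Nehari manifold (\<open>J_nehari\<close>); positivity is the case \<open>t = 0\<close> of \<open>ray_defect_strict\<close>.\<close>
definition G where "G x t = f x t * t / p - F x t"

lemma G_pos: "t \<noteq> 0 \<Longrightarrow> 0 < G x t"
  using ray_defect_strict(1)[of t 0 1 x] p2 by (simp add: ray_defect_def G_def)

lemma G_0 [simp]: "G x 0 = 0" by (simp add: G_def)

lemma G_nonneg: "0 \<le> G x t" using G_pos[of t x] by (cases "t = 0") auto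

lemma G_shift [simp]: "G (x + T *s k) = G x" by (simp add: G_def[abs_def])

lemma G_cont: "continuous_on S (G x)"
  unfolding G_def
  by (intro continuous_intros F_cont continuous_on_subset[OF f_cont[rule_format]]) (use p2 in auto)

end

section \<open>The energy functional and its residual\<close>

definition l1norm :: "('a \<Rightarrow> real) \<Rightarrow> real" where "l1norm w = (\<Sum>x | w x \<noteq> 0. \<bar>w x\<bar>)"

definition site_sum :: "('a \<Rightarrow> real \<Rightarrow> real) \<Rightarrow> ('a \<Rightarrow> real) \<Rightarrow> real" where
  "site_sum h u = (\<Sum>x | u x \<noteq> 0. h x (u x))"

lemma site_sum_eq:
  assumes "finite B" "\<And>x. x \<notin> B \<Longrightarrow> u x = 0" "\<And>x. h x 0 = 0"
  shows "site_sum h u = (\<Sum>x\<in>B. h x (u x))"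
  unfolding site_sum_def by (rule sum.mono_neutral_left) (use assms in auto)

lemma l1norm_eq: assumes "finite B" "\<And>x. x \<notin> B \<Longrightarrow> u x = 0" shows "l1norm u = (\<Sum>x\<in>B. \<bar>u x\<bar>)"
  unfolding l1norm_def by (rule sum.mono_neutral_left) (use assms in auto)

lemma l1norm_ge: assumes "u \<in> fin_supp" shows "\<bar>u x\<bar> \<le> l1norm u"
proof (cases "u x = 0")
  case True then show ?thesis by (simp add: l1norm_def sum_nonneg)
next
  case False
  then show ?thesis unfolding l1norm_def
    using assms by (intro member_le_sum[of x _ "\<lambda>x. \<bar>u x\<bar>"]) (auto simp: fin_supp_def)
qed

lemma fin_supp_add: "u \<in> fin_supp \<Longrightarrow> w \<in> fin_supp \<Longrightarrow> (\<lambda>x. u x + c * w x) \<in> fin_supp"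
  unfolding fin_supp_def by (rule CollectI, rule finite_subset[of _ "{x. u x \<noteq> 0} \<union> {x. w x \<noteq> 0}"]) auto

lemma fin_supp_scale: "u \<in> fin_supp \<Longrightarrow> (\<lambda>x. c * u x) \<in> fin_supp"
  unfolding fin_supp_def by (rule CollectI, rule finite_subset[of _ "{x. u x \<noteq> 0}"]) auto

lemma has_real_derivative_abs_powr:
  assumes p: "1 < p"
  shows "((\<lambda>t::real. \<bar>t\<bar> powr p) has_real_derivative p * (\<bar>t\<bar> powr (p - 2) * t)) (at t)"
proof -
  consider "t > 0" | "t < 0" | "t = 0" by linarith
  then show ?thesis
  proof cases
    case 1
    have "((\<lambda>t. t powr p) has_real_derivative p * t powr (p - 1)) (at t)"
      using 1 by (auto intro!: derivative_eq_intros)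
    then have "((\<lambda>t. \<bar>t\<bar> powr p) has_real_derivative p * t powr (p - 1)) (at t)"
      by (rule has_field_derivative_transform_within_open[where S = "{0<..}"]) (use 1 in auto)
    moreover have "t powr (p - 1) = t powr (p - 2) * t" using 1 powr_add[of t "p - 2" 1] by simp
    ultimately show ?thesis using 1 by simp
  next
    case 2
    have "((\<lambda>t. (- t) powr p) has_real_derivative - (p * (- t) powr (p - 1))) (at t)"
      using 2 by (auto intro!: derivative_eq_intros)
    then have "((\<lambda>t. \<bar>t\<bar> powr p) has_real_derivative - (p * (- t) powr (p - 1))) (at t)"
      by (rule has_field_derivative_transform_within_open[where S = "{..<0}"]) (use 2 in auto)
    moreover have "(- t) powr (p - 1) = (- t) powr (p - 2) * - t" using 2 powr_add[of "- t" "p - 2" 1] by simp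
    ultimately show ?thesis using 2 by simp
  next
    case 3
    have "((\<lambda>h. \<bar>h\<bar> powr (p - 1)) \<longlongrightarrow> 0) (at (0::real))"
    proof -
      have "((\<lambda>h. \<bar>h\<bar> powr (p - 1)) \<longlongrightarrow> \<bar>0\<bar> powr (p - 1)) (at (0::real))"
        using p by (intro tendsto_powr' tendsto_rabs tendsto_ident_at tendsto_const) auto
      then show ?thesis by simp
    qed
    then have "((\<lambda>h. \<bar>h\<bar> powr p / h) \<longlongrightarrow> 0) (at (0::real))"
    proof (rule Lim_null_comparison[rotated])
      have "norm (\<bar>h\<bar> powr p / h) = \<bar>h\<bar> powr (p - 1)" for h :: real
        by (cases "h = 0") (auto simp: powr_diff)
      then show "\<forall>\<^sub>F h in at (0::real). norm (\<bar>h\<bar> powr p / h) \<le> \<bar>h\<bar> powr (p - 1)" by simp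
    qed
    then show ?thesis using 3 by (simp add: DERIV_def)
  qed
qed

lemma continuous_on_abs_powr_mult:
  assumes p: "2 \<le> p" shows "continuous_on S (\<lambda>t::real. \<bar>t\<bar> powr (p - 2) * t)"
proof (cases "p = 2")
  case True
  show ?thesis by (rule continuous_on_eq[OF continuous_on_id]) (use True in auto)
next
  case False
  then show ?thesis using p by (intro continuous_intros continuous_on_powr') auto
qed

context periodic_problem
begin

definition En :: "(int ^ 'n \<Rightarrow> real) \<Rightarrow> real" where
  "En u = edge_energy p u / 2 + (\<Sum>\<^sub>\<infinity>x\<in>UNIV. V x * \<bar>u x\<bar> powr p)"

lemma E_norm_En: "E_norm p V u = En u powr (1 / p)"
proof -
  have "(\<Sum>\<^sub>\<infinity>(x, y)\<in>{(x, y). adj x y}. 1 / 2 * \<bar>u y - u x\<bar> powr p) = (1 / 2) * edge_energy p u"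
    unfolding edge_energy_def by (subst infsum_cmult_right'[symmetric]) (simp add: case_prod_unfold)
  then have "(\<Sum>\<^sub>\<infinity>(x, y)\<in>{(x, y). adj x y}. 1 / 2 * \<bar>u y - u x\<bar> powr p) = edge_energy p u / 2"
    by (simp only: mult_1 times_divide_eq_left)
  then show ?thesis by (simp only: E_norm_def En_def)
qed

definition edges :: "(int ^ 'n) set \<Rightarrow> ((int ^ 'n) \<times> (int ^ 'n)) set" where
  "edges B = {(x, y). adj x y \<and> (x \<in> B \<or> y \<in> B)}"

lemma En_eq:
  assumes B: "finite B" and u: "\<And>x. x \<notin> B \<Longrightarrow> u x = 0"
  shows "En u = (\<Sum>(x, y)\<in>edges B. \<bar>u y - u x\<bar> powr p) / 2 + (\<Sum>x\<in>B. V x * \<bar>u x\<bar> powr p)"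
proof -
  have "edge_energy p u = infsum (\<lambda>(x, y). \<bar>u y - u x\<bar> powr p) (edges B)"
    unfolding edge_energy_def
  proof (rule infsum_cong_neutral)
    fix e assume "e \<in> {(x, y). adj x y} - edges B"
    then obtain x y where "e = (x, y)" "x \<notin> B" "y \<notin> B" by (auto simp: edges_def)
    then show "(case e of (x, y) \<Rightarrow> \<bar>u y - u x\<bar> powr p) = 0" using u by simp
  qed (auto simp: edges_def)
  also have "\<dots> = (\<Sum>(x, y)\<in>edges B. \<bar>u y - u x\<bar> powr p)"
    using finite_edges[OF B] by (simp add: edges_def)
  finally have 1: "edge_energy p u = (\<Sum>(x, y)\<in>edges B. \<bar>u y - u x\<bar> powr p)" .
  have "(\<Sum>\<^sub>\<infinity>x\<in>UNIV. V x * \<bar>u x\<bar> powr p) = infsum (\<lambda>x. V x * \<bar>u x\<bar> powr p) B"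
    by (rule infsum_cong_neutral) (use u in auto)
  then show ?thesis using B 1 by (simp add: En_def)
qed

lemma edge_energy_le_En: assumes u: "u \<in> fin_supp" shows "edge_energy p u \<le> 2 * En u"
proof -
  have "0 \<le> (\<Sum>\<^sub>\<infinity>x\<in>UNIV. V x * \<bar>u x\<bar> powr p)" by (rule infsum_nonneg) (simp add: V_nonneg)
  then show ?thesis by (simp add: En_def)
qed

lemma En_nonneg: "0 \<le> En u"
  unfolding En_def using edge_energy_nonneg[of p u] by (auto intro!: add_nonneg_nonneg infsum_nonneg simp: V_nonneg)

lemma En_scale: assumes "0 \<le> t" shows "En (\<lambda>x. t * u x) = t powr p * En u"
proof -
  have "\<bar>t * u y - t * u x\<bar> powr p = t powr p * \<bar>u y - u x\<bar> powr p" for x y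
    using assms by (simp add: abs_mult powr_mult flip: right_diff_distrib)
  then have "edge_energy p (\<lambda>x. t * u x) = t powr p * edge_energy p u"
    unfolding edge_energy_def by (subst infsum_cmult_right'[symmetric]) (simp add: case_prod_unfold)
  moreover have "(\<Sum>\<^sub>\<infinity>x\<in>UNIV. V x * \<bar>t * u x\<bar> powr p) = t powr p * (\<Sum>\<^sub>\<infinity>x\<in>UNIV. V x * \<bar>u x\<bar> powr p)"
    using assms by (subst infsum_cmult_right'[symmetric]) (simp add: abs_mult powr_mult mult_ac)
  ultimately show ?thesis by (simp add: En_def algebra_simps)
qed

text \<open>The energy whose derivative in direction \<open>w\<close> pairs \<open>w\<close> with the residual of the equation (\<open>J_line_deriv\<close>).\<close>
definition J :: "(int ^ 'n \<Rightarrow> real) \<Rightarrow> real" where "J u = En u / p - site_sum F u"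

definition residual :: "(int ^ 'n \<Rightarrow> real) \<Rightarrow> int ^ 'n \<Rightarrow> real" where
  "residual u x = - p_laplacian p u x + V x * \<bar>u x\<bar> powr (p - 2) * u x - f x (u x)"

abbreviation kap :: "real \<Rightarrow> real" where "kap t \<equiv> \<bar>t\<bar> powr (p - 2) * t"

text \<open>Ordered edges come in pairs \<open>(x, y)\<close>, \<open>(y, x)\<close>, and \<open>kap\<close> is odd; swapping the two ends turns the terms
  with \<open>w y\<close> into minus those with \<open>w x\<close>.\<close>
lemma summation_by_parts:
  assumes B: "finite B" and w: "\<And>x. x \<notin> B \<Longrightarrow> w x = 0"
  shows "(\<Sum>(x, y)\<in>edges B. kap (v y - v x) * (w y - w x)) / 2 = (\<Sum>x\<in>B. - p_laplacian p v x * w x)"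
proof -
  have fin: "finite (edges B)" unfolding edges_def by (rule finite_edges[OF B])
  have wB: "w x \<noteq> 0 \<Longrightarrow> x \<in> B" for x using w by blast
  have swap: "(\<Sum>(x, y)\<in>edges B. kap (v y - v x) * w y) = (\<Sum>(x, y)\<in>edges B. kap (v x - v y) * w x)"
    by (rule sum.reindex_bij_witness[where i = prod.swap and j = prod.swap])
       (auto simp: edges_def adj_sym)
  have neg: "kap (v x - v y) = - kap (v y - v x)" for x y
    by (simp add: abs_minus_commute minus_mult_right)
  have "(\<Sum>(x, y)\<in>edges B. kap (v y - v x) * (w y - w x))
      = (\<Sum>(x, y)\<in>edges B. kap (v y - v x) * w y) - (\<Sum>(x, y)\<in>edges B. kap (v y - v x) * w x)"
    unfolding sum_subtractf[symmetric] by (rule sum.cong) (auto simp: right_diff_distrib)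
  also have "\<dots> = - 2 * (\<Sum>(x, y)\<in>edges B. kap (v y - v x) * w x)"
  proof -
    have "(\<Sum>(x, y)\<in>edges B. kap (v x - v y) * w x) = (\<Sum>(x, y)\<in>edges B. - (kap (v y - v x) * w x))"
    proof (rule sum.cong[OF refl])
      fix e :: "(int ^ 'n) \<times> (int ^ 'n)"
      show "(case e of (x, y) \<Rightarrow> kap (v x - v y) * w x) = (case e of (x, y) \<Rightarrow> - (kap (v y - v x) * w x))"
      proof -
        obtain a b where e: "e = (a, b)" by (cases e)
        show ?thesis unfolding e prod.case using neg[of a b] by (simp only: mult_minus_left)
      qed
    qed
    then show ?thesis unfolding swap by (simp add: case_prod_unfold sum_negf)
  qed
  also have "(\<Sum>(x, y)\<in>edges B. kap (v y - v x) * w x) = (\<Sum>(x, y)\<in>(SIGMA x:B. {y. adj x y}). kap (v y - v x) * w x)"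
    by (rule sum.mono_neutral_right[OF fin]) (auto simp: edges_def dest: wB)
  also have "\<dots> = (\<Sum>x\<in>B. \<Sum>y\<in>{y. adj x y}. kap (v y - v x) * w x)"
    by (rule sum.Sigma[symmetric]) (use B finite_adj in auto)
  also have "\<dots> = (\<Sum>x\<in>B. p_laplacian p v x * w x)"
    by (simp add: p_laplacian_def sum_distrib_right)
  finally show ?thesis by (simp add: sum_negf)
qed

lemma J_line_deriv:
  assumes u: "u \<in> fin_supp" and w: "w \<in> fin_supp"
  shows "((\<lambda>s. J (\<lambda>x. u x + s * w x)) has_real_derivative
     (\<Sum>x | w x \<noteq> 0. residual (\<lambda>x. u x + s * w x) x * w x)) (at s)"
proof -
  define B where "B = {x. u x \<noteq> 0} \<union> {x. w x \<noteq> 0}"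
  have B: "finite B" using u w by (simp add: B_def fin_supp_def)
  have u0: "u x = 0" and w0: "w x = 0" if "x \<notin> B" for x using that by (auto simp: B_def)
  let ?v = "\<lambda>s x. u x + s * w x"
  have eq: "J (?v s) = ((\<Sum>(x, y)\<in>edges B. \<bar>?v s y - ?v s x\<bar> powr p) / 2 + (\<Sum>x\<in>B. V x * \<bar>?v s x\<bar> powr p)) / p
      - (\<Sum>x\<in>B. F x (?v s x))" for s
    unfolding J_def by (subst En_eq[OF B], simp add: u0 w0, subst site_sum_eq[OF B]) (auto simp: u0 w0)
  have e: "((\<lambda>s. \<bar>?v s y - ?v s x\<bar> powr p) has_real_derivative p * (kap (?v s y - ?v s x) * (w y - w x))) (at s)" for x y
  proof -
    have "((\<lambda>s. ?v s y - ?v s x) has_real_derivative (w y - w x)) (at s)" by (auto intro!: derivative_eq_intros)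
    from DERIV_chain2[OF has_real_derivative_abs_powr this, of p] show ?thesis using p2 by (simp add: mult.assoc)
  qed
  have v: "((\<lambda>s. \<bar>?v s x\<bar> powr p) has_real_derivative p * (kap (?v s x) * w x)) (at s)" for x
  proof -
    have "((\<lambda>s. ?v s x) has_real_derivative w x) (at s)" by (auto intro!: derivative_eq_intros)
    from DERIV_chain2[OF has_real_derivative_abs_powr this, of p] show ?thesis using p2 by (simp add: mult.assoc)
  qed
  have Fd: "((\<lambda>s. F x (?v s x)) has_real_derivative f x (?v s x) * w x) (at s)" for x
    by (rule DERIV_chain2[OF F_deriv]) (auto intro!: derivative_eq_intros)
  have 1: "((\<lambda>s. J (?v s)) has_real_derivative
      ((\<Sum>(x, y)\<in>edges B. p * (kap (?v s y - ?v s x) * (w y - w x))) / 2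
         + (\<Sum>x\<in>B. V x * (p * (kap (?v s x) * w x)))) / p - (\<Sum>x\<in>B. f x (?v s x) * w x)) (at s)"
    unfolding eq case_prod_unfold
    by (intro DERIV_diff DERIV_cdivide DERIV_add DERIV_sum DERIV_cmult e v Fd)
  have "((\<Sum>(x, y)\<in>edges B. p * (kap (?v s y - ?v s x) * (w y - w x))) / 2
         + (\<Sum>x\<in>B. V x * (p * (kap (?v s x) * w x)))) / p
      = (\<Sum>(x, y)\<in>edges B. kap (?v s y - ?v s x) * (w y - w x)) / 2 + (\<Sum>x\<in>B. V x * (kap (?v s x) * w x))"
  proof -
    have "(\<Sum>(x, y)\<in>edges B. p * (kap (?v s y - ?v s x) * (w y - w x)))
        = p * (\<Sum>(x, y)\<in>edges B. kap (?v s y - ?v s x) * (w y - w x))"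
      by (simp add: sum_distrib_left case_prod_unfold)
    moreover have "(\<Sum>x\<in>B. V x * (p * (kap (?v s x) * w x))) = p * (\<Sum>x\<in>B. V x * (kap (?v s x) * w x))"
      by (simp add: sum_distrib_left mult_ac)
    ultimately show ?thesis using p2 by (simp add: add_divide_distrib)
  qed
  also have "(\<Sum>(x, y)\<in>edges B. kap (?v s y - ?v s x) * (w y - w x)) / 2 = (\<Sum>x\<in>B. - p_laplacian p (?v s) x * w x)"
    by (rule summation_by_parts[OF B w0])
  finally have "((\<Sum>(x, y)\<in>edges B. p * (kap (?v s y - ?v s x) * (w y - w x))) / 2
         + (\<Sum>x\<in>B. V x * (p * (kap (?v s x) * w x)))) / p - (\<Sum>x\<in>B. f x (?v s x) * w x)
      = (\<Sum>x\<in>B. residual (?v s) x * w x)"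
    by (simp add: residual_def algebra_simps sum.distrib sum_subtractf sum_negf)
  also have "\<dots> = (\<Sum>x | w x \<noteq> 0. residual (?v s) x * w x)"
    by (rule sum.mono_neutral_right[OF B]) (auto simp: B_def)
  finally show ?thesis using 1 by simp
qed

lemma J_mean_value:
  assumes u: "u \<in> fin_supp" and w: "w \<in> fin_supp"
  obtains s where "0 < s" "s < 1"
    "J (\<lambda>x. u x + w x) = J u + (\<Sum>x | w x \<noteq> 0. residual (\<lambda>x. u x + s * w x) x * w x)"
proof -
  have "\<exists>s>0. s < 1 \<and> J (\<lambda>x. u x + 1 * w x) - J (\<lambda>x. u x + 0 * w x)
      = (1 - 0) * (\<Sum>x | w x \<noteq> 0. residual (\<lambda>x. u x + s * w x) x * w x)"
    by (rule MVT2[of 0 1 "\<lambda>s. J (\<lambda>x. u x + s * w x)"]) (simp_all only: zero_less_one J_line_deriv[OF u w])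
  then show thesis using that by auto
qed

definition degree_bound :: real where "degree_bound = real (card {y. adj (0 :: int ^ 'n) y})"

lemma card_adj: "real (card {y. adj x y}) = degree_bound" for x :: "int ^ 'n"
proof -
  have "{y. adj x y} = (\<lambda>y. y + x) ` {y. adj 0 y}"
  proof (rule Set.set_eqI)
    fix y
    have "adj x y \<longleftrightarrow> adj 0 (y - x)" using adj_translate[of 0 x "y - x"] by simp
    then show "y \<in> {y. adj x y} \<longleftrightarrow> y \<in> (\<lambda>y. y + x) ` {y. adj 0 y}"
      by (auto intro: image_eqI[of _ _ "y - x"])
  qed
  moreover have "card ((\<lambda>y. y + x) ` {y. adj 0 y}) = card {y. adj (0 :: int ^ 'n) y}"
    by (rule card_image) (auto simp: inj_on_def)
  ultimately show ?thesis by (simp add: degree_bound_def)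
qed

lemma degree_bound_nonneg: "0 \<le> degree_bound" by (simp add: degree_bound_def)

lemma kap_bound: assumes "\<bar>t\<bar> \<le> M" shows "\<bar>kap t\<bar> \<le> M powr (p - 1)"
proof -
  have "\<bar>kap t\<bar> = \<bar>t\<bar> powr (p - 1)"
    using powr_add[of "\<bar>t\<bar>" "p - 2" 1] by (cases "t = 0") (auto simp: abs_mult)
  also have "\<dots> \<le> M powr (p - 1)" using assms p2 by (intro powr_mono2) auto
  finally show ?thesis .
qed

lemma residual_bounded:
  obtains C where "0 \<le> C" "\<And>u x. (\<And>y. \<bar>u y\<bar> \<le> M) \<Longrightarrow> \<bar>residual u x\<bar> \<le> C"
proof -
  obtain K where K: "0 \<le> K" "\<And>x. V x \<le> K" using V_bounded by blast
  obtain Kf where Kf: "0 \<le> Kf" "\<And>x t. \<bar>t\<bar> \<le> M \<Longrightarrow> \<bar>f x t\<bar> \<le> Kf" using f_bounded by blast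
  define C where "C = degree_bound * (2 * M) powr (p - 1) + K * M powr (p - 1) + Kf"
  have "\<bar>residual u x\<bar> \<le> C" if u: "\<And>y. \<bar>u y\<bar> \<le> M" for u x
  proof -
    have "\<bar>p_laplacian p u x\<bar> \<le> (\<Sum>y\<in>{y. adj x y}. \<bar>kap (u y - u x)\<bar>)"
      unfolding p_laplacian_def by (rule sum_abs)
    also have "\<dots> \<le> (\<Sum>y\<in>{y. adj x y}. (2 * M) powr (p - 1))"
    proof (rule sum_mono, rule kap_bound)
      fix y show "\<bar>u y - u x\<bar> \<le> 2 * M" using u[of x] u[of y] by linarith
    qed
    also have "\<dots> = degree_bound * (2 * M) powr (p - 1)" by (simp add: card_adj)
    finally have 1: "\<bar>p_laplacian p u x\<bar> \<le> degree_bound * (2 * M) powr (p - 1)" .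
    have "\<bar>V x * \<bar>u x\<bar> powr (p - 2) * u x\<bar> = V x * \<bar>kap (u x)\<bar>" using V_nonneg[of x] by (simp add: abs_mult)
    also have "\<dots> \<le> K * M powr (p - 1)" using kap_bound[OF u] K V_nonneg by (intro mult_mono) auto
    finally have 2: "\<bar>V x * \<bar>u x\<bar> powr (p - 2) * u x\<bar> \<le> K * M powr (p - 1)" .
    show ?thesis using 1 2 Kf(2)[OF u, of x x] unfolding residual_def C_def by linarith
  qed
  moreover have "0 \<le> C" unfolding C_def using K Kf degree_bound_nonneg by simp
  ultimately show thesis using that by blast
qed

lemma kap_uniform:
  assumes e: "0 < e"
  obtains r where "0 < r" "\<And>s t. \<bar>s\<bar> \<le> M \<Longrightarrow> \<bar>t\<bar> \<le> M \<Longrightarrow> \<bar>s - t\<bar> < r \<Longrightarrow> \<bar>kap s - kap t\<bar> < e"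
proof -
  have "uniformly_continuous_on {-M..M} kap"
    by (intro compact_uniformly_continuous continuous_on_abs_powr_mult p2) auto
  then obtain r where "0 < r" "\<forall>s\<in>{-M..M}. \<forall>t\<in>{-M..M}. dist t s < r \<longrightarrow> dist (kap t) (kap s) < e"
    using e unfolding uniformly_continuous_on_def by blast
  then show thesis by (intro that[of r]) (auto simp: dist_real_def abs_le_iff)
qed

text \<open>The residual at a site depends on boundedly many values, and by periodicity only finitely many different
  moduli of continuity occur.\<close>
lemma residual_uniform:
  assumes e: "0 < e"
  obtains r where "0 < r" "\<And>u v x. (\<And>y. \<bar>u y\<bar> \<le> M) \<Longrightarrow> (\<And>y. \<bar>v y\<bar> \<le> M) \<Longrightarrow>
     (\<And>y. \<bar>u y - v y\<bar> \<le> r) \<Longrightarrow> \<bar>residual u x - residual v x\<bar> \<le> e"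
proof -
  obtain K where K: "0 \<le> K" "\<And>x. V x \<le> K" using V_bounded by blast
  define e' where "e' = e / (degree_bound + K + 1)"
  have den: "0 < degree_bound + K + 1" using degree_bound_nonneg K by linarith
  have e': "0 < e'" using e den by (simp add: e'_def)
  obtain r1 where r1: "0 < r1" "\<And>s t. \<bar>s\<bar> \<le> 2 * M \<Longrightarrow> \<bar>t\<bar> \<le> 2 * M \<Longrightarrow> \<bar>s - t\<bar> < r1 \<Longrightarrow> \<bar>kap s - kap t\<bar> < e'"
    using kap_uniform[OF e'] by blast
  obtain r2 where r2: "0 < r2" "\<And>x s t. \<bar>s\<bar> \<le> M \<Longrightarrow> \<bar>t\<bar> \<le> M \<Longrightarrow> \<bar>s - t\<bar> < r2 \<Longrightarrow> \<bar>f x s - f x t\<bar> < e'"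
    using f_equicontinuous[OF e'] by blast
  define r where "r = min (r1 / 4) (r2 / 2)"
  have r: "0 < r" "2 * r < r1" "r < r2" using r1(1) r2(1) by (auto simp: r_def)
  have "\<bar>residual u x - residual v x\<bar> \<le> e"
    if u: "\<And>y. \<bar>u y\<bar> \<le> M" and v: "\<And>y. \<bar>v y\<bar> \<le> M" and uv: "\<And>y. \<bar>u y - v y\<bar> \<le> r" for u v x
  proof -
    have M: "0 \<le> M" using u[of x] by linarith
    have "\<bar>p_laplacian p u x - p_laplacian p v x\<bar> \<le> (\<Sum>y\<in>{y. adj x y}. \<bar>kap (u y - u x) - kap (v y - v x)\<bar>)"
      unfolding p_laplacian_def sum_subtractf[symmetric] by (rule sum_abs)
    also have "\<dots> \<le> (\<Sum>y\<in>{y. adj x y}. e')"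
    proof (rule sum_mono)
      fix y
      show "\<bar>kap (u y - u x) - kap (v y - v x)\<bar> \<le> e'"
        using u[of x] u[of y] v[of x] v[of y] uv[of x] uv[of y] r
        by (intro less_imp_le[OF r1(2)]) linarith+
    qed
    also have "\<dots> = degree_bound * e'" by (simp add: card_adj)
    finally have 1: "\<bar>p_laplacian p u x - p_laplacian p v x\<bar> \<le> degree_bound * e'" .
    have "\<bar>V x * \<bar>u x\<bar> powr (p - 2) * u x - V x * \<bar>v x\<bar> powr (p - 2) * v x\<bar> = V x * \<bar>kap (u x) - kap (v x)\<bar>"
      using V_nonneg[of x] by (simp add: abs_mult mult.assoc flip: right_diff_distrib)
    also have "\<dots> \<le> K * e'"
    proof (rule mult_mono)
      show "\<bar>kap (u x) - kap (v x)\<bar> \<le> e'"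
        using u[of x] v[of x] uv[of x] r M by (intro less_imp_le[OF r1(2)]) linarith+
    qed (use K in auto)
    finally have 2: "\<bar>V x * \<bar>u x\<bar> powr (p - 2) * u x - V x * \<bar>v x\<bar> powr (p - 2) * v x\<bar> \<le> K * e'" .
    have 3: "\<bar>f x (u x) - f x (v x)\<bar> \<le> e'"
      using u[of x] v[of x] uv[of x] r by (intro less_imp_le[OF r2(2)]) linarith+
    have "degree_bound * e' + K * e' + e' = (degree_bound + K + 1) * e'" by (simp add: algebra_simps)
    also have "\<dots> = e" using den by (simp add: e'_def)
    finally have "degree_bound * e' + K * e' + e' = e" .
    then show ?thesis using 1 2 3 unfolding residual_def by linarith
  qed
  then show thesis using that r(1) by blast
qed

lemma residual_tendsto:
  assumes "\<And>y. (\<lambda>n. u n y) \<longlonglongrightarrow> v y"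
  shows "(\<lambda>n. residual (u n) x) \<longlonglongrightarrow> residual v x"
proof -
  have k: "(\<lambda>n. kap (a n)) \<longlonglongrightarrow> kap b" if "a \<longlonglongrightarrow> b" for a b
    using continuous_on_tendsto_compose[OF continuous_on_abs_powr_mult[OF p2, of UNIV] that] by simp
  have fx: "(\<lambda>n. f x (u n x)) \<longlonglongrightarrow> f x (v x)"
    using continuous_on_tendsto_compose[OF f_cont[rule_format, of x] assms[of x]] by simp
  show ?thesis
    unfolding residual_def p_laplacian_def mult.assoc
    by (intro tendsto_diff tendsto_add tendsto_minus tendsto_sum tendsto_mult_left k fx assms)
qed

lemma residual_minus: "residual (\<lambda>x. - u x) x = - residual u x"
proof -
  have "\<bar>- u y - - u x\<bar> powr (p - 2) * (- u y - - u x) = - (\<bar>u y - u x\<bar> powr (p - 2) * (u y - u x))" for y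
    by (simp add: abs_minus_commute algebra_simps)
  then have "p_laplacian p (\<lambda>x. - u x) x = - p_laplacian p u x"
    unfolding p_laplacian_def by (simp add: sum_negf)
  then show ?thesis by (simp add: residual_def f_minus)
qed

text \<open>Sup-norm bounds control the residual, and the mean value theorem along the segment pairs it with \<open>w\<close>; hence
  the \<open>l1\<close> norm is the natural distance in which \<open>J\<close> is Lipschitz.\<close>
lemma J_lipschitz:
  obtains C where "0 \<le> C" "\<And>u w. u \<in> fin_supp \<Longrightarrow> w \<in> fin_supp \<Longrightarrow> (\<And>x. \<bar>u x\<bar> \<le> M) \<Longrightarrow> (\<And>x. \<bar>u x + w x\<bar> \<le> M)
    \<Longrightarrow> \<bar>J (\<lambda>x. u x + w x) - J u\<bar> \<le> C * l1norm w"
proof -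
  obtain C where C: "0 \<le> C" "\<And>u x. (\<And>y. \<bar>u y\<bar> \<le> M) \<Longrightarrow> \<bar>residual u x\<bar> \<le> C" using residual_bounded by blast
  have "\<bar>J (\<lambda>x. u x + w x) - J u\<bar> \<le> C * l1norm w"
    if u: "u \<in> fin_supp" and w: "w \<in> fin_supp" and uM: "\<And>x. \<bar>u x\<bar> \<le> M" and uwM: "\<And>x. \<bar>u x + w x\<bar> \<le> M" for u w
  proof -
    obtain s where s: "0 < s" "s < 1"
      "J (\<lambda>x. u x + w x) = J u + (\<Sum>x | w x \<noteq> 0. residual (\<lambda>x. u x + s * w x) x * w x)"
      using J_mean_value[OF u w] by blast
    have "\<bar>u x + s * w x\<bar> \<le> M" for x
    proof -
      have "u x + s * w x = (1 - s) * u x + s * (u x + w x)" by (simp add: algebra_simps)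
      then have "\<bar>u x + s * w x\<bar> \<le> \<bar>(1 - s) * u x\<bar> + \<bar>s * (u x + w x)\<bar>"
        by (simp only: abs_triangle_ineq)
      also have "\<dots> = (1 - s) * \<bar>u x\<bar> + s * \<bar>u x + w x\<bar>" using s by (simp add: abs_mult)
      also have "\<dots> \<le> (1 - s) * M + s * M" using s uM uwM by (intro add_mono mult_left_mono) auto
      finally show ?thesis by (simp add: algebra_simps)
    qed
    then have r: "\<bar>residual (\<lambda>x. u x + s * w x) x\<bar> \<le> C" for x by (rule C(2))
    have "\<bar>\<Sum>x | w x \<noteq> 0. residual (\<lambda>x. u x + s * w x) x * w x\<bar> \<le> (\<Sum>x | w x \<noteq> 0. C * \<bar>w x\<bar>)"
      by (rule order_trans[OF sum_abs]) (auto intro!: sum_mono mult_right_mono r simp: abs_mult)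
    then show ?thesis using s(3) by (simp add: l1norm_def sum_distrib_left)
  qed
  then show thesis using that C(1) by blast
qed

definition shift :: "int ^ 'n \<Rightarrow> (int ^ 'n \<Rightarrow> real) \<Rightarrow> int ^ 'n \<Rightarrow> real" where
  "shift k u = (\<lambda>x. u (x + T *s k))"

lemma shift_fin_supp: "u \<in> fin_supp \<Longrightarrow> shift k u \<in> fin_supp"
  unfolding shift_def by (drule fin_supp_shift) (simp add: fin_supp_def)

lemma adj_shift: "adj (x + z) y \<longleftrightarrow> adj x (y - z)"
  using adj_translate[of x z "y - z"] by simp

lemma adj_diff: "adj (x - z) (y - z) \<longleftrightarrow> adj x y"
  by (simp add: adj_def)

lemma residual_shift: "residual (shift k u) x = residual u (x + T *s k)"
proof -
  have "p_laplacian p (shift k u) x = p_laplacian p u (x + T *s k)"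
    unfolding p_laplacian_def shift_def
    by (rule sum.reindex_bij_witness[where i = "\<lambda>y. y - T *s k" and j = "\<lambda>y. y + T *s k"])
       (simp_all add: adj_shift)
  moreover have "shift k u x = u (x + T *s k)" by (simp only: shift_def)
  ultimately show ?thesis unfolding residual_def by (simp only: V_shift f_shift)
qed

lemma En_shift: "En (shift k u) = En u"
proof -
  have "edge_energy p (shift k u) = edge_energy p u"
    unfolding edge_energy_def shift_def
    by (rule infsum_reindex_bij_witness[where i = "\<lambda>(x, y). (x - T *s k, y - T *s k)" and j = "\<lambda>(x, y). (x + T *s k, y + T *s k)"])
       (auto simp: adj_translate adj_diff)
  moreover have "(\<Sum>\<^sub>\<infinity>x\<in>UNIV. V x * \<bar>shift k u x\<bar> powr p) = (\<Sum>\<^sub>\<infinity>x\<in>UNIV. V x * \<bar>u x\<bar> powr p)"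
    by (rule infsum_reindex_bij_witness[where i = "\<lambda>x. x - T *s k" and j = "\<lambda>x. x + T *s k"])
       (auto simp: shift_def)
  ultimately show ?thesis by (simp add: En_def)
qed

lemma site_sum_shift:
  assumes "\<And>x. h (x + T *s k) = h x" shows "site_sum h (shift k u) = site_sum h u"
  unfolding site_sum_def shift_def
  by (rule sum.reindex_bij_witness[where i = "\<lambda>x. x - T *s k" and j = "\<lambda>x. x + T *s k"]) (auto simp: assms)

lemma J_shift: "J (shift k u) = J u"
  by (simp add: J_def En_shift site_sum_shift)

section \<open>The Nehari manifold\<close>

definition psum :: "(int ^ 'n \<Rightarrow> real) \<Rightarrow> real" where "psum = site_sum (\<lambda>x t. \<bar>t\<bar> powr pstar)"

lemma psum_eq: "psum u = (\<Sum>x | u x \<noteq> 0. \<bar>u x\<bar> powr pstar)"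
  by (simp add: psum_def site_sum_def)

lemma psum_nonneg: "0 \<le> psum u"
  by (simp add: psum_eq sum_nonneg)

lemma psum_ge: assumes "u \<in> fin_supp" shows "\<bar>u x\<bar> powr pstar \<le> psum u"
proof (cases "u x = 0")
  case True then show ?thesis using psum_nonneg by simp
next
  case False
  then show ?thesis unfolding psum_eq
    using assms by (intro member_le_sum[of x _ "\<lambda>x. \<bar>u x\<bar> powr pstar"]) (auto simp: fin_supp_def)
qed

lemma Sobolev:
  obtains C where "0 < C" "\<And>u. u \<in> fin_supp \<Longrightarrow> psum u \<le> C * En u powr (pstar / p)"
proof -
  obtain C where C: "0 < C" "\<And>u :: int ^ 'n \<Rightarrow> real. u \<in> fin_supp \<Longrightarrow>
    (\<Sum>x | u x \<noteq> 0. \<bar>u x\<bar> powr pstar) \<le> C * edge_energy p u powr (pstar / p)"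
    using discrete_Sobolev[of p pstar, OF _ pN pstar] p2 by auto
  have "psum u \<le> C * 2 powr (pstar / p) * En u powr (pstar / p)" if u: "u \<in> fin_supp" for u
  proof -
    have "edge_energy p u powr (pstar / p) \<le> (2 * En u) powr (pstar / p)"
      using edge_energy_le_En[OF u] edge_energy_nonneg[of p u] p2 pstar_gt by (intro powr_mono2) auto
    also have "\<dots> = 2 powr (pstar / p) * En u powr (pstar / p)" using En_nonneg[of u] by (simp add: powr_mult)
    finally have "C * edge_energy p u powr (pstar / p) \<le> C * (2 powr (pstar / p) * En u powr (pstar / p))"
      using C(1) by (intro mult_left_mono) auto
    then show ?thesis using C(2)[OF u] by (simp add: psum_eq mult.assoc)
  qed
  then show thesis using that[of "C * 2 powr (pstar / p)"] C(1) by simp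
qed

lemma En_pos: assumes u: "u \<in> fin_supp" "u \<noteq> (\<lambda>_. 0)" shows "0 < En u"
proof (rule ccontr)
  assume "\<not> 0 < En u"
  then have "En u = 0" using En_nonneg[of u] by simp
  moreover obtain C where "psum u \<le> C * En u powr (pstar / p)" using Sobolev u(1) by metis
  moreover obtain x where x: "u x \<noteq> 0" using u(2) by auto
  moreover have "0 < \<bar>u x\<bar> powr pstar" using x by simp
  ultimately show False using psum_ge[OF u(1), of x] by simp
qed

text \<open>The finitely supported nonzero \<open>u\<close> at which the derivative of \<open>J\<close> in the direction \<open>u\<close> vanishes.\<close>
definition nehari :: "(int ^ 'n \<Rightarrow> real) set" where
  "nehari = {u \<in> fin_supp. u \<noteq> (\<lambda>_. 0) \<and> En u = site_sum (\<lambda>x t. f x t * t) u}"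

lemma nehariD: "u \<in> nehari \<Longrightarrow> u \<in> fin_supp" "u \<in> nehari \<Longrightarrow> u \<noteq> (\<lambda>_. 0)"
  by (auto simp: nehari_def)

lemma site_sum_scale:
  assumes "u \<in> fin_supp" "\<And>x. h x 0 = 0"
  shows "site_sum h (\<lambda>x. t * u x) = (\<Sum>x | u x \<noteq> 0. h x (t * u x))"
  by (rule site_sum_eq) (use assms in \<open>auto simp: fin_supp_def\<close>)

lemma J_nehari: assumes "u \<in> nehari" shows "J u = site_sum G u"
  using assms by (simp add: J_def nehari_def G_def site_sum_def sum_subtractf sum_divide_distrib)

lemma J_nehari_pos: assumes "u \<in> nehari" shows "0 < J u"
proof -
  obtain x where "u x \<noteq> 0" using nehariD(2)[OF assms] by auto
  then show ?thesis unfolding J_nehari[OF assms] site_sum_def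
    using nehariD(1)[OF assms] G_pos by (intro sum_pos) (auto simp: fin_supp_def)
qed

lemma J_ray:
  assumes u: "u \<in> nehari" and t: "0 \<le> t"
  shows "J (\<lambda>x. t * u x) = J u + (\<Sum>x | u x \<noteq> 0. ray_defect x (u x) t)"
proof -
  have "J (\<lambda>x. t * u x) = t powr p * En u / p - (\<Sum>x | u x \<noteq> 0. F x (t * u x))"
    unfolding J_def by (simp add: En_scale[OF t] site_sum_scale[OF nehariD(1)[OF u]])
  also have "\<dots> = En u / p - site_sum F u + ((t powr p - 1) / p * En u - (\<Sum>x | u x \<noteq> 0. F x (t * u x)) + site_sum F u)"
    using p2 by (simp add: field_simps)
  also have "(t powr p - 1) / p * En u = (\<Sum>x | u x \<noteq> 0. (t powr p - 1) / p * (f x (u x) * u x))"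
    using u by (simp add: nehari_def site_sum_def sum_distrib_left)
  finally show ?thesis
    by (simp add: J_def ray_defect_def site_sum_def sum.distrib sum_subtractf)
qed

lemma J_ray_le: assumes "u \<in> nehari" "0 \<le> t" shows "J (\<lambda>x. t * u x) \<le> J u"
  unfolding J_ray[OF assms] using ray_defect_nonpos[OF assms(2)] by (simp add: sum_nonpos)

lemma J_ray_mono:
  assumes u: "u \<in> nehari"
  shows "0 \<le> s \<Longrightarrow> s \<le> t \<Longrightarrow> t \<le> 1 \<Longrightarrow> J (\<lambda>x. s * u x) \<le> J (\<lambda>x. t * u x)"
    and "1 \<le> s \<Longrightarrow> s \<le> t \<Longrightarrow> J (\<lambda>x. t * u x) \<le> J (\<lambda>x. s * u x)"
proof -
  assume a: "0 \<le> s" "s \<le> t" "t \<le> 1"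
  show "J (\<lambda>x. s * u x) \<le> J (\<lambda>x. t * u x)"
    using a by (simp add: J_ray[OF u] ray_defect_mono(1)[OF a] sum_mono)
next
  assume a: "1 \<le> s" "s \<le> t"
  show "J (\<lambda>x. t * u x) \<le> J (\<lambda>x. s * u x)"
    using a by (simp add: J_ray[OF u] ray_defect_mono(2)[OF a] sum_mono)
qed

lemma J_ray_less: assumes u: "u \<in> nehari" and t: "0 < t" "t \<noteq> 1" shows "J (\<lambda>x. t * u x) < J u"
proof -
  have fin: "finite {x. u x \<noteq> 0}" using nehariD(1)[OF u] by (simp add: fin_supp_def)
  have "(\<Sum>x | u x \<noteq> 0. ray_defect x (u x) t) < 0"
  proof -
    have "ray_defect x (u x) t < 0" if "u x \<noteq> 0" for x
      using ray_defect_strict(1)[OF that, of t 1 x] ray_defect_strict(2)[OF that, of 1 t x] t by (cases "t < 1") auto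
    moreover have "{x. u x \<noteq> 0} \<noteq> {}" using nehariD(2)[OF u] by auto
    ultimately have "(\<Sum>x | u x \<noteq> 0. ray_defect x (u x) t) < (\<Sum>x | u x \<noteq> 0. 0)"
      by (intro sum_strict_mono fin) auto
    then show ?thesis by simp
  qed
  then show ?thesis using J_ray[OF u, of t] t by simp
qed

lemma nehari_ray_unique: assumes u: "u \<in> nehari" and tu: "(\<lambda>x. t * u x) \<in> nehari" and t: "0 < t" shows "t = 1"
proof (rule ccontr)
  assume "t \<noteq> 1"
  then have "J (\<lambda>x. t * u x) < J u" using J_ray_less[OF u] t by simp
  moreover have "J (\<lambda>x. (1 / t) * (t * u x)) < J (\<lambda>x. t * u x)" using J_ray_less[OF tu, of "1 / t"] t \<open>t \<noteq> 1\<close> by simp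
  ultimately show False using t by simp
qed

text \<open>Along a ray the energy is \<open>t powr p * En u\<close>.  It dominates \<open>\<Sum>x. f x (t * u x) * (t * u x)\<close> for small \<open>t\<close>, by the
  smallness of \<open>f\<close> at \<open>0\<close>, and is dominated for large \<open>t\<close>, since already the term of one site outgrows it by
  superlinearity of \<open>F\<close>.  The intermediate value theorem does the rest.\<close>
lemma nehari_scale_exists:
  assumes u: "u \<in> fin_supp" "u \<noteq> (\<lambda>_. 0)"
  shows "\<exists>t>0. (\<lambda>x. t * u x) \<in> nehari"
proof -
  define B where "B = {x. u x \<noteq> 0}"
  have B: "finite B" using u(1) by (simp add: B_def fin_supp_def)
  obtain x0 where x0: "x0 \<in> B" using u(2) by (auto simp: B_def)
  define g where "g t = t powr p * En u - (\<Sum>x\<in>B. f x (t * u x) * (t * u x))" for t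
  have E: "0 < En u" by (rule En_pos[OF u])
  obtain d where d: "0 < d" "\<And>x t. \<bar>t\<bar> \<le> d \<Longrightarrow> f x t * t \<le> 1 * \<bar>t\<bar> powr pstar" using F_small[OF zero_less_one] by metis
  define m where "m = l1norm u + 1"
  have m: "0 < m" "\<And>x. \<bar>u x\<bar> \<le> m"
  proof -
    show "\<bar>u x\<bar> \<le> m" for x using l1norm_ge[OF u(1), of x] by (simp add: m_def)
    then show "0 < m" using l1norm_ge[OF u(1), of x0] by (simp add: m_def)
  qed
  define P where "P = (\<Sum>x\<in>B. \<bar>u x\<bar> powr pstar)"
  have P: "0 < P" unfolding P_def using x0 B by (intro sum_pos) (auto simp: B_def)
  define t1 where "t1 = min (d / m) ((En u / (2 * P)) powr (1 / (pstar - p)))"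
  have t1: "0 < t1" using d(1) m(1) E P by (simp add: t1_def)
  have g1: "0 < g t1"
  proof -
    have "t1 powr (pstar - p) \<le> ((En u / (2 * P)) powr (1 / (pstar - p))) powr (pstar - p)"
      using t1 pstar_gt by (intro powr_mono2) (auto simp: t1_def)
    also have "\<dots> = En u / (2 * P)" using E P pstar_gt by (simp add: powr_powr)
    finally have "t1 powr (pstar - p) * P \<le> En u / 2" using P by (simp add: field_simps)
    then have h: "t1 powr p * (t1 powr (pstar - p) * P) \<le> t1 powr p * (En u / 2)" by (rule mult_left_mono) simp
    have "t1 powr pstar * P \<le> t1 powr p * (En u / 2)"
      using h by (simp flip: powr_add mult.assoc)
    moreover have "(\<Sum>x\<in>B. f x (t1 * u x) * (t1 * u x)) \<le> (\<Sum>x\<in>B. t1 powr pstar * \<bar>u x\<bar> powr pstar)"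
    proof (rule sum_mono)
      fix x
      have "\<bar>t1 * u x\<bar> \<le> d"
      proof -
        have "\<bar>t1 * u x\<bar> \<le> t1 * m" using t1 m(2)[of x] by (simp add: abs_mult)
        also have "\<dots> \<le> d" using m(1) by (simp add: t1_def field_simps min_def)
        finally show ?thesis .
      qed
      from d(2)[OF this, of x] show "f x (t1 * u x) * (t1 * u x) \<le> t1 powr pstar * \<bar>u x\<bar> powr pstar"
        using t1 by (simp add: abs_mult powr_mult)
    qed
    moreover have "(\<Sum>x\<in>B. t1 powr pstar * \<bar>u x\<bar> powr pstar) = t1 powr pstar * P" by (simp add: P_def sum_distrib_left)
    moreover have "t1 powr p * (En u / 2) < t1 powr p * En u" using E t1 by simp
    ultimately show ?thesis unfolding g_def by linarith
  qed
  define M where "M = En u / \<bar>u x0\<bar> powr p"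
  obtain b where b: "0 < b" "\<And>x t. b \<le> \<bar>t\<bar> \<Longrightarrow> M * \<bar>t\<bar> powr p \<le> F x t" using F_superlinear by blast
  have ux0: "0 < \<bar>u x0\<bar>" using x0 by (simp add: B_def)
  define t2 where "t2 = max t1 (b / \<bar>u x0\<bar>)"
  have t2: "t1 \<le> t2" "0 < t2" using t1 by (auto simp: t2_def)
  have g2: "g t2 \<le> 0"
  proof -
    have "b / \<bar>u x0\<bar> \<le> t2" by (simp add: t2_def)
    then have "b \<le> \<bar>t2 * u x0\<bar>" using ux0 t2 by (simp add: field_simps abs_mult)
    from b(2)[OF this, of x0] have "t2 powr p * En u \<le> F x0 (t2 * u x0)"
      using ux0 t2 by (simp add: M_def abs_mult powr_mult mult.commute)
    also have "\<dots> \<le> f x0 (t2 * u x0) * (t2 * u x0) / p" using G_nonneg[of x0 "t2 * u x0"] by (simp add: G_def)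
    also have "\<dots> \<le> f x0 (t2 * u x0) * (t2 * u x0)"
      using p2 f_times_nonneg[of x0 "t2 * u x0"] by (simp add: divide_le_eq mult_le_cancel_left1)
    also have "\<dots> \<le> (\<Sum>x\<in>B. f x (t2 * u x) * (t2 * u x))"
      by (rule member_le_sum[of x0 B "\<lambda>x. f x (t2 * u x) * (t2 * u x)"]) (use x0 B f_times_nonneg in auto)
    finally show ?thesis by (simp add: g_def)
  qed
  have cont: "continuous_on {t1..t2} g"
    unfolding g_def
    by (intro continuous_intros continuous_on_compose2[OF f_cont[rule_format]]) (use t1 in auto)
  obtain t where t: "t1 \<le> t" "t \<le> t2" "g t = 0"
    using IVT2'[of g t2 0 t1, OF g2 less_imp_le[OF g1] t2(1) cont] by auto
  have tp: "0 < t" using t t1 by simp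
  have "En (\<lambda>x. t * u x) = site_sum (\<lambda>x t. f x t * t) (\<lambda>x. t * u x)"
    using t(3) tp by (simp add: En_scale site_sum_scale[OF u(1)] g_def B_def)
  moreover have "(\<lambda>x. t * u x) \<noteq> (\<lambda>_. 0)" using x0 tp by (auto simp: B_def fun_eq_iff)
  ultimately have "(\<lambda>x. t * u x) \<in> nehari" using fin_supp_scale[OF u(1), of t] by (simp add: nehari_def)
  then show ?thesis using tp by blast
qed

definition ray_scale :: "(int ^ 'n \<Rightarrow> real) \<Rightarrow> real" where
  "ray_scale u = (SOME t. 0 < t \<and> (\<lambda>x. t * u x) \<in> nehari)"

definition proj :: "(int ^ 'n \<Rightarrow> real) \<Rightarrow> int ^ 'n \<Rightarrow> real" where
  "proj u = (\<lambda>x. ray_scale u * u x)"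

lemma proj_nehari:
  assumes "u \<in> fin_supp" "u \<noteq> (\<lambda>_. 0)" shows "0 < ray_scale u" "proj u \<in> nehari"
  using someI_ex[OF nehari_scale_exists[OF assms]] by (auto simp: ray_scale_def proj_def)

lemma proj_eqI:
  assumes v: "v \<in> nehari" and c: "0 < c" and u: "u = (\<lambda>x. c * v x)"
  shows "proj u = v"
proof -
  have uf: "u \<in> fin_supp" "u \<noteq> (\<lambda>_. 0)" using nehariD[OF v] c fin_supp_scale by (auto simp: u fun_eq_iff)
  have "proj u = (\<lambda>x. (ray_scale u * c) * v x)" by (simp add: proj_def u mult.assoc)
  moreover from this have "ray_scale u * c = 1"
    using proj_nehari[OF uf] c by (intro nehari_ray_unique[OF v]) auto
  ultimately show ?thesis by simp
qed

lemma proj_scale: assumes "u \<in> fin_supp" "u \<noteq> (\<lambda>_. 0)" "0 < c" shows "proj (\<lambda>x. c * u x) = proj u"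
proof (rule proj_eqI[OF proj_nehari(2)[OF assms(1,2)]])
  show "0 < c / ray_scale u" using assms proj_nehari by simp
  show "(\<lambda>x. c * u x) = (\<lambda>x. c / ray_scale u * proj u x)"
    using proj_nehari(1)[OF assms(1,2)] by (simp add: proj_def)
qed

lemma nehari_minus: assumes "u \<in> nehari" shows "(\<lambda>x. - u x) \<in> nehari"
proof -
  have "En (\<lambda>x. - u x) = En u"
    by (simp add: En_def edge_energy_def abs_minus_commute)
  then show ?thesis using assms fin_supp_scale[of u "-1"]
    by (auto simp: nehari_def site_sum_def f_minus fun_eq_iff)
qed

lemma J_minus: "J (\<lambda>x. - u x) = J u"
proof -
  have "En (\<lambda>x. - u x) = En u"
    by (simp add: En_def edge_energy_def abs_minus_commute)
  then show ?thesis by (simp add: J_def site_sum_def F_minus)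
qed

lemma proj_minus: assumes "u \<in> fin_supp" "u \<noteq> (\<lambda>_. 0)" shows "proj (\<lambda>x. - u x) = (\<lambda>x. - proj u x)"
  by (rule proj_eqI[OF nehari_minus[OF proj_nehari(2)[OF assms]], of "1 / ray_scale u"])
     (use proj_nehari(1)[OF assms] in \<open>auto simp: proj_def\<close>)

lemma nehari_shift: assumes "u \<in> nehari" shows "shift k u \<in> nehari"
proof -
  have "shift k u \<noteq> (\<lambda>_. 0)"
  proof
    assume "shift k u = (\<lambda>_. 0)"
    then have "u (x - T *s k + T *s k) = 0" for x unfolding shift_def by (rule fun_cong)
    then have "u = (\<lambda>_. 0)" by (auto simp: fun_eq_iff)
    then show False using assms by (simp add: nehari_def)
  qed
  then show ?thesis using assms shift_fin_supp by (simp add: nehari_def En_shift site_sum_shift)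
qed

text \<open>Scale \<open>u\<close> to \<open>v\<close> with unit energy.  If \<open>v\<close> were uniformly small, the Sobolev inequality would make the
  \<open>F\<close>-term of \<open>s * v\<close> at most \<open>1\<close>, so \<open>J (s * v) \<ge> \<bar>D\<bar> + 1\<close> for the chosen \<open>s\<close>, although \<open>J u\<close> is the maximum along
  the ray.  So \<open>v\<close> exceeds some fixed \<open>d'\<close> at a site, and if \<open>En u\<close> is large, superlinearity of \<open>F\<close> at
  that site alone forces \<open>J u \<le> 0\<close>.\<close>
lemma nehari_energy_bound:
  obtains R where "\<And>u. u \<in> nehari \<Longrightarrow> J u \<le> D \<Longrightarrow> En u \<le> R"
proof -
  obtain C where C: "0 < C" "\<And>u. u \<in> fin_supp \<Longrightarrow> psum u \<le> C * En u powr (pstar / p)" using Sobolev by blast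
  \<comment> \<open>With this \<open>s\<close> the energy part of \<open>J (s * v)\<close> is \<open>\<bar>D\<bar> + 2\<close>, and \<open>e\<close> bounds the remaining part by \<open>1\<close>.\<close>
  define s where "s = (p * (\<bar>D\<bar> + 2)) powr (1 / p)"
  have s: "0 < s" "s powr p = p * (\<bar>D\<bar> + 2)" using p2 by (auto simp: s_def powr_powr)
  define e where "e = 1 / (C * s powr pstar)"
  have e: "0 < e" using C(1) s by (simp add: e_def)
  obtain d where d: "0 < d" "\<And>x t. \<bar>t\<bar> \<le> d \<Longrightarrow> F x t \<le> e * \<bar>t\<bar> powr pstar" using F_small[OF e] by metis
  define d' where "d' = d / s"
  have d': "0 < d'" using d s by (simp add: d'_def)
  obtain b where b: "0 < b" "\<And>x t. b \<le> \<bar>t\<bar> \<Longrightarrow> 1 / (d' powr p * p) * \<bar>t\<bar> powr p \<le> F x t" using F_superlinear by metis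
  have "En u \<le> (b / d') powr p" if u: "u \<in> nehari" "J u \<le> D" for u
  proof (rule ccontr)
    assume neg: "\<not> En u \<le> (b / d') powr p"
    define r where "r = En u powr (1 / p)"
    have Epos: "0 < En u" using En_pos nehariD u by blast
    have r: "0 < r" "r powr p = En u" using Epos p2 by (auto simp: r_def powr_powr)
    have rb: "b / d' < r"
    proof (rule ccontr)
      assume "\<not> b / d' < r"
      then have "r powr p \<le> (b / d') powr p" using r p2 by (intro powr_mono2) auto
      then show False using neg r by simp
    qed
    define v where "v = (\<lambda>x. u x / r)"
    have vu: "v = (\<lambda>x. (1 / r) * u x)" by (simp add: v_def)
    have vf: "v \<in> fin_supp" unfolding vu using u nehariD fin_supp_scale by blast
    have Ev: "En v = 1" unfolding vu using r by (subst En_scale) (auto simp: powr_divide)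
    have "\<exists>x. d' < \<bar>v x\<bar>"
    proof (rule ccontr)
      assume "\<nexists>x. d' < \<bar>v x\<bar>"
      then have small: "\<bar>v x\<bar> \<le> d'" for x by (simp add: not_less)
      have "J (\<lambda>x. s * v x) = s powr p / p - (\<Sum>x | v x \<noteq> 0. F x (s * v x))"
        unfolding J_def using s by (simp add: En_scale Ev site_sum_scale[OF vf])
      moreover have "(\<Sum>x | v x \<noteq> 0. F x (s * v x)) \<le> (\<Sum>x | v x \<noteq> 0. e * s powr pstar * \<bar>v x\<bar> powr pstar)"
      proof (rule sum_mono)
        fix x
        have "\<bar>s * v x\<bar> \<le> d" using small[of x] s by (simp add: d'_def abs_mult field_simps)
        from d(2)[OF this, of x] show "F x (s * v x) \<le> e * s powr pstar * \<bar>v x\<bar> powr pstar"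
          using s by (simp add: abs_mult powr_mult)
      qed
      moreover have "(\<Sum>x | v x \<noteq> 0. e * s powr pstar * \<bar>v x\<bar> powr pstar) = e * s powr pstar * psum v"
        by (simp add: psum_eq sum_distrib_left)
      moreover have "e * s powr pstar * psum v \<le> e * s powr pstar * C"
        using C(2)[OF vf] e by (intro mult_left_mono) (auto simp: Ev)
      moreover have "e * s powr pstar * C = 1" using C(1) s by (simp add: e_def)
      moreover have "s powr p / p = \<bar>D\<bar> + 2" using s(2) p2 by simp
      moreover have "J (\<lambda>x. s * v x) \<le> J u"
      proof -
        have "(\<lambda>x. s * v x) = (\<lambda>x. (s / r) * u x)" by (simp add: v_def)
        then show ?thesis using J_ray_le[OF u(1), of "s / r"] s r by simp
      qed
      ultimately show False using u(2) by linarith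
    qed
    then obtain x where x: "d' < \<bar>v x\<bar>" by blast
    then have ux: "r * d' < \<bar>u x\<bar>" using r by (simp add: v_def abs_divide field_simps)
    have "b \<le> \<bar>u x\<bar>" using ux rb d' by (simp add: field_simps)
    from b(2)[OF this, of x] have Fx: "1 / (d' powr p * p) * \<bar>u x\<bar> powr p \<le> F x (u x)" .
    have "r powr p * d' powr p \<le> \<bar>u x\<bar> powr p"
    proof -
      have "(r * d') powr p \<le> \<bar>u x\<bar> powr p" using ux r d' p2 by (intro powr_mono2) auto
      then show ?thesis using r d' by (simp add: powr_mult)
    qed
    then have "1 / (d' powr p * p) * (r powr p * d' powr p) \<le> 1 / (d' powr p * p) * \<bar>u x\<bar> powr p"
      using p2 by (intro mult_left_mono) auto
    then have "En u / p \<le> F x (u x)" using Fx d' r p2 by simp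
    also have "F x (u x) \<le> site_sum F u"
    proof (cases "u x = 0")
      case True then show ?thesis using F_nonneg by (simp add: site_sum_def sum_nonneg)
    next
      case False
      then show ?thesis unfolding site_sum_def
        using nehariD(1)[OF u(1)] F_nonneg
        by (intro member_le_sum[of x _ "\<lambda>x. F x (u x)"]) (auto simp: fin_supp_def)
    qed
    finally have "J u \<le> 0" by (simp add: J_def)
    then show False using J_nehari_pos[OF u(1)] by simp
  qed
  then show thesis using that by blast
qed

text \<open>The upper bounds follow from the energy bound by the Sobolev inequality.  For the lower bound: if
  \<open>\<bar>u x\<bar> \<le> d\<close> everywhere, the Nehari identity and the Sobolev inequality give
  \<open>En u \<le> e * C * En u powr (pstar / p)\<close>, which for this \<open>e\<close> is at most \<open>En u / 2\<close>.\<close>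
lemma nehari_bounds:
  obtains R M d where "0 < R" "0 < M" "0 < d"
    "\<And>u. u \<in> nehari \<Longrightarrow> J u \<le> D \<Longrightarrow> En u \<le> R" "\<And>u. u \<in> nehari \<Longrightarrow> J u \<le> D \<Longrightarrow> psum u \<le> R"
    "\<And>u x. u \<in> nehari \<Longrightarrow> J u \<le> D \<Longrightarrow> \<bar>u x\<bar> \<le> M" "\<And>u. u \<in> nehari \<Longrightarrow> J u \<le> D \<Longrightarrow> \<exists>x. d < \<bar>u x\<bar>"
proof -
  obtain R0 where R0: "\<And>u. u \<in> nehari \<Longrightarrow> J u \<le> D \<Longrightarrow> En u \<le> R0" using nehari_energy_bound by blast
  obtain C where C: "0 < C" "\<And>u. u \<in> fin_supp \<Longrightarrow> psum u \<le> C * En u powr (pstar / p)" using Sobolev by blast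
  define R1 where "R1 = max R0 1"
  define R where "R = max R1 (C * R1 powr (pstar / p))"
  have R1: "1 \<le> R1" "\<And>u. u \<in> nehari \<Longrightarrow> J u \<le> D \<Longrightarrow> En u \<le> R1" using R0 by (force simp: R1_def)+
  have pp: "0 < pstar" using pstar_gt p2 by simp
  have ps: "psum u \<le> C * R1 powr (pstar / p)" if "u \<in> nehari" "J u \<le> D" for u
  proof -
    have "En u powr (pstar / p) \<le> R1 powr (pstar / p)"
      using R1(2)[OF that] En_nonneg[of u] pp p2 by (intro powr_mono2) auto
    then have "C * En u powr (pstar / p) \<le> C * R1 powr (pstar / p)" using C(1) by simp
    then show ?thesis using C(2)[OF nehariD(1)[OF that(1)]] by linarith
  qed
  have "0 < R" "R1 \<le> R" "C * R1 powr (pstar / p) \<le> R" using R1 by (auto simp: R_def)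
  define M where "M = R powr (1 / pstar)"
  have M: "\<bar>u x\<bar> \<le> M" if u: "u \<in> nehari" "J u \<le> D" for u x
  proof -
    have "\<bar>u x\<bar> powr pstar \<le> R" using psum_ge[OF nehariD(1)[OF u(1)], of x] ps[OF u] \<open>C * R1 powr (pstar / p) \<le> R\<close> by linarith
    then have "(\<bar>u x\<bar> powr pstar) powr (1 / pstar) \<le> R powr (1 / pstar)" using pp by (intro powr_mono2) auto
    then show ?thesis using pp by (simp add: M_def powr_powr)
  qed
  define e where "e = 1 / (2 * C * R1 powr (pstar / p - 1))"
  have e: "0 < e" using C(1) R1(1) by (simp add: e_def)
  obtain d where d: "0 < d" "\<And>x t. \<bar>t\<bar> \<le> d \<Longrightarrow> f x t * t \<le> e * \<bar>t\<bar> powr pstar" using F_small[OF e] by metis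
  have low: "\<exists>x. d < \<bar>u x\<bar>" if u: "u \<in> nehari" "J u \<le> D" for u
  proof (rule ccontr)
    assume "\<nexists>x. d < \<bar>u x\<bar>"
    then have small: "\<bar>u x\<bar> \<le> d" for x by (simp add: not_less)
    have E: "0 < En u" using En_pos nehariD u by blast
    have "En u = (\<Sum>x | u x \<noteq> 0. f x (u x) * u x)" using u(1) by (simp add: nehari_def site_sum_def)
    also have "\<dots> \<le> (\<Sum>x | u x \<noteq> 0. e * \<bar>u x\<bar> powr pstar)" by (rule sum_mono) (rule d(2)[OF small])
    also have "\<dots> = e * psum u" by (simp add: psum_eq sum_distrib_left)
    also have "\<dots> \<le> e * (C * En u powr (pstar / p))" using C(2)[OF nehariD(1)[OF u(1)]] e by (intro mult_left_mono) auto
    also have "En u powr (pstar / p) = En u * En u powr (pstar / p - 1)" using E by (simp add: powr_diff)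
    also have "e * (C * (En u * En u powr (pstar / p - 1))) \<le> e * (C * (En u * R1 powr (pstar / p - 1)))"
      using e C(1) E R1(2)[OF u] pstar_gt p2 by (intro mult_left_mono powr_mono2) (auto simp: field_simps)
    also have "\<dots> = En u / 2" using C(1) R1(1) by (simp add: e_def)
    finally show False using E by simp
  qed
  have "0 < M" using \<open>0 < R\<close> by (simp add: M_def)
  have "En u \<le> R" if "u \<in> nehari" "J u \<le> D" for u using R1(2)[OF that] \<open>R1 \<le> R\<close> by linarith
  moreover have "psum u \<le> R" if "u \<in> nehari" "J u \<le> D" for u using ps[OF that] \<open>C * R1 powr (pstar / p) \<le> R\<close> by linarith
  ultimately show thesis using that \<open>0 < R\<close> \<open>0 < M\<close> d(1) M low by blast
qed

lemma nehari_sup_bounds: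
  obtains M d where "0 < M" "0 < d"
    "\<And>u x. u \<in> nehari \<Longrightarrow> J u \<le> D \<Longrightarrow> \<bar>u x\<bar> \<le> M" "\<And>u. u \<in> nehari \<Longrightarrow> J u \<le> D \<Longrightarrow> \<exists>x. d < \<bar>u x\<bar>"
proof (rule nehari_bounds[of D])
  fix R M d
  assume "0 < M" "0 < d" and M: "\<And>u x. u \<in> nehari \<Longrightarrow> J u \<le> D \<Longrightarrow> \<bar>u x\<bar> \<le> M"
    and d: "\<And>u. u \<in> nehari \<Longrightarrow> J u \<le> D \<Longrightarrow> \<exists>x. d < \<bar>u x\<bar>"
  then show thesis using that by blast
qed

lemma ray_defect_gap:
  assumes d: "0 < d" and t: "0 < t" "t \<noteq> 1"
  obtains c where "0 < c" "\<And>x a. d \<le> \<bar>a\<bar> \<Longrightarrow> \<bar>a\<bar> \<le> M \<Longrightarrow> ray_defect x a t \<le> - c"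
proof -
  have ex: "\<exists>c>0. \<forall>a. d \<le> \<bar>a\<bar> \<longrightarrow> \<bar>a\<bar> \<le> M \<longrightarrow> ray_defect x a t \<le> - c" for x
  proof (cases "d \<le> M")
    case True
    have "continuous_on {d..M} (\<lambda>a. ray_defect x a t)"
      unfolding ray_defect_def
      by (intro continuous_intros continuous_on_compose2[OF F_cont[of UNIV]] continuous_on_subset[OF f_cont[rule_format]] F_cont) auto
    then obtain a0 where a0: "a0 \<in> {d..M}" "\<And>a. a \<in> {d..M} \<Longrightarrow> ray_defect x a t \<le> ray_defect x a0 t"
      using continuous_attains_sup[of "{d..M}" "\<lambda>a. ray_defect x a t"] True by auto
    have "ray_defect x a0 t < 0"
      using ray_defect_strict(1)[of a0 t 1 x] ray_defect_strict(2)[of a0 1 t x] t a0(1) d by (cases "t < 1") auto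
    moreover have "ray_defect x a t \<le> ray_defect x a0 t" if "d \<le> \<bar>a\<bar>" "\<bar>a\<bar> \<le> M" for a
      using a0(2)[of "\<bar>a\<bar>"] that by (auto simp: abs_if ray_defect_minus split: if_splits)
    ultimately show ?thesis by (intro exI[of _ "- ray_defect x a0 t"]) auto
  next
    case False
    then show ?thesis by (intro exI[of _ 1]) auto
  qed
  then obtain c where c: "\<And>x. 0 < c x" "\<And>x a. d \<le> \<bar>a\<bar> \<Longrightarrow> \<bar>a\<bar> \<le> M \<Longrightarrow> ray_defect x a t \<le> - c x" by metis
  define c0 where "c0 = Min (insert 1 (c ` cell))"
  have c0: "0 < c0" "\<And>x. x \<in> cell \<Longrightarrow> c0 \<le> c x" unfolding c0_def using finite_cell c(1) by auto
  have "ray_defect x a t \<le> - c0" if "d \<le> \<bar>a\<bar>" "\<bar>a\<bar> \<le> M" for x a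
  proof -
    obtain k where k: "x + T *s k \<in> cell" by (rule to_cell)
    have "ray_defect x a t = ray_defect (x + T *s k) a t" by (simp add: ray_defect_def)
    then show ?thesis using c(2)[OF that, of "x + T *s k"] c0(2)[OF k] by linarith
  qed
  then show thesis using that c0(1) by blast
qed

text \<open>Quantitative strictness of the maximum: at a site where \<open>\<bar>u x\<bar> > d\<close> the defect is at most \<open>- c\<close> by compactness
  of \<open>d \<le> \<bar>a\<bar> \<le> M\<close> and periodicity, and no site has a positive defect.\<close>
lemma J_ray_gap:
  assumes t: "0 < t" "t \<noteq> 1"
  obtains c where "0 < c" "\<And>u. u \<in> nehari \<Longrightarrow> J u \<le> D \<Longrightarrow> J (\<lambda>x. t * u x) \<le> J u - c"
proof -
  obtain M d where b: "0 < M" "0 < d"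
    "\<And>u x. u \<in> nehari \<Longrightarrow> J u \<le> D \<Longrightarrow> \<bar>u x\<bar> \<le> M" "\<And>u. u \<in> nehari \<Longrightarrow> J u \<le> D \<Longrightarrow> \<exists>x. d < \<bar>u x\<bar>"
    using nehari_sup_bounds[of D] by blast
  obtain c where c: "0 < c" "\<And>x a. d \<le> \<bar>a\<bar> \<Longrightarrow> \<bar>a\<bar> \<le> M \<Longrightarrow> ray_defect x a t \<le> - c"
    using ray_defect_gap[OF b(2) t] by metis
  have "J (\<lambda>x. t * u x) \<le> J u - c" if u: "u \<in> nehari" "J u \<le> D" for u
  proof -
    obtain x where x: "d < \<bar>u x\<bar>" using b(4)[OF u] by blast
    have fin: "finite {x. u x \<noteq> 0}" using nehariD(1)[OF u(1)] by (simp add: fin_supp_def)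
    have xs: "x \<in> {x. u x \<noteq> 0}" using x b(2) by auto
    have "(\<Sum>x | u x \<noteq> 0. ray_defect x (u x) t) = ray_defect x (u x) t + (\<Sum>y\<in>{x. u x \<noteq> 0} - {x}. ray_defect y (u y) t)"
      by (rule sum.remove[OF fin xs])
    moreover have "(\<Sum>y\<in>{x. u x \<noteq> 0} - {x}. ray_defect y (u y) t) \<le> 0"
      using t by (intro sum_nonpos ray_defect_nonpos) auto
    moreover have "ray_defect x (u x) t \<le> - c" using c(2) x b(3)[OF u] by auto
    ultimately show ?thesis using J_ray[OF u(1), of t] t by linarith
  qed
  then show thesis using that c(1) by blast
qed

section \<open>Projection to the Nehari manifold and descent\<close>

lemma l1norm_diff_bound:
  assumes "u \<in> fin_supp" "w \<in> fin_supp" "l1norm (\<lambda>x. w x - u x) < r"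
  shows "\<bar>w x - u x\<bar> < r"
proof -
  have "(\<lambda>x. w x + (-1) * u x) \<in> fin_supp" by (rule fin_supp_add) (use assms in auto)
  then have "\<bar>w x - u x\<bar> \<le> l1norm (\<lambda>x. w x - u x)" using l1norm_ge[of "\<lambda>x. w x - u x" x] by simp
  then show ?thesis using assms by linarith
qed

lemma l1norm_scale: assumes "0 < c" shows "l1norm (\<lambda>x. c * u x) = c * l1norm u"
proof -
  have "{x. c * u x \<noteq> 0} = {x. u x \<noteq> 0}" using assms by auto
  then show ?thesis using assms by (simp add: l1norm_def abs_mult sum_distrib_left)
qed

text \<open>Let \<open>t = ray_scale w\<close>.  If \<open>t > L\<close>, then \<open>J\<close> still increases along the ray from \<open>w\<close> to \<open>L * w\<close>, but
  \<open>J (L * w)\<close> is close to \<open>J (L * u)\<close>, which is smaller than \<open>J u\<close> by the gap of \<open>J_ray_gap\<close>, while \<open>J w\<close> is close to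
  \<open>J u\<close>.  The case \<open>t < 1 / L\<close> is symmetric.  Only bounds uniform on the sublevel set enter, so
  the radius does not depend on \<open>u\<close>.\<close>
lemma ray_scale_near_1:
  assumes L: "1 < L"
  obtains r where "0 < r" "\<And>u w. u \<in> nehari \<Longrightarrow> J u \<le> D \<Longrightarrow> w \<in> fin_supp \<Longrightarrow> l1norm (\<lambda>x. w x - u x) < r
     \<Longrightarrow> w \<noteq> (\<lambda>_. 0) \<and> 1 / L \<le> ray_scale w \<and> ray_scale w \<le> L"
proof -
  obtain M d where b: "0 < M" "0 < d"
    "\<And>u x. u \<in> nehari \<Longrightarrow> J u \<le> D \<Longrightarrow> \<bar>u x\<bar> \<le> M" "\<And>u. u \<in> nehari \<Longrightarrow> J u \<le> D \<Longrightarrow> \<exists>x. d < \<bar>u x\<bar>"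
    using nehari_sup_bounds[of D] by blast
  have L0: "0 < L" "L \<noteq> 1" "0 < 1 / L" "1 / L \<noteq> 1" using L by auto
  obtain c1 where c1: "0 < c1" "\<And>u. u \<in> nehari \<Longrightarrow> J u \<le> D \<Longrightarrow> J (\<lambda>x. L * u x) \<le> J u - c1"
    using J_ray_gap[OF L0(1,2), of D] by blast
  obtain c2 where c2: "0 < c2" "\<And>u. u \<in> nehari \<Longrightarrow> J u \<le> D \<Longrightarrow> J (\<lambda>x. (1 / L) * u x) \<le> J u - c2"
    using J_ray_gap[OF L0(3,4), of D] by blast
  obtain C where C: "0 \<le> C" "\<And>u w. u \<in> fin_supp \<Longrightarrow> w \<in> fin_supp \<Longrightarrow> (\<And>x. \<bar>u x\<bar> \<le> L * (M + 1)) \<Longrightarrow> (\<And>x. \<bar>u x + w x\<bar> \<le> L * (M + 1))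
    \<Longrightarrow> \<bar>J (\<lambda>x. u x + w x) - J u\<bar> \<le> C * l1norm w" using J_lipschitz[of "L * (M + 1)"] by blast
  define r where "r = Min {1, d, c1 / (C * (1 + L) + 1), c2 / (C * (1 + L) + 1)}"
  have den: "0 < C * (1 + L) + 1" using C(1) L by (simp add: add_nonneg_pos)
  have r: "0 < r" "r \<le> 1" "r \<le> d" "r \<le> c1 / (C * (1 + L) + 1)" "r \<le> c2 / (C * (1 + L) + 1)"
    using b c1 c2 den by (auto simp: r_def)
  have rc: "r * (C * (1 + L) + 1) \<le> c1" "r * (C * (1 + L) + 1) \<le> c2" using r den by (auto simp: field_simps)
  have main: "w \<noteq> (\<lambda>_. 0) \<and> 1 / L \<le> ray_scale w \<and> ray_scale w \<le> L"
    if u: "u \<in> nehari" "J u \<le> D" and w: "w \<in> fin_supp" and near: "l1norm (\<lambda>x. w x - u x) < r" for u w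
  proof -
    have uf: "u \<in> fin_supp" using nehariD(1)[OF u(1)] .
    have pt: "\<bar>w x - u x\<bar> < r" for x by (rule l1norm_diff_bound[OF uf w near])
    obtain x where x: "d < \<bar>u x\<bar>" using b(4)[OF u] by blast
    have "w x \<noteq> 0" using x pt[of x] r(3) by auto
    then have w0: "w \<noteq> (\<lambda>_. 0)" by auto
    define t where "t = ray_scale w"
    have t: "0 < t" "proj w \<in> nehari" using proj_nehari[OF w w0] by (auto simp: t_def)
    have wt: "w = (\<lambda>x. (1 / t) * proj w x)" using t(1) by (simp add: proj_def t_def)
    have lip: "\<bar>J (\<lambda>x. c * w x) - J (\<lambda>x. c * u x)\<bar> \<le> C * (L * r)" if c: "0 < c" "c \<le> L" for c
    proof -
      have "\<bar>J (\<lambda>x. c * u x + c * (w x - u x)) - J (\<lambda>x. c * u x)\<bar> \<le> C * l1norm (\<lambda>x. c * (w x - u x))"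
      proof (rule C(2))
        show "(\<lambda>x. c * u x) \<in> fin_supp" using uf by (rule fin_supp_scale)
        have "(\<lambda>x. w x + (-1) * u x) \<in> fin_supp" by (rule fin_supp_add[OF w uf])
        then show "(\<lambda>x. c * (w x - u x)) \<in> fin_supp" using fin_supp_scale[of "\<lambda>x. w x - u x" c] by simp
        fix x
        have ux: "\<bar>u x\<bar> \<le> M" by (rule b(3)[OF u])
        have "\<bar>c * u x\<bar> \<le> L * (M + 1)" using c ux b(1) by (simp add: abs_mult mult_mono)
        then show "\<bar>c * u x\<bar> \<le> L * (M + 1)" .
        have "\<bar>w x\<bar> \<le> M + 1" using ux pt[of x] r(2) by linarith
        then have "\<bar>c * w x\<bar> \<le> L * (M + 1)" using c b(1) by (simp add: abs_mult mult_mono)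
        then show "\<bar>c * u x + c * (w x - u x)\<bar> \<le> L * (M + 1)" by (simp add: algebra_simps)
      qed
      moreover have "(\<lambda>x. c * u x + c * (w x - u x)) = (\<lambda>x. c * w x)" by (simp add: algebra_simps)
      moreover have "C * l1norm (\<lambda>x. c * (w x - u x)) \<le> C * (L * r)"
      proof -
        have "c * l1norm (\<lambda>x. w x - u x) \<le> L * r"
          using c near by (intro mult_mono) (auto simp: l1norm_def sum_nonneg)
        then show ?thesis using c C(1) by (simp add: l1norm_scale mult_left_mono)
      qed
      ultimately show ?thesis by simp
    qed
    have lip1: "J u - C * r \<le> J w"
    proof -
      have "\<bar>J (\<lambda>x. u x + (w x - u x)) - J u\<bar> \<le> C * l1norm (\<lambda>x. w x - u x)"
      proof (rule C(2)[OF uf])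
        show "(\<lambda>x. w x - u x) \<in> fin_supp" using fin_supp_add[OF w uf, of "-1"] by simp
        fix x
        have ux: "\<bar>u x\<bar> \<le> M" by (rule b(3)[OF u])
        have LM: "M + 1 \<le> L * (M + 1)" using L b(1) by simp
        show "\<bar>u x\<bar> \<le> L * (M + 1)" using ux LM by linarith
        show "\<bar>u x + (w x - u x)\<bar> \<le> L * (M + 1)" using ux pt[of x] r(2) LM by linarith
      qed
      moreover have "C * l1norm (\<lambda>x. w x - u x) \<le> C * r" using near C(1) by (intro mult_left_mono) auto
      ultimately show ?thesis by simp
    qed
    have Cr: "C * r + C * (L * r) < r * (C * (1 + L) + 1)" using r(1) by (simp add: algebra_simps)
    have "\<not> L < t"
    proof
      assume Lt: "L < t"
      have "J (\<lambda>x. (1 / t) * proj w x) \<le> J (\<lambda>x. (L / t) * proj w x)"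
        using Lt t L by (intro J_ray_mono(1)) (auto simp: field_simps)
      moreover have "(\<lambda>x. (L / t) * proj w x) = (\<lambda>x. L * w x)" using t by (simp add: proj_def t_def)
      ultimately have "J w \<le> J (\<lambda>x. L * w x)" using wt by simp
      moreover have "J (\<lambda>x. L * w x) \<le> J (\<lambda>x. L * u x) + C * (L * r)" using lip[of L] L by linarith
      ultimately show False using c1(2)[OF u] lip1 Cr rc(1) by linarith
    qed
    moreover have "\<not> t < 1 / L"
    proof
      assume Lt: "t < 1 / L"
      have "J (\<lambda>x. (1 / t) * proj w x) \<le> J (\<lambda>x. (1 / L / t) * proj w x)"
        using Lt t L by (intro J_ray_mono(2)) (auto simp: field_simps)
      moreover have "(\<lambda>x. (1 / L / t) * proj w x) = (\<lambda>x. (1 / L) * w x)" using t by (simp add: proj_def t_def)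
      ultimately have "J w \<le> J (\<lambda>x. (1 / L) * w x)" using wt by simp
      moreover have "1 / L \<le> 1" using L by simp
      then have "1 / L \<le> L" using L by linarith
      then have "J (\<lambda>x. (1 / L) * w x) \<le> J (\<lambda>x. (1 / L) * u x) + C * (L * r)" using lip[of "1 / L"] L0(3) by linarith
      ultimately show False using c2(2)[OF u] lip1 Cr rc(2) by linarith
    qed
    ultimately show ?thesis using w0 by (simp add: t_def)
  qed
  show thesis using that[OF r(1) main] .
qed

lemma proj_near:
  assumes e: "0 < e"
  obtains r where "0 < r" "\<And>u w. u \<in> nehari \<Longrightarrow> J u \<le> D \<Longrightarrow> w \<in> fin_supp \<Longrightarrow> l1norm (\<lambda>x. w x - u x) < r
     \<Longrightarrow> w \<noteq> (\<lambda>_. 0) \<and> 1 / 2 \<le> ray_scale w \<and> ray_scale w \<le> 2 \<and> \<bar>ray_scale w - 1\<bar> \<le> e \<and> (\<forall>x. \<bar>proj w x - u x\<bar> \<le> e)"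
proof -
  obtain M d where b: "0 < M" "0 < d"
    "\<And>u x. u \<in> nehari \<Longrightarrow> J u \<le> D \<Longrightarrow> \<bar>u x\<bar> \<le> M" "\<And>u. u \<in> nehari \<Longrightarrow> J u \<le> D \<Longrightarrow> \<exists>x. d < \<bar>u x\<bar>"
    using nehari_sup_bounds[of D] by blast
  define L where "L = 1 + Min {1, e, e / (2 * M)}"
  have L: "1 < L" "L \<le> 2" "L - 1 \<le> e" "L - 1 \<le> e / (2 * M)" using e b(1) by (auto simp: L_def)
  obtain r0 where r0: "0 < r0" "\<And>u w. u \<in> nehari \<Longrightarrow> J u \<le> D \<Longrightarrow> w \<in> fin_supp \<Longrightarrow> l1norm (\<lambda>x. w x - u x) < r0
     \<Longrightarrow> w \<noteq> (\<lambda>_. 0) \<and> 1 / L \<le> ray_scale w \<and> ray_scale w \<le> L" using ray_scale_near_1[OF L(1), of D] by blast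
  define r where "r = min r0 (e / 4)"
  have "w \<noteq> (\<lambda>_. 0) \<and> 1 / 2 \<le> ray_scale w \<and> ray_scale w \<le> 2 \<and> \<bar>ray_scale w - 1\<bar> \<le> e \<and> (\<forall>x. \<bar>proj w x - u x\<bar> \<le> e)"
    if u: "u \<in> nehari" "J u \<le> D" and w: "w \<in> fin_supp" and near: "l1norm (\<lambda>x. w x - u x) < r" for u w
  proof -
    have w1: "w \<noteq> (\<lambda>_. 0)" "1 / L \<le> ray_scale w" "ray_scale w \<le> L" using r0(2)[OF u w] near by (auto simp: r_def)
    have "1 / 2 \<le> 1 / L" using L by (simp add: field_simps)
    moreover have "1 - 1 / L \<le> L - 1"
    proof -
      have "2 \<le> L + 1 / L"
      proof -
        have "0 \<le> (L - 1)\<^sup>2 / L" using L by simp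
        also have "\<dots> = L + 1 / L - 2" using L by (simp add: power2_eq_square field_simps)
        finally show ?thesis by simp
      qed
      then show ?thesis by simp
    qed
    ultimately have t: "1 / 2 \<le> ray_scale w" "ray_scale w \<le> 2" "\<bar>ray_scale w - 1\<bar> \<le> L - 1" using w1 L by linarith+
    have "\<bar>proj w x - u x\<bar> \<le> e" for x
    proof -
      have d1: "\<bar>w x - u x\<bar> < e / 4" using l1norm_diff_bound[OF nehariD(1)[OF u(1)] w, of "e / 4" x] near by (simp add: r_def)
      have "proj w x - u x = ray_scale w * (w x - u x) + (ray_scale w - 1) * u x" by (simp add: proj_def algebra_simps)
      then have "\<bar>proj w x - u x\<bar> \<le> \<bar>ray_scale w * (w x - u x)\<bar> + \<bar>(ray_scale w - 1) * u x\<bar>" by (simp only: abs_triangle_ineq)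
      also have "\<bar>ray_scale w * (w x - u x)\<bar> \<le> 2 * (e / 4)"
        unfolding abs_mult using t d1 by (intro mult_mono) auto
      also have "\<bar>(ray_scale w - 1) * u x\<bar> \<le> (e / (2 * M)) * M"
        unfolding abs_mult using t L b(3)[OF u, of x] e b(1) by (intro mult_mono) auto
      also have "(e / (2 * M)) * M = e / 2" using b(1) by simp
      finally show ?thesis by simp
    qed
    then show ?thesis using w1 t L by auto
  qed
  moreover have "0 < r" using r0(1) e by (simp add: r_def)
  ultimately show thesis using that by blast
qed

text \<open>Moving against \<open>\<phi>\<close> and projecting back.  With \<open>t = ray_scale v\<close> for \<open>v = u - s * \<phi>\<close>, the projected point is
  \<open>t * u - t * s * \<phi>\<close>; scaling \<open>u\<close> by \<open>t\<close> does not increase \<open>J\<close> because \<open>u\<close> is the maximum on its ray, and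
  the mean value theorem compares the rest with the pairing of \<open>\<phi>\<close> with the residual at a point close to
  \<open>u\<close>.  One factor \<open>1 / 2\<close> is lost to \<open>t \<ge> 1 / 2\<close>, the other to the oscillation of the residual.\<close>
lemma nehari_descent:
  assumes al: "0 < \<alpha>"
  obtains s0 where "0 < s0" "\<And>u \<phi> w s. u \<in> nehari \<Longrightarrow> J u \<le> D \<Longrightarrow> \<phi> \<in> fin_supp \<Longrightarrow> 0 \<le> w \<Longrightarrow> w \<le> 1 \<Longrightarrow>
     l1norm \<phi> \<le> w \<Longrightarrow> \<alpha> * w \<le> (\<Sum>x | \<phi> x \<noteq> 0. residual u x * \<phi> x) \<Longrightarrow> 0 < s \<Longrightarrow> s \<le> s0 \<Longrightarrow>
     (\<lambda>x. u x - s * \<phi> x) \<noteq> (\<lambda>_. 0) \<and> J (proj (\<lambda>x. u x - s * \<phi> x)) \<le> J u - s * \<alpha> * w / 4"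
proof -
  obtain M d where b: "0 < M" "0 < d"
    "\<And>u x. u \<in> nehari \<Longrightarrow> J u \<le> D \<Longrightarrow> \<bar>u x\<bar> \<le> M" "\<And>u. u \<in> nehari \<Longrightarrow> J u \<le> D \<Longrightarrow> \<exists>x. d < \<bar>u x\<bar>"
    using nehari_sup_bounds[of D] by blast
  obtain q where q: "0 < q" "\<And>u v x. (\<And>y. \<bar>u y\<bar> \<le> M + 1) \<Longrightarrow> (\<And>y. \<bar>v y\<bar> \<le> M + 1) \<Longrightarrow>
     (\<And>y. \<bar>u y - v y\<bar> \<le> q) \<Longrightarrow> \<bar>residual u x - residual v x\<bar> \<le> \<alpha> / 2"
    using residual_uniform[of "\<alpha> / 2" "M + 1", OF half_gt_zero[OF al]] by blast
  define q' where "q' = min q 1"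
  have q': "0 < q'" "q' \<le> 1" "q' \<le> q" using q(1) by (auto simp: q'_def)
  define e where "e = q' / (2 * M)"
  have e: "0 < e" using q' b(1) by (simp add: e_def)
  obtain r where r: "0 < r" "\<And>u w. u \<in> nehari \<Longrightarrow> J u \<le> D \<Longrightarrow> w \<in> fin_supp \<Longrightarrow> l1norm (\<lambda>x. w x - u x) < r
     \<Longrightarrow> w \<noteq> (\<lambda>_. 0) \<and> 1 / 2 \<le> ray_scale w \<and> ray_scale w \<le> 2 \<and> \<bar>ray_scale w - 1\<bar> \<le> e \<and> (\<forall>x. \<bar>proj w x - u x\<bar> \<le> e)"
    using proj_near[OF e, of D] by blast
  define s0 where "s0 = min (r / 2) (q' / 4)"
  have s0: "0 < s0" "s0 < r" "s0 \<le> q' / 4" using r(1) q' by (auto simp: s0_def)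
  have "(\<lambda>x. u x - s * \<phi> x) \<noteq> (\<lambda>_. 0) \<and> J (proj (\<lambda>x. u x - s * \<phi> x)) \<le> J u - s * \<alpha> * w / 4"
    if u: "u \<in> nehari" "J u \<le> D" and ph: "\<phi> \<in> fin_supp" and w: "0 \<le> w" "w \<le> 1" "l1norm \<phi> \<le> w"
      and sl: "\<alpha> * w \<le> (\<Sum>x | \<phi> x \<noteq> 0. residual u x * \<phi> x)" and s: "0 < s" "s \<le> s0" for u \<phi> w s
  proof -
    define v where "v = (\<lambda>x. u x - s * \<phi> x)"
    have uf: "u \<in> fin_supp" using nehariD(1)[OF u(1)] .
    have vf: "v \<in> fin_supp" using fin_supp_add[OF uf ph, of "- s"] by (simp add: v_def)
    have "l1norm (\<lambda>x. v x - u x) = s * l1norm \<phi>"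
    proof -
      have "l1norm (\<lambda>x. v x - u x) = l1norm (\<lambda>x. s * \<phi> x)" by (simp add: v_def l1norm_def)
      then show ?thesis using s by (simp add: l1norm_scale)
    qed
    also have "\<dots> \<le> s * 1" using w s by (intro mult_left_mono) auto
    finally have near: "l1norm (\<lambda>x. v x - u x) < r" using s s0 by linarith
    define t where "t = ray_scale v"
    have t: "v \<noteq> (\<lambda>_. 0)" "1 / 2 \<le> t" "t \<le> 2" "\<bar>t - 1\<bar> \<le> e"
      using r(2)[OF u vf near] by (auto simp: t_def)
    have tuf: "(\<lambda>x. t * u x) \<in> fin_supp" by (rule fin_supp_scale[OF uf])
    have phf: "(\<lambda>x. - (t * s) * \<phi> x) \<in> fin_supp" by (rule fin_supp_scale[OF ph])
    have supp: "{x. - (t * s) * \<phi> x \<noteq> 0} = {x. \<phi> x \<noteq> 0}" using t(2) s by auto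
    obtain z where z: "0 < z" "z < 1" "J (\<lambda>x. t * u x + - (t * s) * \<phi> x) = J (\<lambda>x. t * u x)
       + (\<Sum>x | - (t * s) * \<phi> x \<noteq> 0. residual (\<lambda>x. t * u x + z * (- (t * s) * \<phi> x)) x * (- (t * s) * \<phi> x))"
      by (rule J_mean_value[OF tuf phf])
    define y where "y = (\<lambda>x. t * u x + z * (- (t * s) * \<phi> x))"
    have pv: "proj v = (\<lambda>x. t * u x + - (t * s) * \<phi> x)" by (simp add: proj_def t_def v_def algebra_simps)
    have yu: "\<bar>y x - u x\<bar> \<le> q'" for x
    proof -
      have phx: "\<bar>\<phi> x\<bar> \<le> 1" using l1norm_ge[OF ph, of x] w by linarith
      have "y x - u x = (t - 1) * u x + - (z * (t * s) * \<phi> x)" by (simp add: y_def algebra_simps)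
      then have "\<bar>y x - u x\<bar> \<le> \<bar>(t - 1) * u x\<bar> + \<bar>- (z * (t * s) * \<phi> x)\<bar>" by (simp only: abs_triangle_ineq)
      also have "\<bar>(t - 1) * u x\<bar> \<le> e * M" unfolding abs_mult using t b(3)[OF u, of x] e by (intro mult_mono) auto
      also have "\<bar>- (z * (t * s) * \<phi> x)\<bar> \<le> 2 * s0"
      proof -
        have ts: "0 \<le> t * s" "t * s \<le> 2 * s0" using t s s0 by (auto intro!: mult_mono)
        have zts: "z * (t * s) \<le> 1 * (2 * s0)" by (rule mult_mono) (use z(1,2) ts in auto)
        have "0 \<le> z * (t * s)" using z(1) ts(1) by simp
        moreover have "z * (t * s) * \<bar>\<phi> x\<bar> \<le> 1 * (2 * s0) * 1" by (rule mult_mono[OF zts phx]) (use s0 in auto)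
        moreover have "\<bar>- (z * (t * s) * \<phi> x)\<bar> = \<bar>z * (t * s)\<bar> * \<bar>\<phi> x\<bar>" by (simp only: abs_minus_cancel abs_mult)
        ultimately show ?thesis by simp
      qed
      also have "e * M = q' / 2" using b(1) by (simp add: e_def)
      finally show ?thesis using s0 by simp
    qed
    have res: "\<bar>residual u x - residual y x\<bar> \<le> \<alpha> / 2" for x
    proof (rule q(2))
      fix x'
      have "\<bar>u x'\<bar> \<le> M" by (rule b(3)[OF u])
      then show "\<bar>u x'\<bar> \<le> M + 1" "\<bar>y x'\<bar> \<le> M + 1" "\<bar>u x' - y x'\<bar> \<le> q" using yu[of x'] q' by linarith+
    qed
    have "(\<Sum>x | \<phi> x \<noteq> 0. residual u x * \<phi> x) - (\<Sum>x | \<phi> x \<noteq> 0. residual y x * \<phi> x)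
        = (\<Sum>x | \<phi> x \<noteq> 0. (residual u x - residual y x) * \<phi> x)"
      by (simp add: left_diff_distrib sum_subtractf)
    also have "\<dots> \<le> (\<Sum>x | \<phi> x \<noteq> 0. \<bar>(residual u x - residual y x) * \<phi> x\<bar>)" by (rule sum_mono) simp
    also have "\<dots> \<le> (\<Sum>x | \<phi> x \<noteq> 0. (\<alpha> / 2) * \<bar>\<phi> x\<bar>)"
      unfolding abs_mult by (intro sum_mono mult_right_mono res) auto
    also have "\<dots> = (\<alpha> / 2) * l1norm \<phi>" by (simp add: l1norm_def sum_distrib_left)
    also have "\<dots> \<le> (\<alpha> / 2) * w" using al w by (intro mult_left_mono) auto
    finally have low: "\<alpha> * w / 2 \<le> (\<Sum>x | \<phi> x \<noteq> 0. residual y x * \<phi> x)" using sl by simp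
    have "J (proj v) = J (\<lambda>x. t * u x) + (\<Sum>x | \<phi> x \<noteq> 0. residual y x * (- (t * s) * \<phi> x))"
      unfolding pv z(3) supp y_def ..
    also have "(\<Sum>x | \<phi> x \<noteq> 0. residual y x * (- (t * s) * \<phi> x)) = - (t * s) * (\<Sum>x | \<phi> x \<noteq> 0. residual y x * \<phi> x)"
      by (simp add: sum_distrib_left mult_ac sum_negf)
    also have "J (\<lambda>x. t * u x) \<le> J u" by (rule J_ray_le[OF u(1)]) (use t in auto)
    finally have up: "J (proj v) \<le> J u - (t * s) * (\<Sum>x | \<phi> x \<noteq> 0. residual y x * \<phi> x)" by simp
    have "(1 / 2 * s) * (\<alpha> * w / 2) \<le> (t * s) * (\<Sum>x | \<phi> x \<noteq> 0. residual y x * \<phi> x)"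
      using t s low al w by (intro mult_mono) auto
    then show ?thesis using up t(1) by (simp add: v_def mult_ac)
  qed
  then show thesis using that s0(1) by blast
qed

end

section \<open>Limits of almost critical sequences\<close>

lemma countable_int_vec: "countable (UNIV :: (int ^ 'n) set)"
proof -
  have "countable (PiE (UNIV :: 'n set) (\<lambda>_. UNIV :: int set))" by (rule countable_PiE) auto
  then have "countable ((\<lambda>g. \<chi> i. g i) ` PiE (UNIV :: 'n set) (\<lambda>_. UNIV :: int set))" by (rule countable_image)
  moreover have "(UNIV :: (int ^ 'n) set) \<subseteq> (\<lambda>g. \<chi> i. g i) ` PiE (UNIV :: 'n set) (\<lambda>_. UNIV :: int set)"
  proof
    fix x :: "int ^ 'n"
    show "x \<in> (\<lambda>g. \<chi> i. g i) ` PiE (UNIV :: 'n set) (\<lambda>_. UNIV :: int set)"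
      by (rule image_eqI[of _ _ "\<lambda>i. x $ i"]) auto
  qed
  ultimately show ?thesis by (rule countable_subset[rotated])
qed

lemma bounded_pointwise_subsequence:
  fixes u :: "nat \<Rightarrow> 'a \<Rightarrow> real"
  assumes cnt: "countable (UNIV :: 'a set)" and M: "\<And>n x. \<bar>u n x\<bar> \<le> M"
  obtains r z where "strict_mono (r :: nat \<Rightarrow> nat)" "\<And>x. (\<lambda>n. u (r n) x) \<longlonglongrightarrow> z x"
proof -
  define v where "v n i = u n (from_nat_into UNIV i)" for n and i :: nat
  have "compact (PiE UNIV (\<lambda>_. {-M..M}) :: (nat \<Rightarrow> real) set)"
  proof -
    have "compactin (powertop_real UNIV) (PiE UNIV (\<lambda>_::nat. {-M..M}))"
      by (subst compactin_PiE) (auto simp: compactin_euclidean_iff)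
    then show ?thesis by (simp add: euclidean_product_topology compactin_euclidean_iff)
  qed
  then have "seq_compact (PiE UNIV (\<lambda>_. {-M..M}) :: (nat \<Rightarrow> real) set)" by (rule compact_imp_seq_compact)
  moreover have "\<forall>n. v n \<in> PiE UNIV (\<lambda>_. {-M..M})" using M by (auto simp: v_def abs_le_iff minus_le_iff)
  ultimately obtain l r where r: "strict_mono (r :: nat \<Rightarrow> nat)" and l: "(v \<circ> r) \<longlonglongrightarrow> l"
    unfolding seq_compact_def by blast
  have "(\<lambda>n. u (r n) x) \<longlonglongrightarrow> l (to_nat_on UNIV x)" for x
  proof -
    have "((\<lambda>n. (v \<circ> r) n (to_nat_on UNIV x)) \<longlongrightarrow> l (to_nat_on UNIV x)) sequentially"
      by (rule continuous_on_tendsto_compose[OF continuous_on_product_coordinates l]) auto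
    then show ?thesis using cnt by (simp add: v_def o_def)
  qed
  then show thesis by (rule that[OF r])
qed

lemma dominated_infsum_small:
  fixes h :: "'a \<Rightarrow> real"
  assumes h: "h summable_on A" "\<And>a. a \<in> A \<Longrightarrow> 0 \<le> h a" and e: "0 < e"
  obtains P where "finite P" "P \<subseteq> A"
    "\<And>g. (\<And>a. a \<in> A \<Longrightarrow> 0 \<le> g a \<and> g a \<le> h a) \<Longrightarrow> infsum g A \<le> sum g P + e"
proof -
  obtain P where P: "finite P" "P \<subseteq> A" "dist (sum h P) (infsum h A) \<le> e"
    using infsum_finite_approximation[OF h(1) e] by blast
  have "infsum g A \<le> sum g P + e" if g: "\<And>a. a \<in> A \<Longrightarrow> 0 \<le> g a \<and> g a \<le> h a" for g
  proof -
    have gs: "g summable_on A"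
      by (rule summable_on_comparison_test[OF h(1)]) (use g in auto)
    have split: "infsum k A = sum k P + infsum k (A - P)" if "k summable_on A" for k :: "'a \<Rightarrow> real"
    proof -
      have "infsum k A = infsum k (P \<union> (A - P))" using P by (simp add: Un_absorb1)
      also have "\<dots> = infsum k P + infsum k (A - P)"
        by (rule infsum_Un_disjoint) (use P that in \<open>auto intro: summable_on_subset_banach\<close>)
      finally show ?thesis using P by simp
    qed
    have "infsum g (A - P) \<le> infsum h (A - P)"
      by (rule infsum_mono) (use gs h g in \<open>auto intro: summable_on_subset_banach\<close>)
    moreover have "infsum h (A - P) \<le> e" using split[OF h(1)] P(3) by (simp add: dist_real_def)
    ultimately show ?thesis using split[OF gs] by linarith
  qed
  then show thesis using that P by blast
qed

text \<open>Shrinks \<open>t\<close> towards \<open>0\<close> by \<open>e\<close>, cutting off at \<open>0\<close>: continuous, odd, and \<open>1\<close>-Lipschitz.\<close>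
definition soft_threshold :: "real \<Rightarrow> real \<Rightarrow> real" where
  "soft_threshold e t = max (t - e) 0 - max (- t - e) 0"

lemma soft_threshold_props:
  assumes "0 \<le> e" "0 \<le> e'"
  shows "\<bar>soft_threshold e t - t\<bar> \<le> e"
    and "\<bar>soft_threshold e t - soft_threshold e' t\<bar> \<le> max e e'"
    and "\<bar>soft_threshold e t - soft_threshold e' t\<bar> \<le> \<bar>t\<bar>"
    and "\<bar>(soft_threshold e t - soft_threshold e' t) - (soft_threshold e s - soft_threshold e' s)\<bar> \<le> \<bar>t - s\<bar>"
  using assms by (auto simp: soft_threshold_def abs_if max_def)

context periodic_problem
begin

lemma psum_limit:
  assumes u: "\<And>n. u n \<in> fin_supp" "\<And>n. psum (u n) \<le> R" and z: "\<And>x. (\<lambda>n. u n x) \<longlonglongrightarrow> z x" and B: "finite B"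
  shows "(\<Sum>x\<in>B. \<bar>z x\<bar> powr pstar) \<le> R"
proof (rule LIMSEQ_le_const2)
  have "0 < pstar" using pstar_gt p2 by simp
  then show "(\<lambda>n. \<Sum>x\<in>B. \<bar>u n x\<bar> powr pstar) \<longlonglongrightarrow> (\<Sum>x\<in>B. \<bar>z x\<bar> powr pstar)"
    by (intro tendsto_sum tendsto_powr' tendsto_rabs z tendsto_const) auto
  have "(\<Sum>x\<in>B. \<bar>u n x\<bar> powr pstar) \<le> R" for n
  proof -
    have "(\<Sum>x\<in>B. \<bar>u n x\<bar> powr pstar) = (\<Sum>x\<in>B \<inter> {x. u n x \<noteq> 0}. \<bar>u n x\<bar> powr pstar)"
      by (rule sum.mono_neutral_right) (use B in auto)
    also have "\<dots> \<le> psum (u n)" unfolding psum_eq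
      by (rule sum_mono2) (use u(1)[of n] in \<open>auto simp: fin_supp_def\<close>)
    finally show ?thesis using u(2)[of n] by linarith
  qed
  then show "\<exists>N. \<forall>n\<ge>N. (\<Sum>x\<in>B. \<bar>u n x\<bar> powr pstar) \<le> R" by blast
qed

lemma decay_of_psum:
  assumes z: "\<And>B. finite B \<Longrightarrow> (\<Sum>x\<in>B. \<bar>z x\<bar> powr pstar) \<le> R" and d: "0 < d"
  shows "finite {x. d \<le> \<bar>z x\<bar>}"
proof (rule ccontr)
  assume inf: "infinite {x. d \<le> \<bar>z x\<bar>}"
  have pp: "0 < pstar" using pstar_gt p2 by simp
  obtain m :: nat where m: "R / d powr pstar < real m" using reals_Archimedean2 by blast
  obtain B where B: "finite B" "card B = m" "B \<subseteq> {x. d \<le> \<bar>z x\<bar>}" using infinite_arbitrarily_large[OF inf] by blast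
  have "(\<Sum>x\<in>B. d powr pstar) \<le> (\<Sum>x\<in>B. \<bar>z x\<bar> powr pstar)"
    using B(3) d pp by (intro sum_mono powr_mono2) auto
  then have "real m * d powr pstar \<le> R" using z[OF B(1)] B(2) by simp
  then show False using m d by (simp add: field_simps)
qed

text \<open>The limit decays at infinity since \<open>psum\<close> is bounded, so its soft thresholds at heights \<open>1 / (k + 1)\<close> are
  finitely supported.  Differences of two thresholds have increments bounded by those of \<open>z\<close>, which are
  summable by Fatou's lemma, and are uniformly small; so their energies tend to \<open>0\<close> by domination.\<close>
lemma limit_in_E_space:
  assumes u: "\<And>n. u n \<in> fin_supp" "\<And>n. En (u n) \<le> R" "\<And>n. psum (u n) \<le> R" and z: "\<And>x. (\<lambda>n. u n x) \<longlonglongrightarrow> z x"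
  shows "z \<in> E_space p V"
proof -
  have pp: "0 < p" using p2 by simp
  have decay: "finite {x. d \<le> \<bar>z x\<bar>}" if "0 < d" for d
    by (rule decay_of_psum[OF psum_limit[OF u(1) u(3) z] that])
  let ?A = "{(x, y). adj x y} :: ((int ^ 'n) \<times> (int ^ 'n)) set"
  have summE: "(\<lambda>(x, y). \<bar>z y - z x\<bar> powr p) summable_on ?A"
  proof (rule nonneg_bdd_above_summable_on)
    have "(\<Sum>(x, y)\<in>P. \<bar>z y - z x\<bar> powr p) \<le> 2 * R" if P: "finite P" "P \<subseteq> ?A" for P
    proof (rule LIMSEQ_le_const2)
      show "(\<lambda>n. \<Sum>(x, y)\<in>P. \<bar>u n y - u n x\<bar> powr p) \<longlonglongrightarrow> (\<Sum>(x, y)\<in>P. \<bar>z y - z x\<bar> powr p)"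
        unfolding case_prod_unfold
        by (intro tendsto_sum tendsto_powr' tendsto_rabs tendsto_diff z tendsto_const) (use pp in auto)
      have "(\<Sum>(x, y)\<in>P. \<bar>u n y - u n x\<bar> powr p) \<le> 2 * R" for n
      proof -
        have "(\<Sum>(x, y)\<in>P. \<bar>u n y - u n x\<bar> powr p) \<le> edge_energy p (u n)"
          unfolding edge_energy_def using edge_summable[OF u(1)] P by (intro finite_sum_le_infsum) auto
        then show ?thesis using edge_energy_le_En[OF u(1), of n] u(2)[of n] by linarith
      qed
      then show "\<exists>N. \<forall>n\<ge>N. (\<Sum>(x, y)\<in>P. \<bar>u n y - u n x\<bar> powr p) \<le> 2 * R" by blast
    qed
    then show "bdd_above (sum (\<lambda>(x, y). \<bar>z y - z x\<bar> powr p) ` {F. F \<subseteq> ?A \<and> finite F})"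
      by (intro bdd_aboveI2[where M = "2 * R"]) auto
  qed auto
  have summV: "(\<lambda>x. V x * \<bar>z x\<bar> powr p) summable_on UNIV"
  proof (rule nonneg_bdd_above_summable_on)
    have "(\<Sum>x\<in>B. V x * \<bar>z x\<bar> powr p) \<le> R" if B: "finite B" for B
    proof (rule LIMSEQ_le_const2)
      show "(\<lambda>n. \<Sum>x\<in>B. V x * \<bar>u n x\<bar> powr p) \<longlonglongrightarrow> (\<Sum>x\<in>B. V x * \<bar>z x\<bar> powr p)"
        by (intro tendsto_sum tendsto_mult_left tendsto_powr' tendsto_rabs z tendsto_const) (use pp in auto)
      have "(\<Sum>x\<in>B. V x * \<bar>u n x\<bar> powr p) \<le> R" for n
      proof -
        have "(\<lambda>x. V x * \<bar>u n x\<bar> powr p) summable_on UNIV"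
          by (rule finite_nonzero_values_imp_summable_on, rule finite_subset[of _ "{x. u n x \<noteq> 0}"])
             (use u(1)[of n] in \<open>auto simp: fin_supp_def\<close>)
        then have "(\<Sum>x\<in>B. V x * \<bar>u n x\<bar> powr p) \<le> (\<Sum>\<^sub>\<infinity>x\<in>UNIV. V x * \<bar>u n x\<bar> powr p)"
          using B V_nonneg by (intro finite_sum_le_infsum) auto
        also have "\<dots> \<le> En (u n)" using edge_energy_nonneg[of p "u n"] by (simp add: En_def)
        finally show ?thesis using u(2)[of n] by linarith
      qed
      then show "\<exists>N. \<forall>n\<ge>N. (\<Sum>x\<in>B. V x * \<bar>u n x\<bar> powr p) \<le> R" by blast
    qed
    then show "bdd_above (sum (\<lambda>x. V x * \<bar>z x\<bar> powr p) ` {F. F \<subseteq> UNIV \<and> finite F})"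
      by (intro bdd_aboveI2[where M = R]) auto
  qed (simp add: V_nonneg)
  define ph where "ph k x = soft_threshold (1 / real (Suc k)) (z x)" for k :: nat and x
  have ph_fin: "ph k \<in> fin_supp" for k
  proof -
    have "{x. ph k x \<noteq> 0} \<subseteq> {x. 1 / real (Suc k) \<le> \<bar>z x\<bar>}"
      by (auto simp: ph_def soft_threshold_def max_def split: if_splits)
    then show ?thesis using decay[of "1 / real (Suc k)"] by (auto simp: fin_supp_def intro: finite_subset)
  qed
  have ph_lim: "(\<lambda>k. ph k x) \<longlonglongrightarrow> z x" for x
  proof -
    have "(\<lambda>k. ph k x - z x) \<longlonglongrightarrow> 0"
    proof (rule Lim_null_comparison)
      show "\<forall>\<^sub>F k in sequentially. norm (ph k x - z x) \<le> 1 / real (Suc k)"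
        using soft_threshold_props(1)[of "1 / real (Suc _)" 0 "z x"] by (simp add: ph_def)
      show "(\<lambda>k. 1 / real (Suc k)) \<longlonglongrightarrow> 0" using LIMSEQ_inverse_real_of_nat by (simp add: inverse_eq_divide)
    qed
    then show ?thesis by (simp add: LIM_zero_iff)
  qed
  have cauchy: "\<exists>K. \<forall>k\<ge>K. \<forall>l\<ge>K. E_norm p V (\<lambda>x. ph k x - ph l x) < e" if e: "0 < e" for e
  proof -
    \<comment> \<open>Outside finite sets \<open>P\<close> of edges and \<open>Q\<close> of sites the energy is at most \<open>h\<close> each; on these sets the differences
    are so small that they contribute at most \<open>h\<close>.  In total \<open>3 * h < e powr p\<close>.\<close>
    define h where "h = e powr p / 4"
    have h: "0 < h" using e by (simp add: h_def)
    obtain P where P: "finite P" "P \<subseteq> ?A" "\<And>g. (\<And>a. a \<in> ?A \<Longrightarrow> 0 \<le> g a \<and> g a \<le> (case a of (x, y) \<Rightarrow> \<bar>z y - z x\<bar> powr p)) \<Longrightarrow> infsum g ?A \<le> sum g P + h"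
      using dominated_infsum_small[OF summE _ h] by (auto simp: case_prod_unfold)
    obtain Q where Q: "finite Q" "\<And>g. (\<And>a. 0 \<le> g a \<and> g a \<le> V a * \<bar>z a\<bar> powr p) \<Longrightarrow> infsum g UNIV \<le> sum g Q + h"
      using dominated_infsum_small[OF summV _ h] V_nonneg by auto
    define c where "c = real (card P) + (\<Sum>x\<in>Q. V x) + 1"
    have "0 \<le> (\<Sum>x\<in>Q. V x)" by (intro sum_nonneg V_nonneg)
    then have c: "0 < c" by (simp add: c_def)
    define d where "d = (h / c) powr (1 / p)"
    have d: "0 < d" "d powr p = h / c" using h c pp by (auto simp: d_def powr_powr)
    obtain K :: nat where K: "2 / d < real K" using reals_Archimedean2 by blast
    have "E_norm p V (\<lambda>x. ph k x - ph l x) < e" if kl: "K \<le> k" "K \<le> l" for k l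
    proof -
      define w where "w = (\<lambda>x. ph k x - ph l x)"
      have K0: "0 < real K" using K d(1) by (smt (verit) divide_pos_pos)
      have small: "\<bar>w x\<bar> \<le> d / 2" for x
      proof -
        have "1 / real (Suc k) \<le> 1 / real K" "1 / real (Suc l) \<le> 1 / real K"
          using kl K0 by (auto intro!: divide_left_mono)
        moreover have "1 / real K \<le> d / 2" using K K0 d(1) by (simp add: field_simps)
        ultimately have "max (1 / real (Suc k)) (1 / real (Suc l)) \<le> d / 2" by (intro max.boundedI) linarith+
        moreover have "\<bar>soft_threshold (1 / real (Suc k)) (z x) - soft_threshold (1 / real (Suc l)) (z x)\<bar>
            \<le> max (1 / real (Suc k)) (1 / real (Suc l))" by (rule soft_threshold_props(2)) auto
        ultimately show ?thesis unfolding w_def ph_def by (rule order_trans[rotated])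
      qed
      have dE: "\<bar>w y - w x\<bar> \<le> \<bar>z y - z x\<bar>" for x y
        using soft_threshold_props(4)[of "1 / real (Suc k)" "1 / real (Suc l)" "z y" "z x"] by (simp add: w_def ph_def)
      have dV: "\<bar>w x\<bar> \<le> \<bar>z x\<bar>" for x
        using soft_threshold_props(3)[of "1 / real (Suc k)" "1 / real (Suc l)" "z x"] by (simp add: w_def ph_def)
      have "edge_energy p w \<le> (\<Sum>(x, y)\<in>P. \<bar>w y - w x\<bar> powr p) + h"
        unfolding edge_energy_def by (rule P(3)) (use dE pp in \<open>auto intro!: powr_mono2\<close>)
      also have "(\<Sum>(x, y)\<in>P. \<bar>w y - w x\<bar> powr p) \<le> (\<Sum>(x, y)\<in>P. d powr p)"
      proof (rule sum_mono)
        fix a :: "(int ^ 'n) \<times> (int ^ 'n)"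
        have "\<bar>w (snd a) - w (fst a)\<bar> \<le> d" using small[of "fst a"] small[of "snd a"] by linarith
        then have "\<bar>w (snd a) - w (fst a)\<bar> powr p \<le> d powr p" using pp by (intro powr_mono2) auto
        then show "(case a of (x, y) \<Rightarrow> \<bar>w y - w x\<bar> powr p) \<le> (case a of (x, y) \<Rightarrow> d powr p)"
          by (simp add: case_prod_unfold)
      qed
      also have "(\<Sum>(x, y)\<in>P. d powr p) = real (card P) * d powr p" by (simp add: case_prod_unfold)
      finally have 1: "edge_energy p w \<le> real (card P) * d powr p + h" by simp
      have "(\<Sum>\<^sub>\<infinity>x\<in>UNIV. V x * \<bar>w x\<bar> powr p) \<le> (\<Sum>x\<in>Q. V x * \<bar>w x\<bar> powr p) + h"
        by (rule Q(2)) (use dV pp V_nonneg in \<open>auto intro!: mult_left_mono powr_mono2\<close>)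
      also have "(\<Sum>x\<in>Q. V x * \<bar>w x\<bar> powr p) \<le> (\<Sum>x\<in>Q. V x * d powr p)"
      proof (intro sum_mono mult_left_mono V_nonneg powr_mono2)
        fix x show "\<bar>w x\<bar> \<le> d" using small[of x] d(1) by linarith
      qed (use pp in auto)
      also have "\<dots> = (\<Sum>x\<in>Q. V x) * d powr p" by (simp add: sum_distrib_right)
      finally have 2: "(\<Sum>\<^sub>\<infinity>x\<in>UNIV. V x * \<bar>w x\<bar> powr p) \<le> (\<Sum>x\<in>Q. V x) * d powr p + h" by simp
      have "(real (card P) + (\<Sum>x\<in>Q. V x)) * d powr p \<le> c * d powr p" by (intro mult_right_mono) (auto simp: c_def)
      also have "c * d powr p = h" using c by (simp add: d(2))
      finally have "real (card P) * d powr p + (\<Sum>x\<in>Q. V x) * d powr p \<le> h" by (simp add: algebra_simps)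
      moreover have "0 \<le> edge_energy p w" by (rule edge_energy_nonneg)
      ultimately have "En w \<le> 3 * h" using 1 2 by (simp add: En_def)
      moreover have "3 * h < e powr p" using e by (simp add: h_def)
      ultimately have "En w < e powr p" by linarith
      then have "En w powr (1 / p) < (e powr p) powr (1 / p)" using En_nonneg[of w] pp by (intro powr_less_mono2) auto
      also have "\<dots> = e" using e pp by (simp add: powr_powr)
      finally show ?thesis by (simp add: E_norm_En w_def)
    qed
    then show ?thesis by blast
  qed
  show ?thesis unfolding E_space_def using ph_fin cauchy ph_lim by blast
qed

text \<open>Subtracting one member of a Cauchy sequence far out leaves functions of energy at most \<open>1\<close>, to whose limit
  the Sobolev inequality applies.\<close>
lemma E_space_decay:
  assumes z: "z \<in> E_space p V" and d: "0 < d" shows "finite {x. d \<le> \<bar>z x\<bar>}"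
proof -
  have pp: "0 < p" using p2 by simp
  obtain ph where ph: "\<And>k. ph k \<in> fin_supp" "\<And>e. 0 < e \<Longrightarrow> \<exists>K. \<forall>k\<ge>K. \<forall>l\<ge>K. E_norm p V (\<lambda>x. ph k x - ph l x) < e"
    "\<And>x. (\<lambda>k. ph k x) \<longlonglongrightarrow> z x" using z by (auto simp: E_space_def)
  obtain K where K: "\<And>k l. K \<le> k \<Longrightarrow> K \<le> l \<Longrightarrow> E_norm p V (\<lambda>x. ph k x - ph l x) < 1" using ph(2)[of 1] by auto
  obtain C where C: "0 < C" "\<And>u. u \<in> fin_supp \<Longrightarrow> psum u \<le> C * En u powr (pstar / p)" using Sobolev by blast
  define w where "w n x = ph (n + K) x - ph K x" for n x
  have wf: "w n \<in> fin_supp" for n using fin_supp_add[OF ph(1) ph(1), of "n + K" "-1" K] by (simp add: w_def[abs_def])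
  have "psum (w n) \<le> C" for n
  proof -
    have "En (w n) powr (1 / p) < 1" using K[of "n + K" K] by (simp add: E_norm_En w_def[abs_def])
    then have "En (w n) < 1"
      using pp by (metis En_nonneg ge_one_powr_ge_zero divide_nonneg_pos less_eq_real_def not_less zero_le_one)
    then have "En (w n) powr (pstar / p) \<le> 1 powr (pstar / p)"
      using En_nonneg[of "w n"] pp pstar_gt by (intro powr_mono2) auto
    then have "C * En (w n) powr (pstar / p) \<le> C * 1" using C(1) by (intro mult_left_mono) auto
    then show ?thesis using C(2)[OF wf, of n] by linarith
  qed
  moreover have "(\<lambda>n. w n x) \<longlonglongrightarrow> z x - ph K x" for x
    unfolding w_def by (intro tendsto_diff tendsto_const LIMSEQ_ignore_initial_segment ph(3))
  ultimately have "finite {x. d \<le> \<bar>z x - ph K x\<bar>}"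
    by (intro decay_of_psum[OF psum_limit[OF wf]] d)
  moreover have "{x. d \<le> \<bar>z x\<bar>} \<subseteq> {x. d \<le> \<bar>z x - ph K x\<bar>} \<union> {x. ph K x \<noteq> 0}" by auto
  moreover have "finite {x. ph K x \<noteq> 0}" using ph(1)[of K] by (simp add: fin_supp_def)
  ultimately show ?thesis by (meson finite_Un finite_subset)
qed

lemma limit_is_solution:
  assumes u: "\<And>n. u n \<in> fin_supp" "\<And>n. En (u n) \<le> R" "\<And>n. psum (u n) \<le> R" and z: "\<And>x. (\<lambda>n. u n x) \<longlonglongrightarrow> z x"
    and r: "\<And>x. (\<lambda>n. residual (u n) x) \<longlonglongrightarrow> 0"
  shows "z \<in> solutions p V f"
proof -
  have "residual z x = 0" for x
    using LIMSEQ_unique[OF residual_tendsto[OF z] r] .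
  then show ?thesis
    using limit_in_E_space[OF u z] by (auto simp: solutions_def residual_def)
qed

text \<open>The energy of a solution.  It is defined through the density \<open>G\<close>, as the separate terms of \<open>J\<close> are known
  for finitely supported functions only.\<close>
definition level :: "(int ^ 'n \<Rightarrow> real) \<Rightarrow> real" where "level z = (\<Sum>\<^sub>\<infinity>x\<in>UNIV. G x (z x))"

text \<open>Outside a finite set \<open>B\<close> both \<open>z\<close> and \<open>u n\<close> are small, where \<open>G\<close> is at most a small multiple of
  \<open>\<bar>t\<bar> powr pstar\<close>; the bound on \<open>psum\<close> makes both tails small.  On \<open>B\<close> there is pointwise convergence.\<close>
lemma J_tendsto_level:
  assumes u: "\<And>n. u n \<in> nehari" "\<And>n. psum (u n) \<le> R"
    and unif: "\<And>e. 0 < e \<Longrightarrow> \<exists>n0. \<forall>n\<ge>n0. \<forall>x. \<bar>u n x - z x\<bar> \<le> e"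
  shows "(\<lambda>n. J (u n)) \<longlonglongrightarrow> level z"
proof (rule LIMSEQ_I)
  fix e :: real assume e: "0 < e"
  have z: "(\<lambda>n. u n x) \<longlonglongrightarrow> z x" for x
  proof (rule LIMSEQ_I)
    fix e :: real assume "0 < e"
    then obtain n0 where "\<forall>n\<ge>n0. \<forall>x. \<bar>u n x - z x\<bar> \<le> e / 2" using unif[of "e / 2"] by auto
    then have "norm (u n x - z x) < e" if "n0 \<le> n" for n
    proof -
      have "\<bar>u n x - z x\<bar> \<le> e / 2" using \<open>\<forall>n\<ge>n0. \<forall>x. \<bar>u n x - z x\<bar> \<le> e / 2\<close> that by blast
      then show ?thesis using \<open>0 < e\<close> by simp
    qed
    then show "\<exists>no. \<forall>n\<ge>no. norm (u n x - z x) < e" by blast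
  qed
  have uf: "u n \<in> fin_supp" for n using nehariD(1)[OF u(1)] .
  have zs: "(\<Sum>x\<in>B. \<bar>z x\<bar> powr pstar) \<le> R" if "finite B" for B by (rule psum_limit[OF uf u(2) z that])
  have R: "0 \<le> R" using zs[of "{}"] by simp
  define c where "c = e / (4 * (R + 1))"
  have c: "0 < c" "c * R \<le> e / 4" using e R by (auto simp: c_def field_simps)
  obtain d where d: "0 < d" "\<And>x t. \<bar>t\<bar> \<le> d \<Longrightarrow> f x t * t \<le> c * \<bar>t\<bar> powr pstar" using F_small[OF c(1)] by metis
  have Gd: "G x t \<le> c * \<bar>t\<bar> powr pstar" if "\<bar>t\<bar> \<le> d" for x t
  proof -
    have "G x t \<le> f x t * t / p" using F_nonneg by (simp add: G_def)
    also have "\<dots> \<le> f x t * t" using p2 f_times_nonneg[of x t] by (simp add: divide_le_eq mult_le_cancel_left1)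
    also have "\<dots> \<le> c * \<bar>t\<bar> powr pstar" by (rule d(2)[OF that])
    finally show ?thesis .
  qed
  define B where "B = {x. d / 2 \<le> \<bar>z x\<bar>}"
  have B: "finite B" unfolding B_def using d(1) by (intro decay_of_psum[OF zs]) auto
  obtain n0 where n0: "\<And>n x. n0 \<le> n \<Longrightarrow> \<bar>u n x - z x\<bar> \<le> d / 2" using unif[of "d / 2"] d(1) by auto
  have Blim: "(\<lambda>n. \<Sum>x\<in>B. G x (u n x)) \<longlonglongrightarrow> (\<Sum>x\<in>B. G x (z x))"
    by (intro tendsto_sum continuous_on_tendsto_compose[OF G_cont[of UNIV] z]) auto
  have e4: "0 < e / 4" using e by simp
  obtain n1 where n1: "\<And>n. n1 \<le> n \<Longrightarrow> \<bar>(\<Sum>x\<in>B. G x (u n x)) - (\<Sum>x\<in>B. G x (z x))\<bar> < e / 4"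
    using LIMSEQ_D[OF Blim e4] unfolding real_norm_def by blast
  have tailz: "(\<lambda>x. G x (z x)) summable_on (- B)" "infsum (\<lambda>x. G x (z x)) (- B) \<le> e / 4"
  proof -
    have bd: "(\<Sum>x\<in>P. G x (z x)) \<le> e / 4" if P: "finite P" "P \<subseteq> - B" for P
    proof -
      have "(\<Sum>x\<in>P. G x (z x)) \<le> (\<Sum>x\<in>P. c * \<bar>z x\<bar> powr pstar)"
        using P d(1) by (intro sum_mono Gd) (auto simp: B_def)
      also have "\<dots> \<le> c * R" unfolding sum_distrib_left[symmetric] using zs[OF P(1)] c by (intro mult_left_mono) auto
      finally show ?thesis using c by linarith
    qed
    then show s: "(\<lambda>x. G x (z x)) summable_on (- B)"
      by (intro nonneg_bdd_above_summable_on G_nonneg bdd_aboveI2[where M = "e / 4"]) auto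
    show "infsum (\<lambda>x. G x (z x)) (- B) \<le> e / 4" by (rule infsum_le_finite_sums[OF s]) (use bd in auto)
  qed
  have lev: "level z = (\<Sum>x\<in>B. G x (z x)) + infsum (\<lambda>x. G x (z x)) (- B)"
  proof -
    have "infsum (\<lambda>x. G x (z x)) (B \<union> - B) = infsum (\<lambda>x. G x (z x)) B + infsum (\<lambda>x. G x (z x)) (- B)"
      by (rule infsum_Un_disjoint) (use B tailz in auto)
    then show ?thesis using B by (simp add: level_def)
  qed
  have tail0: "0 \<le> infsum (\<lambda>x. G x (z x)) (- B)" by (rule infsum_nonneg) (rule G_nonneg)
  show "\<exists>no. \<forall>n\<ge>no. norm (J (u n) - level z) < e"
  proof (intro exI allI impI)
    fix n assume n: "max n0 n1 \<le> n"
    define S where "S = {x. u n x \<noteq> 0}"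
    have S: "finite S" using uf[of n] by (simp add: S_def fin_supp_def)
    have "J (u n) = (\<Sum>x\<in>S \<union> B. G x (u n x))"
      unfolding J_nehari[OF u(1)] by (rule site_sum_eq) (use S B in \<open>auto simp: S_def\<close>)
    also have "\<dots> = (\<Sum>x\<in>B. G x (u n x)) + (\<Sum>x\<in>S - B. G x (u n x))"
    proof -
      have "S \<union> B = B \<union> (S - B)" by blast
      moreover have "(\<Sum>x\<in>B \<union> (S - B). G x (u n x)) = (\<Sum>x\<in>B. G x (u n x)) + (\<Sum>x\<in>S - B. G x (u n x))"
        by (rule sum.union_disjoint) (use S B in auto)
      ultimately show ?thesis by (simp only:)
    qed
    finally have Jn: "J (u n) = (\<Sum>x\<in>B. G x (u n x)) + (\<Sum>x\<in>S - B. G x (u n x))" .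
    have t0: "0 \<le> (\<Sum>x\<in>S - B. G x (u n x))" by (rule sum_nonneg) (rule G_nonneg)
    have "(\<Sum>x\<in>S - B. G x (u n x)) \<le> (\<Sum>x\<in>S - B. c * \<bar>u n x\<bar> powr pstar)"
    proof (rule sum_mono)
      fix x assume "x \<in> S - B"
      then have "\<bar>z x\<bar> < d / 2" by (simp add: B_def)
      moreover have "\<bar>u n x - z x\<bar> \<le> d / 2" using n0[of n x] n by simp
      ultimately have "\<bar>u n x\<bar> \<le> d" by linarith
      then show "G x (u n x) \<le> c * \<bar>u n x\<bar> powr pstar" by (rule Gd)
    qed
    also have "\<dots> \<le> (\<Sum>x\<in>S. c * \<bar>u n x\<bar> powr pstar)" by (rule sum_mono2) (use S c in auto)
    also have "\<dots> = c * psum (u n)" by (simp add: psum_eq S_def sum_distrib_left)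
    also have "\<dots> \<le> c * R" using u(2) c by (intro mult_left_mono) auto
    finally have "(\<Sum>x\<in>S - B. G x (u n x)) \<le> e / 4" using c by linarith
    moreover have "\<bar>(\<Sum>x\<in>B. G x (u n x)) - (\<Sum>x\<in>B. G x (z x))\<bar> < e / 4" using n1[of n] n by simp
    ultimately show "norm (J (u n) - level z) < e" using Jn lev tail0 t0 tailz(2) e unfolding real_norm_def by linarith
  qed
qed

end

section \<open>Antipodal covers of spheres\<close>

fun alternating :: "bool \<Rightarrow> bool list \<Rightarrow> bool" where
  "alternating b [] = True"
| "alternating b (x # xs) = (x = b \<and> alternating (\<not> b) xs)"

text \<open>The combinatorial core of Ky Fan's lemma: modulo two, the number of ways to delete one letter and
  obtain a word that alternates starting with \<open>b\<close> counts whether the word itself alternates.\<close>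
lemma alternating_facet_parity:
  "even ((\<Sum>i<length xs. of_bool (alternating b (take i xs @ drop (Suc i) xs)))
     + of_bool (alternating b xs) + of_bool (alternating (\<not> b) xs) :: nat)"
proof (induction xs arbitrary: b)
  case (Cons x xs)
  have "(\<Sum>i<length (x # xs). of_bool (alternating b (take i (x # xs) @ drop (Suc i) (x # xs))))
      = (of_bool (alternating b xs) :: nat)
        + (if x = b then \<Sum>i<length xs. of_bool (alternating (\<not> b) (take i xs @ drop (Suc i) xs)) else 0)"
    by (simp add: sum.lessThan_Suc_shift del: sum.lessThan_Suc)
  then show ?case
    using Cons[of "\<not> b"] by (cases "x = b") auto
qed simp

text \<open>A finite set of labels with distinct absolute values, sorted by absolute value, has alternating signs starting
  with \<open>b\<close>, where \<open>True\<close> stands for a positive sign.\<close>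
definition alternating_set :: "bool \<Rightarrow> int set \<Rightarrow> bool" where
  "alternating_set b L \<longleftrightarrow>
     alternating b (map (\<lambda>k. int k \<in> L) (sorted_list_of_set ((\<lambda>l. nat \<bar>l\<bar>) ` L)))"

lemma alternating_set_facet_parity:
  assumes fin: "finite L" and nc: "\<And>l. l \<in> L \<Longrightarrow> - l \<notin> L"
  shows "even ((\<Sum>l\<in>L. of_bool (alternating_set b (L - {l})))
           + of_bool (alternating_set b L) + of_bool (alternating_set (\<not> b) L) :: nat)"
proof -
  define K where "K = (\<lambda>l. nat \<bar>l\<bar>) ` L"
  define ks where "ks = sorted_list_of_set K"
  have finK: "finite K" by (simp add: K_def fin)
  have inj: "inj_on (\<lambda>l. nat \<bar>l\<bar>) L"
    by (rule inj_onI) (metis nc abs_eq_iff nat_abs_int_diff nat_0_le abs_ge_zero eq_nat_nat_iff)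
  have dist: "distinct ks" and setks: "set ks = K" and sortd: "sorted ks"
    by (auto simp: ks_def finK)
  have len: "length ks = card K" using dist setks distinct_card by fastforce
  have facet: "alternating_set b (L - {l}) =
      alternating b (map (\<lambda>k. int k \<in> L) (remove1 (nat \<bar>l\<bar>) ks))" if l: "l \<in> L" for l
  proof -
    have K': "(\<lambda>l. nat \<bar>l\<bar>) ` (L - {l}) = K - {nat \<bar>l\<bar>}"
      using inj l by (auto simp: K_def inj_on_def)
    have "sorted_list_of_set (K - {nat \<bar>l\<bar>}) = remove1 (nat \<bar>l\<bar>) ks"
      unfolding ks_def by (rule sorted_list_of_set_remove) (rule finK)
    moreover have "map (\<lambda>k. int k \<in> L - {l}) (remove1 (nat \<bar>l\<bar>) ks) = map (\<lambda>k. int k \<in> L) (remove1 (nat \<bar>l\<bar>) ks)"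
      using dist by (auto simp: set_remove1_eq)
    ultimately show ?thesis unfolding alternating_set_def K' by (simp only:)
  qed
  have rem: "remove1 (ks ! i) ks = take i ks @ drop (Suc i) ks" if "i < length ks" for i
  proof -
    have ks: "ks = take i ks @ ks ! i # drop (Suc i) ks" using that by (simp add: id_take_nth_drop)
    then have "ks ! i \<notin> set (take i ks)"
      using dist by (metis distinct_append not_distinct_conv_prefix id_take_nth_drop that disjoint_iff list.set_intros(1))
    then show ?thesis by (metis ks remove1_append remove1.simps(2))
  qed
  have "(\<Sum>l\<in>L. of_bool (alternating_set b (L - {l})) :: nat)
      = (\<Sum>l\<in>L. of_bool (alternating b (map (\<lambda>k. int k \<in> L) (remove1 (nat \<bar>l\<bar>) ks))))"
    by (rule sum.cong) (simp_all add: facet)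
  also have "\<dots> = (\<Sum>k\<in>K. of_bool (alternating b (map (\<lambda>k. int k \<in> L) (remove1 k ks))))"
    unfolding K_def by (subst sum.reindex[OF inj]) simp
  also have "\<dots> = (\<Sum>i<length ks. of_bool (alternating b (map (\<lambda>k. int k \<in> L) (remove1 (ks ! i) ks))))"
    by (rule sum.reindex_bij_betw[symmetric, where h = "(!) ks"])
       (metis bij_betw_nth dist setks)
  also have "\<dots> = (\<Sum>i<length (map (\<lambda>k. int k \<in> L) ks). of_bool (alternating b
       (take i (map (\<lambda>k. int k \<in> L) ks) @ drop (Suc i) (map (\<lambda>k. int k \<in> L) ks))))"
    by (rule sum.cong) (simp_all add: rem take_map drop_map)
  finally show ?thesis
    using alternating_facet_parity[where xs = "map (\<lambda>k. int k \<in> L) ks" and b = b]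
    by (simp add: alternating_set_def ks_def K_def)
qed

definition alternating_labels :: "bool \<Rightarrow> nat set \<Rightarrow> (nat \<Rightarrow> int) \<Rightarrow> bool" where
  "alternating_labels b I l \<longleftrightarrow> inj_on l I \<and> alternating_set b (l ` I)"

text \<open>If a label is repeated, then only the two facets that omit one of the repeated vertices can be alternating,
  and these two carry the same labels; otherwise this is the statement on label sets.\<close>
lemma alternating_labels_facet_parity:
  assumes fin: "finite I" and nc: "\<And>i j. i \<in> I \<Longrightarrow> j \<in> I \<Longrightarrow> l i \<noteq> - l j"
  shows "even ((\<Sum>k\<in>I. of_bool (alternating_labels b (I - {k}) l))
           + of_bool (alternating_labels b I l) + of_bool (alternating_labels (\<not> b) I l) :: nat)"
proof (cases "inj_on l I")
  case True
  have *: "alternating_labels b (I - {k}) l = alternating_set b (l ` I - {l k})" if "k \<in> I" for k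
    using True that
    by (auto simp: alternating_labels_def inj_on_diff inj_on_image_set_diff[of l I I "{k}"])
  have "(\<Sum>k\<in>I. of_bool (alternating_labels b (I - {k}) l) :: nat)
      = (\<Sum>x\<in>l ` I. of_bool (alternating_set b (l ` I - {x})))"
    by (subst sum.reindex[OF True]) (simp add: *)
  moreover have "alternating_labels b' I l = alternating_set b' (l ` I)" for b'
    using True by (simp add: alternating_labels_def)
  moreover have "- x \<notin> l ` I" if "x \<in> l ` I" for x
    using that nc by (metis (no_types, lifting) imageE)
  ultimately show ?thesis
    using alternating_set_facet_parity[of "l ` I" b] fin by simp
next
  case False
  then obtain i j where ij: "i \<in> I" "j \<in> I" "i \<noteq> j" "l i = l j" by (auto simp: inj_on_def)
  have "alternating_labels b (I - {k}) l = False" if "k \<in> I - {i, j}" for k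
  proof -
    have "i \<in> I - {k}" "j \<in> I - {k}" using that ij by auto
    then show ?thesis using ij by (auto simp only: alternating_labels_def dest: inj_onD)
  qed
  then have "(\<Sum>k\<in>I. of_bool (alternating_labels b (I - {k}) l) :: nat)
      = (\<Sum>k\<in>{i, j}. of_bool (alternating_labels b (I - {k}) l))"
    by (intro sum.mono_neutral_right) (use fin ij in auto)
  moreover have "alternating_labels b (I - {i}) l = alternating_labels b (I - {j}) l"
  proof -
    have "I - {i} = insert j (I - {i, j})" "I - {j} = insert i (I - {i, j})" using ij by auto
    then have im: "l ` (I - {i}) = l ` (I - {j})" using ij(4) by (metis image_insert)
    have "card (I - {i}) = card (I - {j})" using ij fin by simp
    then have "inj_on l (I - {i}) = inj_on l (I - {j})"
      using im fin by (metis card_image eq_card_imp_inj_on finite_Diff)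
    then show ?thesis by (simp add: alternating_labels_def im)
  qed
  moreover have "alternating_labels b' I l = False" for b' using False by (simp add: alternating_labels_def)
  moreover have "(\<Sum>k\<in>{i, j}. h k :: nat) = h i + h j" for h using ij(3) by simp
  ultimately show ?thesis by simp
qed

abbreviation simplex_vertex :: "nat \<Rightarrow> nat \<Rightarrow> real" where
  "simplex_vertex i \<equiv> (\<lambda>j. if j = i then 1 else 0)"

text \<open>The signed number of simplices in a chain whose vertex labels alternate.  Only its parity matters, but
  as an additive function of integral chains it is evaluated through \<open>frag_extend\<close> into the free group on
  one generator.\<close>
definition alternating_count :: "bool \<Rightarrow> nat \<Rightarrow> ('a \<Rightarrow> int) \<Rightarrow> 'a chain \<Rightarrow> int" where
  "alternating_count b p lab c = Poly_Mapping.lookup (frag_extend (\<lambda>f.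
     if alternating_labels b {..p} (\<lambda>i. lab (f (simplex_vertex i))) then frag_of () else 0) c) ()"

lemma alternating_count_diff:
  "alternating_count b p lab (c - d) = alternating_count b p lab c - alternating_count b p lab d"
  by (simp add: alternating_count_def frag_extend_diff lookup_minus)

lemma alternating_count_cmul:
  "alternating_count b p lab (frag_cmul k c) = k * alternating_count b p lab c"
  by (simp add: alternating_count_def frag_extend_cmul)

lemma alternating_count_0 [simp]: "alternating_count b p lab 0 = 0"
  by (simp add: alternating_count_def)

lemma alternating_count_sum:
  "finite I \<Longrightarrow> alternating_count b p lab (\<Sum>i\<in>I. g i) = (\<Sum>i\<in>I. alternating_count b p lab (g i))"
  by (induction I rule: finite_induct)
     (simp_all add: alternating_count_def frag_extend_add lookup_add)

lemma alternating_count_of: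
  "alternating_count b p lab (frag_of f)
     = of_bool (alternating_labels b {..p} (\<lambda>i. lab (f (simplex_vertex i))))"
  by (simp add: alternating_count_def)

lemma alternating_count_nonzero:
  assumes "alternating_count b p lab c \<noteq> 0"
  obtains f where "f \<in> Poly_Mapping.keys c" "alternating_labels b {..p} (\<lambda>i. lab (f (simplex_vertex i)))"
proof -
  have "\<exists>f\<in>Poly_Mapping.keys c. alternating_labels b {..p} (\<lambda>i. lab (f (simplex_vertex i)))"
  proof (rule ccontr)
    assume "\<not> ?thesis"
    then have "alternating_count b p lab c = 0"
      unfolding alternating_count_def by (subst frag_extend_eq_0) auto
    with assms show False by simp
  qed
  then show thesis using that by blast
qed

lemma simplical_face_vertex:
  "simplical_face k (simplex_vertex i) = simplex_vertex (if i < k then i else Suc i)"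
  by (auto simp: simplical_face_def fun_eq_iff)

lemma alternating_count_boundary_of:
  assumes nc: "\<And>i j. i \<le> Suc p \<Longrightarrow> j \<le> Suc p \<Longrightarrow> lab (f (simplex_vertex i)) \<noteq> - lab (f (simplex_vertex j))"
  shows "even (alternating_count True p lab (chain_boundary (Suc p) (frag_of f))
     + alternating_count True (Suc p) lab (frag_of f) + alternating_count False (Suc p) lab (frag_of f))"
proof -
  let ?l = "\<lambda>i. lab (f (simplex_vertex i))"
  have face: "alternating_labels True {..p} (\<lambda>i. lab (singular_face (Suc p) k f (simplex_vertex i)))
      = alternating_labels True ({..Suc p} - {k}) ?l" if k: "k \<le> Suc p" for k
  proof -
    let ?s = "\<lambda>i. if i < k then i else Suc i"
    have eq: "lab (singular_face (Suc p) k f (simplex_vertex i)) = ?l (?s i)" if "i \<le> p" for i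
      using that by (simp add: singular_face_def simplical_face_vertex)
    have im: "?s ` {..p} = {..Suc p} - {k}"
    proof -
      have "x \<in> ?s ` {..p}" if x: "x \<in> {..Suc p} - {k}" for x
      proof (cases "x < k")
        case True then show ?thesis using k by (intro image_eqI[of _ _ x]) auto
      next
        case False then show ?thesis using x by (intro image_eqI[of _ _ "x - 1"]) auto
      qed
      then show ?thesis using k by auto
    qed
    have injs: "inj_on ?s {..p}" by (auto simp: inj_on_def split: if_splits)
    have "(\<lambda>i. lab (singular_face (Suc p) k f (simplex_vertex i))) ` {..p} = ?l ` ({..Suc p} - {k})"
    proof -
      have "(\<lambda>i. lab (singular_face (Suc p) k f (simplex_vertex i))) ` {..p} = (\<lambda>i. ?l (?s i)) ` {..p}"
        by (rule image_cong) (simp_all add: eq)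
      then show ?thesis by (simp only: im[symmetric] image_image)
    qed
    moreover have "inj_on (\<lambda>i. lab (singular_face (Suc p) k f (simplex_vertex i))) {..p}
         = inj_on ?l ({..Suc p} - {k})"
    proof -
      have "inj_on (\<lambda>i. lab (singular_face (Suc p) k f (simplex_vertex i))) {..p}
          = inj_on (?l \<circ> ?s) {..p}" by (rule inj_on_cong) (simp only: eq atMost_iff o_def)
      also have "\<dots> = inj_on ?l (?s ` {..p})" using comp_inj_on_iff[OF injs, of ?l] by simp
      finally show ?thesis by (simp only: im)
    qed
    ultimately show ?thesis by (simp only: alternating_labels_def)
  qed
  define a where "a k = alternating_labels True ({..Suc p} - {k}) ?l" for k
  let ?pos = "alternating_labels True {..Suc p} ?l" and ?neg = "alternating_labels False {..Suc p} ?l"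
  have key: "even (x + u + v)" if "even (x - y)" "even (y + u + v)" for x y u v :: int
    using that by presburger
  have bd: "alternating_count True p lab (chain_boundary (Suc p) (frag_of f))
      = (\<Sum>k\<le>Suc p. (-1) ^ k * of_bool (a k))"
    unfolding chain_boundary_of a_def
    by (simp add: alternating_count_sum alternating_count_cmul alternating_count_of face del: sum.atMost_Suc)
  have "even ((\<Sum>k\<le>Suc p. (-1) ^ k * of_bool (a k)) - (\<Sum>k\<le>Suc p. of_bool (a k)) :: int)"
    unfolding sum_subtractf[symmetric] by (rule dvd_sum) (auto simp: of_bool_def)
  moreover have "even (int ((\<Sum>k\<le>Suc p. of_bool (a k)) + of_bool ?pos + of_bool (alternating_labels (\<not> True) {..Suc p} ?l)))"
    unfolding even_of_nat a_def by (rule alternating_labels_facet_parity) (use nc in auto)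
  then have "even ((\<Sum>k\<le>Suc p. of_bool (a k)) + of_bool ?pos + of_bool ?neg :: int)"
    by (simp only: of_nat_add of_nat_sum of_nat_of_bool not_True_eq_False)
  ultimately have "even ((\<Sum>k\<le>Suc p. (-1) ^ k * of_bool (a k)) + of_bool ?pos + of_bool ?neg :: int)"
    by (rule key)
  then show ?thesis by (simp only: bd alternating_count_of)
qed

lemma alternating_count_boundary:
  assumes "\<And>f i j. f \<in> Poly_Mapping.keys c \<Longrightarrow> i \<le> Suc p \<Longrightarrow> j \<le> Suc p \<Longrightarrow>
     lab (f (simplex_vertex i)) \<noteq> - lab (f (simplex_vertex j))"
  shows "even (alternating_count True p lab (chain_boundary (Suc p) c)
     + alternating_count True (Suc p) lab c + alternating_count False (Suc p) lab c)"
proof -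
  have "Poly_Mapping.keys c \<subseteq> {f. \<forall>i\<le>Suc p. \<forall>j\<le>Suc p. lab (f (simplex_vertex i)) \<noteq> - lab (f (simplex_vertex j))}"
    using assms by blast
  then show ?thesis
  proof (induction c rule: frag_induction)
    case (one f)
    then show ?case by (intro alternating_count_boundary_of) auto
  next
    case (diff a b)
    moreover have "even (x - x' + (y - y') + (z - z'))" if "even (x + y + z)" "even (x' + y' + z')"
      for x x' y y' z z' :: int using that by presburger
    ultimately show ?case unfolding chain_boundary_diff alternating_count_diff by blast
  qed simp
qed

lemma alternating_Not: "alternating b (map Not xs) = alternating (\<not> b) xs"
  by (induction xs arbitrary: b) auto

lemma alternating_set_uminus:
  assumes "finite L" and nc: "\<And>l. l \<in> L \<Longrightarrow> - l \<notin> L"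
  shows "alternating_set b (uminus ` L) = alternating_set (\<not> b) L"
proof -
  have K: "(\<lambda>l. nat \<bar>l\<bar>) ` uminus ` L = (\<lambda>l. nat \<bar>l\<bar>) ` L" by (simp add: image_image)
  have "int k \<in> uminus ` L \<longleftrightarrow> int k \<notin> L" if k: "k \<in> (\<lambda>l. nat \<bar>l\<bar>) ` L" for k
  proof -
    obtain l where l: "l \<in> L" "k = nat \<bar>l\<bar>" using k by auto
    have "int k \<in> uminus ` L \<longleftrightarrow> - int k \<in> L" by (metis (no_types, lifting) add.inverse_inverse image_iff)
    moreover have "int k = l \<or> int k = - l" using l by auto
    ultimately show ?thesis using nc[of l] nc[of "- l"] l by auto
  qed
  then have "map (\<lambda>k. int k \<in> uminus ` L) (sorted_list_of_set ((\<lambda>l. nat \<bar>l\<bar>) ` L))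
     = map Not (map (\<lambda>k. int k \<in> L) (sorted_list_of_set ((\<lambda>l. nat \<bar>l\<bar>) ` L)))"
    using assms by simp
  then show ?thesis unfolding alternating_set_def K by (simp only: alternating_Not)
qed

lemma alternating_labels_uminus:
  assumes "finite I" "\<And>i j. i \<in> I \<Longrightarrow> j \<in> I \<Longrightarrow> l i \<noteq> - l j"
  shows "alternating_labels b I (\<lambda>i. - l i) = alternating_labels (\<not> b) I l"
proof -
  have "(\<lambda>i. - l i) ` I = uminus ` l ` I" by (simp add: image_image)
  moreover have "inj_on (\<lambda>i. - l i) I = inj_on l I" by (simp add: inj_on_def)
  moreover have "alternating_set b (uminus ` l ` I) = alternating_set (\<not> b) (l ` I)"
  proof (rule alternating_set_uminus)
    show "- x \<notin> l ` I" if "x \<in> l ` I" for x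
      using that assms(2) by (metis (no_types, lifting) imageE)
  qed (simp add: assms(1))
  ultimately show ?thesis by (simp add: alternating_labels_def)
qed

lemma alternating_count_chain_map:
  assumes small: "\<And>f i j. f \<in> Poly_Mapping.keys c \<Longrightarrow> i \<le> p \<Longrightarrow> j \<le> p \<Longrightarrow>
     lab (f (simplex_vertex i)) \<noteq> - lab (f (simplex_vertex j))"
    and c: "singular_chain p X c" and odd: "\<And>x. x \<in> topspace X \<Longrightarrow> lab (g x) = - lab x"
  shows "alternating_count b p lab (chain_map p g c) = alternating_count (\<not> b) p lab c"
proof -
  have "Poly_Mapping.keys c \<subseteq> {f. singular_simplex p X f \<and> (\<forall>i\<le>p. \<forall>j\<le>p. lab (f (simplex_vertex i)) \<noteq> - lab (f (simplex_vertex j)))}"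
    using small c by (auto simp: singular_chain_def)
  then show ?thesis
  proof (induction c rule: frag_induction)
    case (one f)
    have vert: "simplex_vertex i \<in> standard_simplex p" if "i \<le> p" for i using that by simp
    have "f (simplex_vertex i) \<in> topspace X" if "i \<le> p" for i
      using one vert[OF that] by (auto simp: singular_simplex_def continuous_map_def)
    then have eq: "lab (simplex_map p g f (simplex_vertex i)) = - lab (f (simplex_vertex i))" if "i \<le> p" for i
      using that odd by (simp add: simplex_map_def)
    have "alternating_labels b {..p} (\<lambda>i. lab (simplex_map p g f (simplex_vertex i)))
        = alternating_labels b {..p} (\<lambda>i. - lab (f (simplex_vertex i)))"
      unfolding alternating_labels_def
      by (metis (no_types, lifting) eq atMost_iff inj_on_cong image_cong)
    also have "\<dots> = alternating_labels (\<not> b) {..p} (\<lambda>i. lab (f (simplex_vertex i)))"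
      by (rule alternating_labels_uminus) (use one in auto)
    finally show ?case by (simp add: alternating_count_of)
  next
    case (diff a b)
    then show ?case by (simp add: chain_map_diff alternating_count_diff)
  qed simp
qed

definition antipode :: "(nat \<Rightarrow> real) \<Rightarrow> nat \<Rightarrow> real" where "antipode x = (\<lambda>i. - x i)"

lemma antipode_antipode [simp]: "antipode (antipode x) = x"
  by (simp add: antipode_def)

lemma antipode_in_nsphere [simp]: "antipode x \<in> topspace (nsphere m) \<longleftrightarrow> x \<in> topspace (nsphere m)"
  by (simp add: nsphere antipode_def)

lemma continuous_map_antipode: "continuous_map (nsphere m) (nsphere m) antipode"
proof -
  have "continuous_map (nsphere m) (powertop_real UNIV) antipode"
    unfolding continuous_map_componentwise_UNIV antipode_def
    by (intro allI continuous_map_minus continuous_map_nsphere_projection)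
  moreover have "antipode \<in> topspace (nsphere m) \<rightarrow> {x. (\<Sum>i\<le>m. x i ^ 2) = 1 \<and> (\<forall>i>m. x i = 0)}"
    by (auto simp: nsphere antipode_def)
  ultimately show ?thesis
    unfolding nsphere[of m] continuous_map_in_subtopology by (metis nsphere)
qed

lemma nsphere_cycle_bounds:
  assumes p: "0 < p" "p < m" and c: "singular_chain p (nsphere m) c" "chain_boundary p c = 0"
  obtains d where "singular_chain (Suc p) (nsphere m) d" "chain_boundary (Suc p) d = c"
proof -
  have "trivial_group (homology_group (int p) (nsphere m))"
    using reduced_homology_group_nsphere(2)[of "int p" m] un_reduced_homology_group[of "int p" "nsphere m"] p
    by simp
  then have car: "carrier (homology_group (int p) (nsphere m)) = {\<one>\<^bsub>homology_group (int p) (nsphere m)\<^esub>}"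
    by (simp add: trivial_group_def)
  have "singular_relcycle p (nsphere m) {} c" using c by (simp add: singular_cycle)
  then have "homologous_rel_set p (nsphere m) {} c \<in> carrier (homology_group (int p) (nsphere m))"
    by (simp add: carrier_relative_homology_group)
  then have "homologous_rel_set p (nsphere m) {} c = singular_relboundary_set p (nsphere m) {}"
    using car by simp
  moreover have "c \<in> homologous_rel_set p (nsphere m) {} c" by simp
  ultimately have "singular_relboundary p (nsphere m) {} c" by blast
  then show thesis using that by (auto simp: singular_boundary)
qed

text \<open>A half circle joins a point to its antipode.  Dimension one needs this explicit path, as homology in
  dimension \<open>0\<close> does not vanish.\<close>
lemma nsphere_antipodal_points_bound:
  assumes m: "0 < m"
  obtains c d where "singular_simplex 0 (nsphere m) c" "singular_chain 1 (nsphere m) d"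
    "chain_boundary 1 d = frag_of c - chain_map 0 antipode (frag_of c)"
proof -
  define w :: "(nat \<Rightarrow> real) \<Rightarrow> nat \<Rightarrow> real" where
    "w = (\<lambda>t j. if j = 0 then cos (pi * t 0) else if j = 1 then sin (pi * t 0) else 0)"
  define f where "f = restrict w (standard_simplex 1)"
  define c where "c = singular_face 1 1 f"
  have win: "w t \<in> topspace (nsphere m)" for t
  proof -
    have "(\<Sum>i\<le>m. (w t i)\<^sup>2) = (\<Sum>i\<le>1. (w t i)\<^sup>2)"
      by (rule sum.mono_neutral_right) (use m in \<open>auto simp: w_def\<close>)
    also have "\<dots> = 1" by (simp add: w_def)
    finally show ?thesis using m by (auto simp: nsphere w_def)
  qed
  have "continuous_map (powertop_real UNIV) euclideanreal (\<lambda>t. w t j)" for j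
  proof -
    have "continuous_on UNIV (\<lambda>t::nat \<Rightarrow> real. w t j)"
      unfolding w_def by (cases "j = 0"; cases "j = 1") (auto intro!: continuous_intros)
    then show ?thesis by (simp add: euclidean_product_topology)
  qed
  then have "continuous_map (powertop_real UNIV) (nsphere m) w"
    unfolding nsphere continuous_map_in_subtopology continuous_map_componentwise_UNIV
    using win by (auto simp: nsphere)
  then have f: "singular_simplex 1 (nsphere m) f"
    unfolding singular_simplex_def f_def
    by (auto intro: continuous_map_eq[OF continuous_map_from_subtopology])
  have c: "singular_simplex 0 (nsphere m) c"
    using singular_simplex_singular_face[OF f, of 1] by (simp add: c_def)
  have e: "simplical_face k (simplex_vertex 0) = simplex_vertex (if k = 0 then 1 else 0)" for k
    by (simp add: simplical_face_vertex)
  have "singular_face 1 0 f = simplex_map 0 antipode c"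
  proof
    fix t :: "nat \<Rightarrow> real"
    show "singular_face 1 0 f t = simplex_map 0 antipode c t"
    proof (cases "t = simplex_vertex 0")
      case True
      have v: "simplex_vertex 0 \<in> standard_simplex 0" "simplex_vertex 0 \<in> standard_simplex 1"
        "simplex_vertex 1 \<in> standard_simplex 1" by auto
      have "singular_face 1 0 f t = w (simplex_vertex 1)"
        unfolding True singular_face_def f_def using v by (simp add: e)
      moreover have "c t = w (simplex_vertex 0)"
        unfolding True c_def singular_face_def f_def using v by (simp add: e)
      moreover have "w (simplex_vertex 1) = antipode (w (simplex_vertex 0))"
        by (auto simp: w_def antipode_def)
      ultimately show ?thesis using v True by (simp add: simplex_map_def)
    next
      case False
      then show ?thesis by (simp add: singular_face_def simplex_map_def standard_simplex_0)
    qed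
  qed
  then have "chain_boundary 1 (frag_of f) = chain_map 0 antipode (frag_of c) - frag_of c"
    by (simp add: chain_boundary_of c_def)
  then have "chain_boundary 1 (- frag_of f) = frag_of c - chain_map 0 antipode (frag_of c)"
    by (simp add: chain_boundary_minus)
  moreover have "singular_chain 1 (nsphere m) (- frag_of f)"
    using f by (simp add: singular_chain_minus singular_chain_of)
  ultimately show thesis using that c by blast
qed

text \<open>Chains that behave like hemispheres: the boundary of \<open>H (k + 1)\<close> is \<open>H k\<close> together with its antipodal copy, up to
  sign.  The signs make this combination a cycle, which bounds because the homology of the \<open>m\<close>-sphere
  vanishes in dimensions \<open>0 < k < m\<close>.\<close>
lemma nsphere_hemispheres:
  assumes "n \<le> m"
  shows "\<exists>H. (\<exists>f. H 0 = frag_of f) \<and> (\<forall>k\<le>n. singular_chain k (nsphere m) (H k)) \<and>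
    (\<forall>k<n. chain_boundary (Suc k) (H (Suc k))
        = H k - frag_cmul ((-1) ^ k) (chain_map k antipode (H k)))"
  using assms
proof (induction n)
  case 0
  let ?f = "restrict (\<lambda>_. \<lambda>i. if i = 0 then 1 else 0) (standard_simplex 0) :: (nat \<Rightarrow> real) \<Rightarrow> nat \<Rightarrow> real"
  have "singular_simplex 0 (nsphere m) ?f"
    unfolding singular_simplex_def
    by (auto intro!: continuous_map_eq[OF continuous_map_const[THEN iffD2]] in_topspace_nsphere)
  then show ?case by (intro exI[of _ "\<lambda>_. frag_of ?f"]) (auto simp: singular_chain_of)
next
  case (Suc n)
  show ?case
  proof (cases "n = 0")
    case True
    obtain c d where "singular_simplex 0 (nsphere m) c" "singular_chain 1 (nsphere m) d"
      "chain_boundary 1 d = frag_of c - chain_map 0 antipode (frag_of c)"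
      using nsphere_antipodal_points_bound[of m] Suc.prems by auto
    then show ?thesis using True
      by (intro exI[of _ "\<lambda>k. if k = 0 then frag_of c else d"]) (auto simp: le_Suc_eq singular_chain_of)
  next
    case False
    obtain H where H: "\<exists>f. H 0 = frag_of f" "\<forall>k\<le>n. singular_chain k (nsphere m) (H k)"
      "\<forall>k<n. chain_boundary (Suc k) (H (Suc k)) = H k - frag_cmul ((-1) ^ k) (chain_map k antipode (H k))"
      using Suc by auto
    define S where "S k = H k - frag_cmul ((-1) ^ k) (chain_map k antipode (H k))" for k
    have chH: "singular_chain n (nsphere m) (H n)" using H by blast
    have chS: "singular_chain n (nsphere m) (S n)"
      unfolding S_def using chH
      by (intro singular_chain_diff singular_chain_cmul singular_chain_chain_map[OF _ continuous_map_antipode])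
    obtain k where k: "n = Suc k" using False not0_implies_Suc by blast
    have bH: "chain_boundary n (H n) = S k" using H(3) by (simp add: k S_def)
    have chHk: "singular_chain k (nsphere m) (H k)" using H(2) k by simp
    have inv: "chain_map k antipode (chain_map k antipode (H k)) = H k"
    proof -
      have "chain_map k antipode (chain_map k antipode (H k)) = chain_map k (antipode \<circ> antipode) (H k)"
        by (simp add: chain_map_compose)
      also have "\<dots> = H k" by (rule chain_map_id_gen[OF chHk]) simp
      finally show ?thesis .
    qed
    have "chain_map k antipode (S k) = frag_cmul ((-1) ^ n) (S k)"
      unfolding S_def chain_map_diff chain_map_cmul inv
      by (cases "even k") (simp_all add: k)
    then have "chain_boundary n (S n) = S k - frag_cmul ((-1) ^ n * (-1) ^ n) (S k)"
      unfolding S_def[of n] chain_boundary_diff chain_boundary_cmul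
      using chain_boundary_chain_map[OF chH, of antipode] bH by (simp add: k frag_cmul_cmul)
    then have "chain_boundary n (S n) = 0" by (simp flip: power_add mult_2)
    then obtain d where d: "singular_chain (Suc n) (nsphere m) d" "chain_boundary (Suc n) d = S n"
      using nsphere_cycle_bounds[of n m "S n"] False Suc.prems chS by auto
    show ?thesis
      by (rule exI[of _ "H(Suc n := d)"]) (use H d in \<open>auto simp: le_Suc_eq less_Suc_eq S_def\<close>)
  qed
qed

lemma singular_subdivision_power_props:
  assumes "singular_chain p X c"
  shows "singular_chain p X ((singular_subdivision p ^^ r) c)"
    and "chain_boundary p ((singular_subdivision p ^^ r) c)
         = (singular_subdivision (p - Suc 0) ^^ r) (chain_boundary p c)"
    and "(singular_subdivision p ^^ r) (chain_map p g c) = chain_map p g ((singular_subdivision p ^^ r) c)"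
    and "(singular_subdivision p ^^ r) (frag_cmul k c) = frag_cmul k ((singular_subdivision p ^^ r) c)"
proof -
  show *: "singular_chain p X ((singular_subdivision p ^^ r) c)" for r
    by (induction r) (auto simp: assms singular_chain_singular_subdivision)
  show "chain_boundary p ((singular_subdivision p ^^ r) c)
         = (singular_subdivision (p - Suc 0) ^^ r) (chain_boundary p c)"
    by (induction r) (auto simp: chain_boundary_singular_subdivision[OF *])
  show "(singular_subdivision p ^^ r) (chain_map p g c) = chain_map p g ((singular_subdivision p ^^ r) c)"
    by (induction r) (auto simp: naturality_singular_subdivision[OF *])
  show "(singular_subdivision p ^^ r) (frag_cmul k c) = frag_cmul k ((singular_subdivision p ^^ r) c)"
    by (induction r) (auto simp: singular_subdivision_def frag_extend_cmul)
qed

text \<open>If the sets \<open>B i\<close> and their antipodal images covered the sphere, then labelling \<open>x\<close> by \<open>\<plusminus>(i + 1)\<close>, for the least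
  \<open>i\<close> such that \<open>B i\<close> contains \<open>x\<close> (sign \<open>+\<close>) or its antipode (sign \<open>-\<close>), would be an odd labelling with \<open>m\<close>
  absolute values.  As \<open>B i\<close> and its antipodal image are disjoint closed sets, opposite labels do not occur in one simplex of a fine
  subdivision.  By induction on \<open>k\<close> the number of alternating \<open>k\<close>-simplices in the subdivided hemisphere
  \<open>G k\<close> is odd; for \<open>k = m\<close> such a simplex has \<open>m + 1\<close> labels of distinct absolute values, which is one
  too many.\<close>
theorem Lusternik_Schnirelmann_nsphere:
  assumes cl: "\<And>i. i < m \<Longrightarrow> closed (B i)"
    and disj: "\<And>i x. i < m \<Longrightarrow> x \<in> B i \<Longrightarrow> antipode x \<notin> B i"
  obtains x where "x \<in> topspace (nsphere m)" "\<And>i. i < m \<Longrightarrow> x \<notin> B i \<and> antipode x \<notin> B i"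
proof (rule ccontr)
  assume "\<not> thesis"
  with that have cover: "\<exists>i<m. x \<in> B i \<or> antipode x \<in> B i" if "x \<in> topspace (nsphere m)" for x
    using \<open>x \<in> topspace (nsphere m)\<close> by blast
  define idx where "idx x = (LEAST i. i < m \<and> (x \<in> B i \<or> antipode x \<in> B i))" for x
  define lab where "lab x = (if x \<in> B (idx x) then int (Suc (idx x)) else - int (Suc (idx x)))" for x
  have idx: "idx x < m \<and> (x \<in> B (idx x) \<or> antipode x \<in> B (idx x))" if "x \<in> topspace (nsphere m)" for x
    unfolding idx_def using cover[OF that] by (rule LeastI_ex)
  have idx_antipode: "idx (antipode x) = idx x" for x
    unfolding idx_def by (rule arg_cong[where f = Least]) auto
  have lab_odd: "lab (antipode x) = - lab x" if "x \<in> topspace (nsphere m)" for x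
    using idx[OF that] disj[of "idx x" x] disj[of "idx x" "antipode x"]
    by (auto simp: lab_def idx_antipode)
  \<comment> \<open>Choosing for each \<open>i\<close> one of \<open>B i\<close> and its antipodal image and removing all chosen sets gives an open set on
    which no two points carry opposite labels; these open sets cover the sphere.\<close>
  define U where "U A = {x \<in> topspace (nsphere m). \<forall>i<m. x \<notin> A i}" for A :: "nat \<Rightarrow> (nat \<Rightarrow> real) set"
  define \<C> where "\<C> = U ` {A. \<forall>i<m. A i = B i \<or> A i = antipode -` B i}"
  have "openin (nsphere m) W" if W: "W \<in> \<C>" for W
  proof -
    obtain A where A: "W = U A" "\<forall>i<m. A i = B i \<or> A i = antipode -` B i" using W by (auto simp: \<C>_def)
    have "continuous_on UNIV antipode"
      unfolding antipode_def by (intro continuous_on_coordinatewise_then_product continuous_on_minus continuous_on_product_coordinates)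
    then have "closed (A i)" if "i < m" for i
      using A(2) that cl[OF that] by (auto intro!: closed_vimage)
    then have "closed (\<Union>i<m. A i)" by auto
    then have "open (- (\<Union>i<m. A i))" by (rule open_Compl)
    moreover have "W = topspace (nsphere m) \<inter> - (\<Union>i<m. A i)" by (auto simp: A U_def)
    ultimately show ?thesis
      by (auto simp: nsphere openin_subtopology euclidean_product_topology Int_commute)
  qed
  moreover have "topspace (nsphere m) \<subseteq> \<Union>\<C>"
  proof
    fix x assume x: "x \<in> topspace (nsphere m)"
    define A where "A i = (if x \<in> B i then antipode -` B i else B i)" for i
    have "x \<in> U A" using x disj by (auto simp: U_def A_def)
    moreover have "U A \<in> \<C>" unfolding \<C>_def A_def by auto
    ultimately show "x \<in> \<Union>\<C>" by blast
  qed
  moreover obtain H f0 where H0: "H 0 = frag_of f0" and H: "\<And>k. k \<le> m \<Longrightarrow> singular_chain k (nsphere m) (H k)"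
    and bH: "\<And>k. k < m \<Longrightarrow> chain_boundary (Suc k) (H (Suc k))
        = H k - frag_cmul ((-1) ^ k) (chain_map k antipode (H k))"
    using nsphere_hemispheres[of m m] by auto
  ultimately have "\<forall>k\<in>{..m}. \<exists>r. \<forall>r'\<ge>r. \<forall>f\<in>Poly_Mapping.keys ((singular_subdivision k ^^ r') (H k)).
       \<exists>W\<in>\<C>. f \<in> standard_simplex k \<rightarrow> W"
    using sufficient_iterated_singular_subdivision_exists[of \<C> "nsphere m"] by (metis atMost_iff)
  then obtain R where R: "\<And>k r' f. k \<le> m \<Longrightarrow> R k \<le> r' \<Longrightarrow>
       f \<in> Poly_Mapping.keys ((singular_subdivision k ^^ r') (H k)) \<Longrightarrow> \<exists>W\<in>\<C>. f \<in> standard_simplex k \<rightarrow> W"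
    by (metis atMost_iff)
  define r where "r = Max (R ` {..m})"
  have Rr: "R k \<le> r" if "k \<le> m" for k unfolding r_def by (rule Max_ge) (use that in auto)
  define G where "G k = (singular_subdivision k ^^ r) (H k)" for k
  have small: "lab (f (simplex_vertex i)) \<noteq> - lab (f (simplex_vertex j))"
    if k: "k \<le> m" and f: "f \<in> Poly_Mapping.keys (G k)" and ij: "i \<le> k" "j \<le> k" for k f i j
  proof
    obtain A where A: "f \<in> standard_simplex k \<rightarrow> U A" "\<forall>i<m. A i = B i \<or> A i = antipode -` B i"
      using R[OF k Rr[OF k] f[unfolded G_def]] unfolding \<C>_def by auto
    have "simplex_vertex i \<in> standard_simplex k" "simplex_vertex j \<in> standard_simplex k" using ij by auto
    then have mem: "f (simplex_vertex i) \<in> U A" "f (simplex_vertex j) \<in> U A" using A(1) by (auto simp: Pi_iff)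
    define a b where "a = f (simplex_vertex i)" and "b = f (simplex_vertex j)"
    have ab: "a \<in> topspace (nsphere m)" "b \<in> topspace (nsphere m)" using mem by (auto simp: U_def a_def b_def)
    assume "lab (f (simplex_vertex i)) = - lab (f (simplex_vertex j))"
    then have "idx a = idx b" "(a \<in> B (idx a)) \<noteq> (b \<in> B (idx b))"
      by (auto simp: lab_def a_def b_def split: if_splits)
    moreover have "a \<notin> A (idx a)" "b \<notin> A (idx a)" using mem idx[OF ab(1)] by (auto simp: U_def a_def b_def)
    ultimately show False
      using A(2) idx[OF ab(1)] idx[OF ab(2)] disj[of "idx a" a] disj[of "idx a" b] by auto
  qed
  have G: "singular_chain k (nsphere m) (G k)" if "k \<le> m" for k
    unfolding G_def using H[OF that] by (rule singular_subdivision_power_props)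
  have bG: "chain_boundary (Suc k) (G (Suc k)) = G k - frag_cmul ((-1) ^ k) (chain_map k antipode (G k))" if k: "k < m" for k
  proof -
    have c: "singular_chain k (nsphere m) (H k)" and d: "singular_chain k (nsphere m) (chain_map k antipode (H k))"
      using H[of k] k singular_chain_chain_map[OF _ continuous_map_antipode] by auto
    show ?thesis
      unfolding G_def singular_subdivision_power_props(2)[OF H[OF Suc_leI[OF k]]] bH[OF k]
      by (simp only: singular_subdivision_power_diff singular_subdivision_power_props(3)[OF c]
            singular_subdivision_power_props(4)[OF d] diff_Suc_Suc One_nat_def diff_zero)
  qed
  have odd: "odd (alternating_count True n lab (G n) + alternating_count False n lab (G n))" if "n \<le> m" for n
    using that
  proof (induction n)
    case 0
    have "(singular_subdivision 0 ^^ r') (H 0) = H 0" for r'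
      by (induction r') (simp_all add: singular_subdivision_zero[OF H[of 0]])
    then have G0: "G 0 = frag_of f0" by (simp add: G_def H0)
    have "lab (f0 (simplex_vertex 0)) \<noteq> 0" using small[of 0 f0 0 0] by (auto simp: G0)
    then show ?case
      by (auto simp: G0 alternating_count_of alternating_labels_def alternating_set_def of_bool_def)
  next
    case (Suc n)
    have "even (alternating_count True n lab (chain_boundary (Suc n) (G (Suc n)))
        + alternating_count True (Suc n) lab (G (Suc n)) + alternating_count False (Suc n) lab (G (Suc n)))"
      by (rule alternating_count_boundary) (use small Suc.prems in blast)
    then have ev: "even (alternating_count True n lab (chain_boundary (Suc n) (G (Suc n)))
        + (alternating_count True (Suc n) lab (G (Suc n)) + alternating_count False (Suc n) lab (G (Suc n))))"
      by (simp only: add.assoc)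
    have n: "n \<le> m" using Suc.prems by simp
    have "alternating_count True n lab (chain_map n antipode (G n)) = alternating_count (\<not> True) n lab (G n)"
      by (rule alternating_count_chain_map[where X = "nsphere m" and c = "G n" and p = n and lab = lab
                and g = antipode and b = True, OF small[OF n] G[OF n] lab_odd])
    then have bd: "alternating_count True n lab (chain_boundary (Suc n) (G (Suc n)))
        = alternating_count True n lab (G n) - (-1) ^ n * alternating_count False n lab (G n)"
      using Suc.prems by (simp only: bG Suc_le_eq alternating_count_diff alternating_count_cmul not_True_eq_False)
    have key: "odd t" if "even (a - e * b + t)" "odd (a + b)" "e = 1 \<or> e = -1" for a b e t :: int
      using that by auto
    have "(-1::int) ^ n = 1 \<or> (-1::int) ^ n = -1" by (metis neg_one_even_power neg_one_odd_power)
    then show ?case by (rule key[OF ev[unfolded bd] Suc.IH[OF n]])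
  qed
  have "alternating_count True m lab (G m) \<noteq> 0 \<or> alternating_count False m lab (G m) \<noteq> 0"
    using odd[of m] by auto
  then obtain f b where f: "f \<in> Poly_Mapping.keys (G m)" "alternating_labels b {..m} (\<lambda>i. lab (f (simplex_vertex i)))"
    by (metis alternating_count_nonzero)
  let ?l = "\<lambda>i. nat \<bar>lab (f (simplex_vertex i))\<bar>"
  have "inj_on ?l {..m}"
  proof (rule inj_onI)
    fix i j assume ij: "i \<in> {..m}" "j \<in> {..m}" "?l i = ?l j"
    then have "lab (f (simplex_vertex i)) = lab (f (simplex_vertex j))"
      using small[OF order_refl f(1), of i j] by (auto simp: abs_if split: if_splits)
    then show "i = j" using f(2) ij by (auto simp: alternating_labels_def dest: inj_onD)
  qed
  moreover have "?l ` {..m} \<subseteq> {1..m}"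
  proof clarify
    fix i assume "i \<le> m"
    moreover have "singular_simplex m (nsphere m) f" using G[of m] f(1) by (auto simp: singular_chain_def)
    ultimately have "f (simplex_vertex i) \<in> topspace (nsphere m)"
      by (auto simp: singular_simplex_def continuous_map_def Pi_iff)
    from idx[OF this] show "?l i \<in> {1..m}" by (auto simp: lab_def)
  qed
  ultimately have "card {..m} \<le> card {1..m}" by (metis card_image card_mono finite_atLeastAtMost)
  then show False by simp
qed

section \<open>The index and admissible families\<close>

lemma continuous_on_Max_image:
  fixes g :: "'i \<Rightarrow> 'a :: topological_space \<Rightarrow> real"
  assumes "finite I" "I \<noteq> {}" "\<And>i. i \<in> I \<Longrightarrow> continuous_on A (g i)"
  shows "continuous_on A (\<lambda>a. Max ((\<lambda>i. g i a) ` I))"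
  using assms
proof (induction I rule: finite_ne_induct)
  case (insert i I)
  have "continuous_on A (\<lambda>a. max (g i a) (Max ((\<lambda>i. g i a) ` I)))"
    using insert by (intro continuous_on_max) auto
  then show ?case using insert by simp
qed simp

lemma continuous_on_antipode: "continuous_on S antipode"
proof -
  have "continuous_on UNIV antipode"
    unfolding antipode_def by (intro continuous_on_coordinatewise_then_product continuous_on_minus continuous_on_product_coordinates)
  then show ?thesis by (rule continuous_on_subset) simp
qed

text \<open>An upper bound for the Lusternik-Schnirelmann index of a symmetric set.  Closedness of the sets in the whole
  space makes the bound pass to subsets and add up over unions without topology on \<open>A\<close>.\<close>
definition index_le :: "(nat \<Rightarrow> real) set \<Rightarrow> nat \<Rightarrow> bool" where
  "index_le A m \<longleftrightarrow> (\<exists>B. (\<forall>i<m. closed (B i) \<and> (\<forall>x\<in>B i. antipode x \<notin> B i)) \<and>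
     (\<forall>a\<in>A. \<exists>i<m. a \<in> B i \<or> antipode a \<in> B i))"

lemma index_leE:
  assumes "index_le A m"
  obtains B where "\<And>i. i < m \<Longrightarrow> closed (B i)" "\<And>i x. i < m \<Longrightarrow> x \<in> B i \<Longrightarrow> antipode x \<notin> B i"
    "\<And>a. a \<in> A \<Longrightarrow> \<exists>i<m. a \<in> B i \<or> antipode a \<in> B i"
proof -
  obtain B where B: "\<forall>i<m. closed (B i) \<and> (\<forall>x\<in>B i. antipode x \<notin> B i)"
     "\<forall>a\<in>A. \<exists>i<m. a \<in> B i \<or> antipode a \<in> B i" using assms by (auto simp: index_le_def)
  show thesis by (rule that[of B]) (use B in blast)+
qed

lemma index_le_union:
  assumes A: "index_le A m" and A': "index_le A' m'" and C: "C \<subseteq> A \<union> A'"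
  shows "index_le C (m + m')"
proof -
  obtain B where B: "\<And>i. i < m \<Longrightarrow> closed (B i)" "\<And>i x. i < m \<Longrightarrow> x \<in> B i \<Longrightarrow> antipode x \<notin> B i"
    "\<And>a. a \<in> A \<Longrightarrow> \<exists>i<m. a \<in> B i \<or> antipode a \<in> B i" using index_leE[OF A] by blast
  obtain B' where B': "\<And>i. i < m' \<Longrightarrow> closed (B' i)" "\<And>i x. i < m' \<Longrightarrow> x \<in> B' i \<Longrightarrow> antipode x \<notin> B' i"
    "\<And>a. a \<in> A' \<Longrightarrow> \<exists>i<m'. a \<in> B' i \<or> antipode a \<in> B' i" using index_leE[OF A'] by blast
  define D where "D i = (if i < m then B i else B' (i - m))" for i
  have "\<exists>i<m + m'. a \<in> D i \<or> antipode a \<in> D i" if aC: "a \<in> C" for a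
  proof (cases "a \<in> A")
    case True
    then obtain i where "i < m" "a \<in> B i \<or> antipode a \<in> B i" using B(3) by blast
    then show ?thesis by (intro exI[of _ i]) (auto simp: D_def)
  next
    case False
    then obtain i where "i < m'" "a \<in> B' i \<or> antipode a \<in> B' i" using B'(3) C aC by blast
    then show ?thesis by (intro exI[of _ "m + i"]) (auto simp: D_def)
  qed
  moreover have "closed (D i) \<and> (\<forall>x\<in>D i. antipode x \<notin> D i)" if "i < m + m'" for i
    using that B(1,2) B'(1,2)[of "i - m"] by (auto simp: D_def)
  ultimately show ?thesis unfolding index_le_def by blast
qed

lemma index_le_mono: assumes "index_le A m" "m \<le> m'" shows "index_le A m'"
proof -
  obtain B where B: "\<forall>i<m. closed (B i) \<and> (\<forall>x\<in>B i. antipode x \<notin> B i)"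
     "\<forall>a\<in>A. \<exists>i<m. a \<in> B i \<or> antipode a \<in> B i" using assms(1) by (auto simp: index_le_def)
  have "\<forall>i<m'. closed (if i < m then B i else {}) \<and> (\<forall>x\<in>(if i < m then B i else {}). antipode x \<notin> (if i < m then B i else {}))"
    using B(1) by auto
  moreover have "\<forall>a\<in>A. \<exists>i<m'. a \<in> (if i < m then B i else {}) \<or> antipode a \<in> (if i < m then B i else {})"
  proof
    fix a assume "a \<in> A"
    then obtain i where "i < m" "a \<in> B i \<or> antipode a \<in> B i" using B(2) by blast
    then show "\<exists>i<m'. a \<in> (if i < m then B i else {}) \<or> antipode a \<in> (if i < m then B i else {})"
      using assms(2) by (intro exI[of _ i]) auto
  qed
  ultimately show ?thesis unfolding index_le_def by (intro exI[of _ "\<lambda>i. if i < m then B i else {}"]) blast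
qed

lemma index_nsphere: "\<not> index_le (topspace (nsphere m)) m"
proof
  assume ind: "index_le (topspace (nsphere m)) m"
  obtain B where B: "\<And>i. i < m \<Longrightarrow> closed (B i)" "\<And>i x. i < m \<Longrightarrow> x \<in> B i \<Longrightarrow> antipode x \<notin> B i"
    "\<And>a. a \<in> topspace (nsphere m) \<Longrightarrow> \<exists>i<m. a \<in> B i \<or> antipode a \<in> B i" using index_leE[OF ind] by blast
  obtain x where "x \<in> topspace (nsphere m)" "\<And>i. i < m \<Longrightarrow> x \<notin> B i \<and> antipode x \<notin> B i"
    using Lusternik_Schnirelmann_nsphere[of m B, OF B(1,2)] by blast
  then show False using B(3) by blast
qed

context periodic_problem
begin

lemma solutions_minus: assumes "z \<in> solutions p V f" shows "(\<lambda>x. - z x) \<in> solutions p V f"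
proof -
  obtain ph where ph: "\<And>k. ph k \<in> fin_supp" "\<And>e. 0 < e \<Longrightarrow> \<exists>K. \<forall>k\<ge>K. \<forall>l\<ge>K. E_norm p V (\<lambda>x. ph k x - ph l x) < e"
    "\<And>x. (\<lambda>k. ph k x) \<longlonglongrightarrow> z x" using assms by (auto simp: solutions_def E_space_def)
  have "(\<lambda>x. - z x) \<in> E_space p V"
    unfolding E_space_def
  proof (rule CollectI, intro exI[of _ "\<lambda>k x. - ph k x"] conjI allI impI)
    show "(\<lambda>x. - ph k x) \<in> fin_supp" for k using fin_supp_scale[OF ph(1), of "-1" k] by simp
    show "(\<lambda>k. - ph k x) \<longlonglongrightarrow> - z x" for x by (intro tendsto_minus ph(3))
    fix e :: real assume "0 < e"
    have "En (\<lambda>x. - w x) = En w" for w :: "int ^ 'n \<Rightarrow> real" by (simp add: En_def edge_energy_def abs_minus_commute)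
    then have "E_norm p V (\<lambda>x. - ph k x - - ph l x) = E_norm p V (\<lambda>x. ph k x - ph l x)" for k l
      using \<open>\<And>w. En (\<lambda>x. - w x) = En w\<close>[of "\<lambda>x. ph k x - ph l x"] by (simp add: E_norm_En)
    then show "\<exists>K. \<forall>k\<ge>K. \<forall>l\<ge>K. E_norm p V (\<lambda>x. - ph k x - - ph l x) < e"
      using ph(2)[OF \<open>0 < e\<close>] by (simp only:)
  qed
  moreover have "residual (\<lambda>x. - z x) x = 0" for x
    using assms by (simp add: residual_minus) (simp add: residual_def solutions_def)
  then have "- p_laplacian p (\<lambda>x. - z x) x + V x * \<bar>- z x\<bar> powr (p - 2) * - z x = f x (- z x)" for x
    unfolding residual_def by (simp only: right_minus_eq)
  ultimately show ?thesis unfolding solutions_def by blast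
qed

lemma level_minus: "level (\<lambda>x. - z x) = level z"
  by (simp add: level_def G_def f_minus F_minus)

text \<open>An odd map \<open>h\<close> from a compact symmetric set to the sublevel \<open>D\<close> on the Nehari manifold.  The common
  finite support lets pointwise continuity stand for continuity in every norm.\<close>
definition admissible :: "(nat \<Rightarrow> real) set \<Rightarrow> ((nat \<Rightarrow> real) \<Rightarrow> int ^ 'n \<Rightarrow> real) \<Rightarrow> real \<Rightarrow> bool" where
  "admissible A h D \<longleftrightarrow> compact A \<and> (\<exists>B. finite B \<and> (\<forall>a\<in>A. \<forall>x. x \<notin> B \<longrightarrow> h a x = 0)) \<and>
     (\<forall>x. continuous_on A (\<lambda>a. h a x)) \<and>
     (\<forall>a\<in>A. antipode a \<in> A \<and> h (antipode a) = (\<lambda>x. - h a x) \<and> h a \<in> nehari \<and> J (h a) \<le> D)"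

lemma admissible_uniform:
  assumes h: "admissible A h D" and a: "\<And>n. s n \<in> A" "l \<in> A" "s \<longlonglongrightarrow> l" and e: "0 < e"
  shows "\<exists>n0. \<forall>n\<ge>n0. \<forall>x. \<bar>h (s n) x - h l x\<bar> \<le> e"
proof -
  obtain B where B: "finite B" "\<And>a x. a \<in> A \<Longrightarrow> x \<notin> B \<Longrightarrow> h a x = 0" using h by (auto simp: admissible_def)
  have "\<forall>\<^sub>F n in sequentially. \<bar>h (s n) x - h l x\<bar> < e" for x
  proof -
    have c: "continuous_on A (\<lambda>a. h a x)" using h by (simp add: admissible_def)
    have "(\<lambda>n. h (s n) x) \<longlonglongrightarrow> h l x"
      by (rule continuous_on_tendsto_compose[OF c a(3) a(2)]) (simp add: a(1))
    then show ?thesis using e by (auto simp: tendsto_iff dist_real_def)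
  qed
  then have "\<forall>\<^sub>F n in sequentially. \<forall>x\<in>B. \<bar>h (s n) x - h l x\<bar> < e" using B(1) by (simp add: eventually_ball_finite)
  then obtain n0 where n0: "\<And>n x. n0 \<le> n \<Longrightarrow> x \<in> B \<Longrightarrow> \<bar>h (s n) x - h l x\<bar> < e" by (auto simp: eventually_sequentially)
  have "\<bar>h (s n) x - h l x\<bar> \<le> e" if "n0 \<le> n" for n x
    using n0[OF that, of x] B(2)[OF a(1), of x n] B(2)[OF a(2), of x] e by (cases "x \<in> B") auto
  then show ?thesis by blast
qed

lemma J_cont:
  assumes B: "finite B" "\<And>a x. a \<in> A \<Longrightarrow> x \<notin> B \<Longrightarrow> h a x = 0" and c: "\<And>x. continuous_on A (\<lambda>a. h a x)"
  shows "continuous_on A (\<lambda>a. J (h a))"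
proof -
  have "continuous_on A (\<lambda>a. ((\<Sum>(x, y)\<in>edges B. \<bar>h a y - h a x\<bar> powr p) / 2 + (\<Sum>x\<in>B. V x * \<bar>h a x\<bar> powr p)) / p
      - (\<Sum>x\<in>B. F x (h a x)))"
    unfolding case_prod_unfold
    by (intro continuous_intros continuous_on_powr' c continuous_on_compose2[OF F_cont[of UNIV] c]) (use p2 in auto)
  moreover have "J (h a) = ((\<Sum>(x, y)\<in>edges B. \<bar>h a y - h a x\<bar> powr p) / 2 + (\<Sum>x\<in>B. V x * \<bar>h a x\<bar> powr p)) / p
      - (\<Sum>x\<in>B. F x (h a x))" if "a \<in> A" for a
    unfolding J_def using En_eq[OF B(1) B(2)[OF that]] site_sum_eq[OF B(1) B(2)[OF that], where h = F] by simp
  ultimately show ?thesis by (simp cong: continuous_on_cong)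
qed

lemma residual_cont:
  assumes c: "\<And>x. continuous_on A (\<lambda>a. h a x)"
  shows "continuous_on A (\<lambda>a. residual (h a) x)"
proof -
  have k: "continuous_on A (\<lambda>a. kap (g a))" if "continuous_on A g" for g
    using continuous_on_compose2[OF continuous_on_abs_powr_mult[OF p2, of UNIV] that] by simp
  have fx: "continuous_on A (\<lambda>a. f x (h a x))"
    using continuous_on_compose2[OF f_cont[rule_format, of x] c[of x]] by simp
  show ?thesis
    unfolding residual_def p_laplacian_def mult.assoc
    by (intro continuous_on_diff continuous_on_add continuous_on_minus continuous_on_sum continuous_on_mult_left k fx c)
qed

lemma residual_support:
  assumes "\<And>x. x \<notin> B \<Longrightarrow> u x = 0" "x \<notin> B \<union> (\<Union>y\<in>B. {z. adj y z})"
  shows "residual u x = 0"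
proof -
  have "u y = 0" if "adj x y" for y using assms that adj_sym by blast
  moreover have "u x = 0" using assms by blast
  ultimately show ?thesis by (simp add: residual_def p_laplacian_def)
qed

lemma proj_cont:
  assumes B: "finite B" "\<And>a x. a \<in> A \<Longrightarrow> x \<notin> B \<Longrightarrow> h a x = 0" and c: "\<And>x. continuous_on A (\<lambda>a. h a x)"
    and nz: "\<And>a. a \<in> A \<Longrightarrow> h a \<noteq> (\<lambda>_. 0)"
  shows "continuous_on (A :: 'b :: metric_space set) (\<lambda>a. proj (h a) x)"
  unfolding continuous_on_iff
proof (intro ballI allI impI)
  fix a e assume a: "a \<in> A" and e: "(0::real) < e"
  have hf: "h b \<in> fin_supp" if "b \<in> A" for b
    unfolding fin_supp_def using B that by (auto intro!: finite_subset[OF _ B(1)])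
  define t where "t = ray_scale (h a)"
  have t: "0 < t" "proj (h a) \<in> nehari" using proj_nehari[OF hf[OF a] nz[OF a]] by (auto simp: t_def)
  have e2: "0 < e / 2" using e by simp
  obtain r where r: "0 < r" "\<And>u w. u \<in> nehari \<Longrightarrow> J u \<le> J (proj (h a)) \<Longrightarrow> w \<in> fin_supp \<Longrightarrow> l1norm (\<lambda>x. w x - u x) < r
     \<Longrightarrow> w \<noteq> (\<lambda>_. 0) \<and> 1 / 2 \<le> ray_scale w \<and> ray_scale w \<le> 2 \<and> \<bar>ray_scale w - 1\<bar> \<le> e / 2 \<and> (\<forall>x. \<bar>proj w x - u x\<bar> \<le> e / 2)"
    using proj_near[OF e2, of "J (proj (h a))"] by blast
  have cs: "continuous_on A (\<lambda>b. \<Sum>x\<in>B. \<bar>t * h b x - t * h a x\<bar>)" by (intro continuous_intros c)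
  obtain d where d: "0 < d" "\<And>b. b \<in> A \<Longrightarrow> dist b a < d \<Longrightarrow>
      dist (\<Sum>x\<in>B. \<bar>t * h b x - t * h a x\<bar>) (\<Sum>x\<in>B. \<bar>t * h a x - t * h a x\<bar>) < r"
    using cs[unfolded continuous_on_iff, rule_format, OF a r(1)] by blast
  have "dist (proj (h b) x) (proj (h a) x) < e" if b: "b \<in> A" "dist b a < d" for b
  proof -
    have "l1norm (\<lambda>x. t * h b x - proj (h a) x) = (\<Sum>x\<in>B. \<bar>t * h b x - t * h a x\<bar>)"
      unfolding proj_def t_def[symmetric] by (rule l1norm_eq[OF B(1)]) (simp add: B(2)[OF b(1)] B(2)[OF a])
    then have "l1norm (\<lambda>x. t * h b x - proj (h a) x) < r" using d(2)[OF b] by (simp add: dist_real_def)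
    then have "\<bar>proj (\<lambda>x. t * h b x) x - proj (h a) x\<bar> \<le> e / 2"
      using r(2)[OF t(2) order_refl fin_supp_scale[OF hf[OF b(1)]]] by blast
    moreover have "proj (\<lambda>x. t * h b x) = proj (h b)" by (rule proj_scale[OF hf[OF b(1)] nz[OF b(1)] t(1)])
    ultimately show ?thesis using e by (simp add: dist_real_def)
  qed
  then show "\<exists>d>0. \<forall>x'\<in>A. dist x' a < d \<longrightarrow> dist (proj (h x') x) (proj (h a) x) < e" using d(1) by blast
qed

text \<open>The residual norm used below; \<open>B\<close> will contain the support of the residual.\<close>
definition slope :: "(int ^ 'n) set \<Rightarrow> (int ^ 'n \<Rightarrow> real) \<Rightarrow> real" where
  "slope B u = Max ((\<lambda>x. \<bar>residual u x\<bar>) ` B)"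

text \<open>A continuous odd choice of a function that, where the slope is at least \<open>2 * c\<close>, has unit \<open>l1\<close> norm and pairs
  with the residual to at least half of the slope; \<open>J\<close> decreases against it.  Soft thresholding at half of the slope keeps only the sites with large residual, all with the
  correct sign; the maximum with \<open>c\<close> keeps the denominator positive where the slope is small.\<close>
definition descent_field :: "(int ^ 'n) set \<Rightarrow> real \<Rightarrow> (int ^ 'n \<Rightarrow> real) \<Rightarrow> int ^ 'n \<Rightarrow> real" where
  "descent_field B c u x = soft_threshold (slope B u / 2) (residual u x)
     / max (\<Sum>y\<in>B. \<bar>soft_threshold (slope B u / 2) (residual u y)\<bar>) c"

lemma soft_threshold_minus: "soft_threshold e (- t) = - soft_threshold e t"
  by (simp add: soft_threshold_def)

lemma descent_field_minus: "descent_field B c (\<lambda>x. - u x) x = - descent_field B c u x"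
  by (simp add: descent_field_def slope_def residual_minus soft_threshold_minus)

lemma soft_threshold_0 [simp]: "0 \<le> e \<Longrightarrow> soft_threshold e 0 = 0"
  by (simp add: soft_threshold_def)

lemma soft_threshold_times: "0 \<le> e \<Longrightarrow> e * \<bar>soft_threshold e t\<bar> \<le> t * soft_threshold e t"
proof -
  assume e: "0 \<le> e"
  consider "t > e" | "t < - e" | "\<bar>t\<bar> \<le> e" by linarith
  then show ?thesis
  proof cases
    case 1
    then have "soft_threshold e t = t - e" using e by (simp add: soft_threshold_def)
    then show ?thesis using 1 by (simp add: mult_right_mono)
  next
    case 2
    then have s: "soft_threshold e t = t + e" using e by (simp add: soft_threshold_def)
    have "e * (- (t + e)) \<le> (- t) * (- (t + e))" using 2 by (intro mult_right_mono) auto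
    then show ?thesis using 2 s by (simp add: abs_of_neg algebra_simps)
  next
    case 3
    then have "soft_threshold e t = 0" by (simp add: soft_threshold_def)
    then show ?thesis by simp
  qed
qed

text \<open>At sites where the thresholded residual is nonzero, the residual is at least half of the slope in absolute
  value and has the same sign.\<close>
lemma descent_field_props:
  assumes B: "finite B" "\<And>x. x \<notin> B \<Longrightarrow> residual u x = 0" and c: "0 < c" and sl: "2 * c \<le> slope B u" and ne: "B \<noteq> {}"
  shows "descent_field B c u \<in> fin_supp" "l1norm (descent_field B c u) = 1"
    "slope B u / 2 \<le> (\<Sum>x | descent_field B c u x \<noteq> 0. residual u x * descent_field B c u x)"
proof -
  define e where "e = slope B u / 2"
  define S where "S = (\<Sum>y\<in>B. \<bar>soft_threshold e (residual u y)\<bar>)"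
  have e: "c \<le> e" "0 \<le> e" using sl c by (auto simp: e_def)
  obtain x0 where x0: "x0 \<in> B" "\<bar>residual u x0\<bar> = 2 * e"
  proof -
    have "Max ((\<lambda>x. \<bar>residual u x\<bar>) ` B) \<in> (\<lambda>x. \<bar>residual u x\<bar>) ` B" using B(1) ne by (intro Max_in) auto
    then obtain x0 where "x0 \<in> B" "Max ((\<lambda>x. \<bar>residual u x\<bar>) ` B) = \<bar>residual u x0\<bar>" by blast
    then show thesis by (intro that[of x0]) (auto simp: e_def slope_def)
  qed
  have "\<bar>soft_threshold e (residual u x0)\<bar> = e"
    using x0(2) e by (auto simp: soft_threshold_def abs_if max_def split: if_splits)
  moreover have "\<bar>soft_threshold e (residual u x0)\<bar> \<le> S"
    unfolding S_def by (rule member_le_sum[of x0 B "\<lambda>y. \<bar>soft_threshold e (residual u y)\<bar>"]) (use x0 B in auto)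
  ultimately have S: "c \<le> S" "0 < S" using e c by auto
  have df: "descent_field B c u x = soft_threshold e (residual u x) / S" for x
    using S by (simp add: descent_field_def e_def[symmetric] S_def[symmetric] max_def)
  have out: "descent_field B c u x = 0" if "x \<notin> B" for x using B(2)[OF that] e by (simp add: df)
  show "descent_field B c u \<in> fin_supp"
    unfolding fin_supp_def using out by (auto intro!: finite_subset[OF _ B(1)])
  have "l1norm (descent_field B c u) = (\<Sum>x\<in>B. \<bar>soft_threshold e (residual u x)\<bar> / S)"
    using l1norm_eq[OF B(1), of "descent_field B c u", OF out] S by (simp add: df abs_divide)
  also have "\<dots> = 1" using S by (simp add: S_def flip: sum_divide_distrib)
  finally show "l1norm (descent_field B c u) = 1" .
  have "e * S = (\<Sum>x\<in>B. e * \<bar>soft_threshold e (residual u x)\<bar>)" by (simp add: S_def sum_distrib_left)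
  also have "\<dots> \<le> (\<Sum>x\<in>B. residual u x * soft_threshold e (residual u x))"
    by (intro sum_mono soft_threshold_times e)
  finally have "e \<le> (\<Sum>x\<in>B. residual u x * soft_threshold e (residual u x)) / S" using S by (simp add: field_simps)
  also have "\<dots> = (\<Sum>x\<in>B. residual u x * descent_field B c u x)" by (simp add: df sum_divide_distrib)
  also have "\<dots> = (\<Sum>x | descent_field B c u x \<noteq> 0. residual u x * descent_field B c u x)"
    by (rule sum.mono_neutral_right[OF B(1)]) (use out in auto)
  finally show "slope B u / 2 \<le> (\<Sum>x | descent_field B c u x \<noteq> 0. residual u x * descent_field B c u x)"
    by (simp add: e_def)
qed

lemma descent_field_cont:
  assumes B: "finite B" "B \<noteq> {}" and c: "\<And>x. continuous_on A (\<lambda>a. h a x)" and c0: "0 < c"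
  shows "continuous_on A (\<lambda>a. descent_field B c (h a) x)"
proof -
  have s: "continuous_on A (\<lambda>a. slope B (h a))"
    unfolding slope_def by (rule continuous_on_Max_image[OF B]) (intro continuous_on_rabs residual_cont c)
  have st: "continuous_on A (\<lambda>a. soft_threshold (slope B (h a) / 2) (residual (h a) y))" for y
    unfolding soft_threshold_def
    by (intro continuous_on_diff continuous_on_max continuous_on_minus continuous_on_const residual_cont c continuous_on_divide s) auto
  show ?thesis
    unfolding descent_field_def
    by (intro continuous_on_divide st continuous_on_max continuous_on_sum continuous_on_rabs continuous_on_const) (use c0 in auto)
qed

end

section \<open>Almost critical functions when solutions are separated\<close>

text \<open>The situation to be refuted.  It arises from finitely many orbits of solutions, although the solutions themselves
  may be infinitely many.\<close>
locale few_solutions = periodic_problem T p pstar V f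
  for T :: int and p pstar :: real and V :: "int ^ 'n \<Rightarrow> real" and f :: "int ^ 'n \<Rightarrow> real \<Rightarrow> real" +
  fixes \<kappa> :: real
  assumes kappa: "0 < \<kappa>"
    and separated: "\<And>z z'. z \<in> solutions p V f \<Longrightarrow> z' \<in> solutions p V f \<Longrightarrow> z \<noteq> z' \<Longrightarrow> \<exists>x. \<kappa> \<le> \<bar>z x - z' x\<bar>"
    and finite_levels: "finite (level ` {z \<in> solutions p V f. z \<noteq> (\<lambda>_. 0)})"
begin

abbreviation "levels \<equiv> level ` {z \<in> solutions p V f. z \<noteq> (\<lambda>_. 0)}"

definition almost_critical :: "real \<Rightarrow> real \<Rightarrow> (int ^ 'n \<Rightarrow> real) set" where
  "almost_critical D t = {u \<in> nehari. J u \<le> D \<and> (\<forall>x. \<bar>residual u x\<bar> \<le> t)}"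

lemma nehari_bounds_ex:
  "\<exists>R M c. 0 < M \<and> 0 < c \<and> (\<forall>u\<in>nehari. J u \<le> D \<longrightarrow>
     En u \<le> R \<and> psum u \<le> R \<and> (\<forall>x. \<bar>u x\<bar> \<le> M) \<and> (\<exists>x. c < \<bar>u x\<bar>))"
proof (rule nehari_bounds[of D])
  fix R M c
  assume "0 < M" "0 < c" and b: "\<And>u. u \<in> nehari \<Longrightarrow> J u \<le> D \<Longrightarrow> En u \<le> R" "\<And>u. u \<in> nehari \<Longrightarrow> J u \<le> D \<Longrightarrow> psum u \<le> R"
    "\<And>u x. u \<in> nehari \<Longrightarrow> J u \<le> D \<Longrightarrow> \<bar>u x\<bar> \<le> M" "\<And>u. u \<in> nehari \<Longrightarrow> J u \<le> D \<Longrightarrow> \<exists>x. c < \<bar>u x\<bar>"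
  show ?thesis
    by (rule exI[of _ R], rule exI[of _ M], rule exI[of _ c])
       (intro conjI ballI impI allI b \<open>0 < M\<close> \<open>0 < c\<close>)
qed

lemma subsequence_ex:
  fixes u :: "nat \<Rightarrow> int ^ 'n \<Rightarrow> real"
  assumes "\<And>n x. \<bar>u n x\<bar> \<le> M"
  shows "\<exists>r z. strict_mono (r :: nat \<Rightarrow> nat) \<and> (\<forall>x. (\<lambda>n. u (r n) x) \<longlonglongrightarrow> z x)"
proof (rule bounded_pointwise_subsequence[OF countable_int_vec assms])
  fix r :: "nat \<Rightarrow> nat" and z
  assume "strict_mono r" "\<And>x. (\<lambda>n. u (r n) x) \<longlonglongrightarrow> z x"
  then show ?thesis by (intro exI[of _ r] exI[of _ z]) simp
qed

lemma almost_critical_limit: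
  assumes u: "\<And>n. u n \<in> almost_critical D (1 / real (Suc n))"
    and z: "strict_mono r" "\<And>x. (\<lambda>n. u (r n) x) \<longlonglongrightarrow> z x"
  shows "z \<in> solutions p V f"
proof -
  obtain R where R: "\<forall>u\<in>nehari. J u \<le> D \<longrightarrow> En u \<le> R \<and> psum u \<le> R"
    using nehari_bounds_ex[of D] by blast
  show ?thesis
  proof (rule limit_is_solution[of "\<lambda>n. u (r n)" R])
    show "u (r n) \<in> fin_supp" for n using u nehariD(1) by (auto simp: almost_critical_def)
    show "En (u (r n)) \<le> R" "psum (u (r n)) \<le> R" for n using u R by (auto simp: almost_critical_def)
    show "(\<lambda>n. u (r n) x) \<longlonglongrightarrow> z x" for x by (rule z(2))
    show "(\<lambda>n. residual (u (r n)) x) \<longlonglongrightarrow> 0" for x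
    proof (rule Lim_null_comparison)
      have "norm (residual (u (r n)) x) \<le> 1 / real (Suc (r n))" for n
        using u[of "r n"] by (simp only: almost_critical_def mem_Collect_eq real_norm_def)
      moreover have "1 / real (Suc (r n)) \<le> 1 / real (Suc n)" for n
        using seq_suble[OF z(1), of n] by (intro divide_left_mono) auto
      ultimately show "\<forall>\<^sub>F n in sequentially. norm (residual (u (r n)) x) \<le> 1 / real (Suc n)"
        by (intro always_eventually allI) (rule order_trans)
      show "(\<lambda>k. 1 / real (Suc k)) \<longlonglongrightarrow> 0" using LIMSEQ_inverse_real_of_nat by (simp add: inverse_eq_divide)
    qed
  qed
qed

lemma almost_critical_shift: "u \<in> almost_critical D t \<Longrightarrow> shift k u \<in> almost_critical D t"
  by (auto simp: almost_critical_def nehari_shift J_shift residual_shift)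

lemma almost_critical_mono: "u \<in> almost_critical D t \<Longrightarrow> t \<le> t' \<Longrightarrow> u \<in> almost_critical D t'"
  by (auto simp: almost_critical_def intro: order_trans)

text \<open>Otherwise there are pairs of almost critical functions with residuals tending to \<open>0\<close> that stay at
  distance at most \<open>\<kappa> / 2\<close> but differ by more than \<open>e\<close> at some site.  After translating that site into the cell,
  both sequences converge pointwise along a subsequence to solutions at distance at most \<open>\<kappa> / 2\<close>, hence to
  the same solution, which contradicts the difference in the finite cell.\<close>
lemma almost_critical_dichotomy:
  assumes e: "0 < e"
  shows "\<exists>t>0. \<forall>u\<in>almost_critical D t. \<forall>v\<in>almost_critical D t.
    (\<forall>x. \<bar>u x - v x\<bar> \<le> \<kappa> / 2) \<longrightarrow> (\<forall>x. \<bar>u x - v x\<bar> \<le> e)"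
proof (rule ccontr)
    assume neg: "\<not> ?thesis"
    have "\<exists>u v y. u \<in> almost_critical D (1 / real (Suc n)) \<and> v \<in> almost_critical D (1 / real (Suc n)) \<and>
       (\<forall>x. \<bar>u x - v x\<bar> \<le> \<kappa> / 2) \<and> e < \<bar>u y - v y\<bar>" for n
    proof -
      have "0 < 1 / real (Suc n)" by simp
      then show ?thesis using neg by (meson not_le)
    qed
    then obtain u v y where uv: "\<And>n. u n \<in> almost_critical D (1 / real (Suc n))" "\<And>n. v n \<in> almost_critical D (1 / real (Suc n))"
      "\<And>n x. \<bar>u n x - v n x\<bar> \<le> \<kappa> / 2" "\<And>n. e < \<bar>u n (y n) - v n (y n)\<bar>" by metis
    have "\<exists>k. y n + T *s k \<in> cell" for n using to_cell[of "y n"] by blast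
    then obtain k where k: "\<And>n. y n + T *s k n \<in> cell" by metis
    define U where "U n = shift (- k n) (u n)" for n
    define W where "W n = shift (- k n) (v n)" for n
    have U: "U n \<in> almost_critical D (1 / real (Suc n))" and W: "W n \<in> almost_critical D (1 / real (Suc n))" for n
      using uv almost_critical_shift by (auto simp: U_def W_def)
    have UW: "\<bar>U n x - W n x\<bar> \<le> \<kappa> / 2" for n x using uv(3) by (simp add: U_def W_def shift_def)
    have far: "e < \<bar>U n (y n + T *s k n) - W n (y n + T *s k n)\<bar>" for n
    proof -
      have "y n + T *s k n + T *s (- k n) = y n" by (simp add: vec_eq_iff)
      then show ?thesis using uv(4)[of n] by (simp add: U_def W_def shift_def)
    qed
    obtain M where M: "\<forall>u\<in>nehari. J u \<le> D \<longrightarrow> (\<forall>x. \<bar>u x\<bar> \<le> M)" using nehari_bounds_ex[of D] by blast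
    have UM: "\<bar>U n x\<bar> \<le> M" and WM: "\<bar>W n x\<bar> \<le> M" for n x using U W M by (auto simp: almost_critical_def)
    obtain r z where r: "strict_mono r" and z: "\<And>x. (\<lambda>n. U (r n) x) \<longlonglongrightarrow> z x"
      using subsequence_ex[of U M, OF UM] by blast
    obtain r' z' where r': "strict_mono r'" and z': "\<And>x. (\<lambda>n. W (r (r' n)) x) \<longlonglongrightarrow> z' x"
      using subsequence_ex[of "\<lambda>n. W (r n)" M, OF WM] by blast
    have rr: "strict_mono (\<lambda>n. r (r' n))" using strict_mono_compose[OF r r'] by (simp add: o_def)
    have z2: "(\<lambda>n. U (r (r' n)) x) \<longlonglongrightarrow> z x" for x
      using LIMSEQ_subseq_LIMSEQ[OF z r'] by (simp add: o_def)
    have zs: "z \<in> solutions p V f" by (rule almost_critical_limit[OF U rr z2])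
    have zs': "z' \<in> solutions p V f" by (rule almost_critical_limit[OF W rr z'])
    have "\<bar>z x - z' x\<bar> \<le> \<kappa> / 2" for x
      by (rule LIMSEQ_le_const2[OF tendsto_rabs[OF tendsto_diff[OF z2 z']]]) (use UW in auto)
    moreover have "\<kappa> / 2 < \<kappa>" using kappa by simp
    ultimately have "\<not> (\<exists>x. \<kappa> \<le> \<bar>z x - z' x\<bar>)" by (meson not_le order_le_less_trans)
    then have "z = z'" using separated[OF zs zs'] by blast
    then have "(\<lambda>n. U (r (r' n)) x - W (r (r' n)) x) \<longlonglongrightarrow> 0" for x
      using tendsto_diff[OF z2[of x] z'[of x]] by simp
    then have "\<forall>\<^sub>F n in sequentially. \<bar>U (r (r' n)) x - W (r (r' n)) x\<bar> < e" for x
      using e by (auto simp: tendsto_iff dist_real_def)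
    then have "\<forall>\<^sub>F n in sequentially. \<forall>x\<in>cell. \<bar>U (r (r' n)) x - W (r (r' n)) x\<bar> < e"
      using finite_cell by (simp add: eventually_ball_finite)
    then obtain n where "\<forall>x\<in>cell. \<bar>U (r (r' n)) x - W (r (r' n)) x\<bar> < e" by (auto simp: eventually_sequentially)
    then have "\<bar>U (r (r' n)) (y (r (r' n)) + T *s k (r (r' n))) - W (r (r' n)) (y (r (r' n)) + T *s k (r (r' n)))\<bar> < e"
      using k by blast
    then show False using far[of "r (r' n)"] by linarith
qed

text \<open>Otherwise a sequence of functions near the compact image of \<open>h\<close> has residuals tending to \<open>0\<close>.  Along a
  subsequence its members are mutually within \<open>\<kappa> / 2\<close>, so by \<open>almost_critical_dichotomy\<close> it is Cauchy in
  the sup norm.  Its limit is a nonzero solution with level within \<open>e\<close> of \<open>d\<close>, hence of level \<open>d\<close>, from which the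
  functions were supposed to keep a distance.  In contrast to the bound of the dichotomy, this one depends on \<open>h\<close>.\<close>
lemma slope_bound:
  assumes h: "admissible A h D"
    and d: "\<And>l. l \<in> levels \<Longrightarrow> \<bar>l - d\<bar> \<le> e \<Longrightarrow> l = d"
  shows "\<exists>t>0. \<forall>a u. a \<in> A \<and> u \<in> nehari \<and> J u \<le> D \<and> \<bar>J u - d\<bar> \<le> e \<and> (\<forall>x. \<bar>u x - h a x\<bar> \<le> \<kappa> / 16) \<and>
     (\<forall>z. z \<in> solutions p V f \<longrightarrow> z \<noteq> (\<lambda>_. 0) \<longrightarrow> level z = d \<longrightarrow> (\<exists>x. \<kappa> / 16 \<le> \<bar>u x - z x\<bar>))
     \<longrightarrow> (\<exists>x. t < \<bar>residual u x\<bar>)" (is "\<exists>t>0. \<forall>a u. ?P a u \<longrightarrow> (\<exists>x. t < \<bar>residual u x\<bar>)")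
proof (rule ccontr)
    assume neg: "\<not> ?thesis"
    have "\<exists>a u. ?P a u \<and> (\<forall>x. \<bar>residual u x\<bar> \<le> 1 / real (Suc n))" for n
    proof -
      have "0 < 1 / real (Suc n)" by simp
      then have "\<exists>a u. ?P a u \<and> \<not> (\<exists>x. 1 / real (Suc n) < \<bar>residual u x\<bar>)" using neg by blast
      then show ?thesis by (simp only: not_ex not_less)
    qed
    then obtain a u where au: "\<And>n. ?P (a n) (u n)" and res: "\<And>n x. \<bar>residual (u n) x\<bar> \<le> 1 / real (Suc n)"
      by metis
    have "compact A" using h by (simp add: admissible_def)
    moreover have aA: "a n \<in> A" for n using au by blast
    ultimately obtain a0 r where a0: "a0 \<in> A" and r: "strict_mono r" and lim: "(a \<circ> r) \<longlonglongrightarrow> a0"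
      using compact_imp_seq_compact[of A] unfolding seq_compact_def by metis
    have k16: "0 < \<kappa> / 16" using kappa by simp
    obtain n0 where n0: "\<And>n x. n0 \<le> n \<Longrightarrow> \<bar>h ((a \<circ> r) n) x - h a0 x\<bar> \<le> \<kappa> / 16"
      using admissible_uniform[OF h _ a0 lim k16] aA by (metis comp_apply)
    have ac: "u n \<in> almost_critical D (1 / real (Suc n))" for n using au res by (auto simp: almost_critical_def)
    have close: "\<bar>u (r m) x - u (r n) x\<bar> \<le> \<kappa> / 2" if "n0 \<le> m" "n0 \<le> n" for m n x
    proof -
      have "\<bar>u (r m) x - h (a (r m)) x\<bar> \<le> \<kappa> / 16" "\<bar>u (r n) x - h (a (r n)) x\<bar> \<le> \<kappa> / 16" using au by blast+
      moreover have "\<bar>h (a (r m)) x - h a0 x\<bar> \<le> \<kappa> / 16" "\<bar>h (a (r n)) x - h a0 x\<bar> \<le> \<kappa> / 16" using n0 that by (auto simp: o_def)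
      ultimately show ?thesis using kappa by linarith
    qed
    have cauchy: "\<exists>N. \<forall>m\<ge>N. \<forall>n\<ge>N. \<forall>x. \<bar>u (r m) x - u (r n) x\<bar> \<le> q" if q: "0 < q" for q
    proof -
      obtain t where t: "0 < t" "\<forall>u\<in>almost_critical D t. \<forall>v\<in>almost_critical D t.
        (\<forall>x. \<bar>u x - v x\<bar> \<le> \<kappa> / 2) \<longrightarrow> (\<forall>x. \<bar>u x - v x\<bar> \<le> q)" using almost_critical_dichotomy[OF q, of D] by blast
      obtain N :: nat where N: "1 / t < real N" using reals_Archimedean2 by blast
      have ut: "u (r n) \<in> almost_critical D t" if "N \<le> n" for n
      proof (rule almost_critical_mono[OF ac])
        have "N \<le> r n" using seq_suble[OF r, of n] that by linarith
        then have "1 / t < real (Suc (r n))" using N by linarith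
        then show "1 / real (Suc (r n)) \<le> t" using t(1) by (simp add: field_simps)
      qed
      have "\<bar>u (r m) x - u (r n) x\<bar> \<le> q" if "max N n0 \<le> m" "max N n0 \<le> n" for m n x
      proof -
        have "u (r m) \<in> almost_critical D t" "u (r n) \<in> almost_critical D t" "\<forall>x. \<bar>u (r m) x - u (r n) x\<bar> \<le> \<kappa> / 2"
          using ut close that by auto
        then show ?thesis using t(2) by blast
      qed
      then show ?thesis by blast
    qed
    have "\<exists>l. (\<lambda>n. u (r n) x) \<longlonglongrightarrow> l" for x
    proof -
      have "Cauchy (\<lambda>n. u (r n) x)"
      proof (rule metric_CauchyI)
        fix q :: real assume "0 < q"
        then obtain N where "\<forall>m\<ge>N. \<forall>n\<ge>N. \<forall>x. \<bar>u (r m) x - u (r n) x\<bar> \<le> q / 2" using cauchy[of "q / 2"] by auto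
        then show "\<exists>M. \<forall>m\<ge>M. \<forall>n\<ge>M. dist (u (r m) x) (u (r n) x) < q"
        proof (intro exI allI impI)
          fix m n assume "N \<le> m" "N \<le> n"
          then have "\<bar>u (r m) x - u (r n) x\<bar> \<le> q / 2"
            using \<open>\<forall>m\<ge>N. \<forall>n\<ge>N. \<forall>x. \<bar>u (r m) x - u (r n) x\<bar> \<le> q / 2\<close> by blast
          then show "dist (u (r m) x) (u (r n) x) < q" using \<open>0 < q\<close> by (simp add: dist_real_def)
        qed
      qed
      then show ?thesis by (simp add: Cauchy_convergent_iff convergent_def)
    qed
    then obtain z where z: "\<And>x. (\<lambda>n. u (r n) x) \<longlonglongrightarrow> z x" by metis
    have zs: "z \<in> solutions p V f" by (rule almost_critical_limit[OF ac r z])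
    have unif: "\<exists>N. \<forall>n\<ge>N. \<forall>x. \<bar>u (r n) x - z x\<bar> \<le> q" if q: "0 < q" for q
    proof -
      obtain N where N: "\<And>m n x. N \<le> m \<Longrightarrow> N \<le> n \<Longrightarrow> \<bar>u (r m) x - u (r n) x\<bar> \<le> q" using cauchy[OF q] by blast
      have "\<bar>u (r n) x - z x\<bar> \<le> q" if "N \<le> n" for n x
        by (rule LIMSEQ_le_const2[OF tendsto_rabs[OF tendsto_diff[OF tendsto_const z]]]) (use N that in blast)
      then show ?thesis by blast
    qed
    obtain R c where c: "0 < c" and Rc: "\<forall>u\<in>nehari. J u \<le> D \<longrightarrow> psum u \<le> R \<and> (\<exists>x. c < \<bar>u x\<bar>)" using nehari_bounds_ex[of D] by blast
    have z0: "z \<noteq> (\<lambda>_. 0)"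
    proof
      assume "z = (\<lambda>_. 0)"
      then obtain N where N: "\<forall>n\<ge>N. \<forall>x. \<bar>u (r n) x - 0\<bar> \<le> c" using unif[OF c] by blast
      obtain x where "c < \<bar>u (r N) x\<bar>" using Rc au by blast
      moreover have "\<bar>u (r N) x - 0\<bar> \<le> c" using N by blast
      ultimately show False by simp
    qed
    have "(\<lambda>n. J (u (r n))) \<longlonglongrightarrow> level z"
    proof (rule J_tendsto_level[of _ R])
      show "u (r n) \<in> nehari" "psum (u (r n)) \<le> R" for n using au Rc by blast+
    qed (rule unif)
    then have "(\<lambda>n. \<bar>J (u (r n)) - d\<bar>) \<longlonglongrightarrow> \<bar>level z - d\<bar>" by (intro tendsto_intros)
    then have "\<bar>level z - d\<bar> \<le> e" by (rule LIMSEQ_le_const2) (use au in blast)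
    then have "level z = d" using d zs z0 by blast
    have k32: "0 < \<kappa> / 32" using kappa by simp
    obtain N where N: "\<And>n x. N \<le> n \<Longrightarrow> \<bar>u (r n) x - z x\<bar> \<le> \<kappa> / 32" using unif[OF k32] by blast
    obtain x where "\<kappa> / 16 \<le> \<bar>u (r N) x - z x\<bar>" using au[of "r N"] zs z0 \<open>level z = d\<close> by blast
    then show False using N[of N x] kappa by simp
qed

section \<open>Families near a critical level\<close>

definition critical_at :: "real \<Rightarrow> (int ^ 'n \<Rightarrow> real) set" where
  "critical_at d = {z \<in> solutions p V f. z \<noteq> (\<lambda>_. 0) \<and> level z = d}"

definition near_critical :: "(nat \<Rightarrow> real) set \<Rightarrow> ((nat \<Rightarrow> real) \<Rightarrow> int ^ 'n \<Rightarrow> real) \<Rightarrow> real \<Rightarrow> (nat \<Rightarrow> real) set" where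
  "near_critical A h d = {a \<in> A. \<exists>z\<in>critical_at d. \<forall>x. \<bar>h a x - z x\<bar> \<le> \<kappa> / 4}"

lemma critical_at_minus: "z \<in> critical_at d \<Longrightarrow> (\<lambda>x. - z x) \<in> critical_at d"
  by (auto simp: critical_at_def solutions_minus level_minus fun_eq_iff)

lemma critical_at_unique:
  assumes "z \<in> critical_at d" "z' \<in> critical_at d" "\<And>x. \<bar>z x - z' x\<bar> \<le> 3 * \<kappa> / 4" shows "z = z'"
proof (rule ccontr)
  assume "z \<noteq> z'"
  then obtain x where "\<kappa> \<le> \<bar>z x - z' x\<bar>" using separated assms(1,2) by (auto simp: critical_at_def)
  then show False using assms(3)[of x] kappa by simp
qed

text \<open>Each \<open>a\<close> here belongs to a unique solution of level \<open>d\<close>, which is locally constant in \<open>a\<close> by separation.  Selecting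
  one solution from each pair \<open>{z, -z}\<close> splits the set into a closed part and its antipodal image; these are
  disjoint as a nonzero solution differs from its negative.\<close>
lemma near_critical_index:
  assumes h: "admissible A h D"
  shows "index_le (near_critical A h d) (of_bool (d \<in> levels))"
proof (cases "d \<in> levels")
  case False
  then have "critical_at d = {}" by (auto simp: critical_at_def)
  then have "near_critical A h d = {}" by (simp add: near_critical_def)
  then show ?thesis using False by (simp add: index_le_def)
next
  case True
  \<comment> \<open>\<open>K\<close> contains exactly one of \<open>z\<close> and \<open>-z\<close>: the choice operator depends only on the set \<open>{z, -z}\<close>.\<close>
  define K where "K = {z \<in> critical_at d. z = (SOME w. w \<in> {z, \<lambda>x. - z x})}"
  have Kpm: "z \<in> K \<or> (\<lambda>x. - z x) \<in> K" if z: "z \<in> critical_at d" for z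
  proof -
    define w where "w = (SOME w. w \<in> {z, \<lambda>x. - z x})"
    have w: "w \<in> {z, \<lambda>x. - z x}" unfolding w_def by (rule someI[of _ z]) simp
    have "{\<lambda>x. - z x, \<lambda>x. - (- z x)} = {z, \<lambda>x. - z x}" by auto
    then have "(SOME w. w \<in> {\<lambda>x. - z x, \<lambda>x. - (- z x)}) = w" by (simp only: w_def)
    then have s2: "w = (SOME w. w \<in> {\<lambda>x. - z x, \<lambda>x. - (- z x)})" by (rule sym)
    consider "w = z" | "w = (\<lambda>x. - z x)" using w by blast
    then show ?thesis
    proof cases
      case 1
      then have "z \<in> K" using z unfolding K_def w_def by (intro CollectI conjI) (auto simp only:)
      then show ?thesis ..
    next
      case 2
      then have "(\<lambda>x. - z x) \<in> K" using s2 critical_at_minus[OF z] unfolding K_def by (simp only: mem_Collect_eq)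
      then show ?thesis ..
    qed
  qed
  have Knot: "(\<lambda>x. - z x) \<notin> K" if z: "z \<in> K" for z
  proof
    assume m: "(\<lambda>x. - z x) \<in> K"
    have "{\<lambda>x. - z x, \<lambda>x. - (- z x)} = {z, \<lambda>x. - z x}" by auto
    moreover have "z = (SOME w. w \<in> {z, \<lambda>x. - z x})" using z unfolding K_def by blast
    moreover have "(\<lambda>x. - z x) = (SOME w. w \<in> {\<lambda>x. - z x, \<lambda>x. - (- z x)})" using m unfolding K_def by blast
    ultimately have "(\<lambda>x. - z x) = z" by (simp only:)
    then have "- z x = z x" for x by (rule fun_cong)
    then have "z = (\<lambda>_. 0)" by (simp add: fun_eq_iff)
    then show False using z by (simp add: K_def critical_at_def)
  qed
  define B where "B = {a \<in> A. \<exists>z\<in>K. \<forall>x. \<bar>h a x - z x\<bar> \<le> \<kappa> / 4}"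
  have comp: "compact A" using h by (simp add: admissible_def)
  have "closed B"
    unfolding closed_sequential_limits
  proof (intro allI impI, elim conjE)
    fix s l assume s: "\<forall>n. s n \<in> B" and lim: "s \<longlonglongrightarrow> l"
    have sA: "s n \<in> A" for n using s by (simp add: B_def)
    have lA: "l \<in> A" using compact_imp_closed[OF comp] sA lim unfolding closed_sequential_limits by blast
    have "\<forall>n. \<exists>z. z \<in> K \<and> (\<forall>x. \<bar>h (s n) x - z x\<bar> \<le> \<kappa> / 4)" using s unfolding B_def by blast
    from choice[OF this] obtain z where z: "\<And>n. z n \<in> K" "\<And>n x. \<bar>h (s n) x - z n x\<bar> \<le> \<kappa> / 4" by blast
    have u: "\<exists>n0. \<forall>n\<ge>n0. \<forall>x. \<bar>h (s n) x - h l x\<bar> \<le> e" if "0 < e" for e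
      by (rule admissible_uniform[OF h sA lA lim that])
    have k8: "0 < \<kappa> / 8" using kappa by simp
    obtain n0 where n0: "\<And>n x. n0 \<le> n \<Longrightarrow> \<bar>h (s n) x - h l x\<bar> \<le> \<kappa> / 8" using u[OF k8] by blast
    have const: "z n = z n0" if n: "n0 \<le> n" for n
    proof (rule critical_at_unique)
      show "z n \<in> critical_at d" "z n0 \<in> critical_at d" using z(1) by (auto simp: K_def)
      fix x
      show "\<bar>z n x - z n0 x\<bar> \<le> 3 * \<kappa> / 4"
        using z(2)[of n x] z(2)[of n0 x] n0[OF n, of x] n0[OF order_refl, of x] by linarith
    qed
    have "\<bar>h l x - z n0 x\<bar> \<le> \<kappa> / 4" for x
    proof (rule field_le_epsilon)
      fix e :: real assume "0 < e"
      then obtain n1 where n1: "\<And>n x. n1 \<le> n \<Longrightarrow> \<bar>h (s n) x - h l x\<bar> \<le> e" using u by blast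
      show "\<bar>h l x - z n0 x\<bar> \<le> \<kappa> / 4 + e"
        using n1[OF max.cobounded2, of n0 x] z(2)[of "max n0 n1" x] unfolding const[OF max.cobounded1] by linarith
    qed
    then show "l \<in> B" unfolding B_def using lA z(1)[of n0] by blast
  qed
  moreover have "antipode a \<notin> B" if a: "a \<in> B" for a
  proof
    assume a': "antipode a \<in> B"
    obtain z where z: "z \<in> K" "\<And>x. \<bar>h a x - z x\<bar> \<le> \<kappa> / 4" using a by (auto simp: B_def)
    obtain z' where z': "z' \<in> K" "\<And>x. \<bar>h (antipode a) x - z' x\<bar> \<le> \<kappa> / 4" using a' by (auto simp: B_def)
    have hm: "h (antipode a) x = - h a x" for x using h a by (simp add: admissible_def B_def)
    have "z = (\<lambda>x. - z' x)"
    proof (rule critical_at_unique)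
      show "z \<in> critical_at d" "(\<lambda>x. - z' x) \<in> critical_at d" using z(1) z'(1) critical_at_minus by (auto simp: K_def)
      fix x show "\<bar>z x - - z' x\<bar> \<le> 3 * \<kappa> / 4" using z(2)[of x] z'(2)[of x] hm[of x] kappa by linarith
    qed
    then show False using Knot[OF z'(1)] z(1) by simp
  qed
  moreover have "a \<in> B \<or> antipode a \<in> B" if a: "a \<in> near_critical A h d" for a
  proof -
    obtain z where z: "z \<in> critical_at d" "\<And>x. \<bar>h a x - z x\<bar> \<le> \<kappa> / 4" and aA: "a \<in> A" using a by (auto simp: near_critical_def)
    have hm: "h (antipode a) x = - h a x" "antipode a \<in> A" for x using h aA by (auto simp: admissible_def)
    have "\<bar>h (antipode a) x - - z x\<bar> \<le> \<kappa> / 4" for x using z(2)[of x] hm(1)[of x] by linarith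
    then have "(\<lambda>x. - z x) \<in> K \<Longrightarrow> antipode a \<in> B" using hm(2) unfolding B_def
      by (intro CollectI conjI bexI[of _ "\<lambda>x. - z x"] allI)
    moreover have "z \<in> K \<Longrightarrow> a \<in> B" using z(2) aA unfolding B_def by blast
    ultimately show ?thesis using Kpm[OF z(1)] by blast
  qed
  ultimately have "index_le (near_critical A h d) 1"
    unfolding index_le_def by (intro exI[of _ "\<lambda>_. B"]) auto
  then show ?thesis using True by simp
qed

text \<open>The remaining parameters, closed up to be compact again; on the closure the distance to the solutions
  may drop from \<open>\<kappa> / 4\<close>, but not below \<open>\<kappa> / 8\<close>.\<close>
lemma admissible_far:
  fixes d :: real
  assumes h: "admissible A h D"
  defines "A' \<equiv> closure (A - near_critical A h d)"
  shows "admissible A' h D" "A \<subseteq> near_critical A h d \<union> A'"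
    "a \<in> A' \<Longrightarrow> z \<in> critical_at d \<Longrightarrow> \<exists>x. \<kappa> / 8 < \<bar>h a x - z x\<bar>"
proof -
  have comp: "compact A" using h by (simp add: admissible_def)
  have sub: "A' \<subseteq> A" unfolding A'_def using compact_imp_closed[OF comp] by (intro closure_minimal) auto
  show "A \<subseteq> near_critical A h d \<union> A'" unfolding A'_def using closure_subset[of "A - near_critical A h d"] by blast
  have inv: "antipode a \<in> A - near_critical A h d" if a: "a \<in> A - near_critical A h d" for a
  proof -
    have aA: "antipode a \<in> A" and hm: "h (antipode a) = (\<lambda>x. - h a x)" using h a by (auto simp: admissible_def)
    have "antipode a \<notin> near_critical A h d"
    proof
      assume "antipode a \<in> near_critical A h d"
      then obtain z where z: "z \<in> critical_at d" "\<And>x. \<bar>- h a x - z x\<bar> \<le> \<kappa> / 4" by (auto simp: near_critical_def hm)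
      have "\<bar>h a x - - z x\<bar> \<le> \<kappa> / 4" for x using z(2)[of x] by linarith
      then show False using a critical_at_minus[OF z(1)] by (auto simp: near_critical_def)
    qed
    then show ?thesis using aA by blast
  qed
  have anti: "antipode a \<in> A'" if a: "a \<in> A'" for a
  proof -
    obtain s where s: "\<And>n. s n \<in> A - near_critical A h d" "s \<longlonglongrightarrow> a" using a unfolding A'_def closure_sequential by blast
    have "(\<lambda>n. antipode (s n)) \<longlonglongrightarrow> antipode a"
      by (rule continuous_on_tendsto_compose[OF continuous_on_antipode[of UNIV] s(2)]) auto
    then show ?thesis unfolding A'_def closure_sequential
      by (intro exI[of _ "\<lambda>n. antipode (s n)"] conjI allI inv[OF s(1)])
  qed
  have "compact A'"
  proof -
    have "A \<inter> A' = A'" using sub by blast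
    moreover have "closed A'" by (simp add: A'_def)
    ultimately show ?thesis using compact_Int_closed[OF comp] by metis
  qed
  then show "admissible A' h D"
    using h sub anti unfolding admissible_def by (meson continuous_on_subset subsetD)
  assume a: "a \<in> A'" and z: "z \<in> critical_at d"
  show "\<exists>x. \<kappa> / 8 < \<bar>h a x - z x\<bar>"
  proof (rule ccontr)
    assume "\<not> ?thesis"
    then have c: "\<bar>h a x - z x\<bar> \<le> \<kappa> / 8" for x by (simp add: not_less)
    obtain s where s: "\<And>n. s n \<in> A - near_critical A h d" "s \<longlonglongrightarrow> a" using a unfolding A'_def closure_sequential by blast
    have k8: "0 < \<kappa> / 8" using kappa by simp
    have sA: "s n \<in> A" for n using s(1) by blast
    have aA: "a \<in> A" using a sub by blast
    obtain n where n: "\<And>x. \<bar>h (s n) x - h a x\<bar> \<le> \<kappa> / 8"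
      using admissible_uniform[OF h sA aA s(2) k8] by blast
    have "\<bar>h (s n) x - z x\<bar> \<le> \<kappa> / 4" for x using n[of x] c[of x] by linarith
    then show False using s(1)[of n] z by (auto simp: near_critical_def)
  qed
qed

section \<open>Deformation below a critical level\<close>

lemma admissible_mono:
  assumes "admissible A h D" "D \<le> D'" shows "admissible A h D'"
proof -
  have "J (h a) \<le> D'" if "a \<in> A" for a using assms that unfolding admissible_def by (meson order_trans)
  then show ?thesis using assms(1) unfolding admissible_def by blast
qed

text \<open>The conclusion of \<open>nehari_descent\<close> for one step length \<open>s\<close>, which has to serve two rates \<open>\<alpha>\<close> at the same time.\<close>
definition descends :: "real \<Rightarrow> real \<Rightarrow> real \<Rightarrow> bool" where
  "descends D \<alpha> s \<longleftrightarrow> (\<forall>u\<in>nehari. \<forall>\<phi>\<in>fin_supp. \<forall>w. J u \<le> D \<longrightarrow> 0 \<le> w \<longrightarrow> w \<le> 1 \<longrightarrow>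
     l1norm \<phi> \<le> w \<longrightarrow> \<alpha> * w \<le> (\<Sum>x | \<phi> x \<noteq> 0. residual u x * \<phi> x) \<longrightarrow>
     (\<lambda>x. u x - s * \<phi> x) \<noteq> (\<lambda>_. 0) \<and> J (proj (\<lambda>x. u x - s * \<phi> x)) \<le> J u - s * \<alpha> * w / 4)"

lemma descends_ex:
  assumes al: "0 < \<alpha>" shows "\<exists>s0>0. \<forall>s. 0 < s \<longrightarrow> s \<le> s0 \<longrightarrow> descends D \<alpha> s"
proof (rule nehari_descent[OF al, of D])
  fix s0 :: real
  assume s0: "0 < s0" "\<And>u \<phi> w s. u \<in> nehari \<Longrightarrow> J u \<le> D \<Longrightarrow> \<phi> \<in> fin_supp \<Longrightarrow> 0 \<le> w \<Longrightarrow> w \<le> 1 \<Longrightarrow>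
     l1norm \<phi> \<le> w \<Longrightarrow> \<alpha> * w \<le> (\<Sum>x | \<phi> x \<noteq> 0. residual u x * \<phi> x) \<Longrightarrow> 0 < s \<Longrightarrow> s \<le> s0 \<Longrightarrow>
     (\<lambda>x. u x - s * \<phi> x) \<noteq> (\<lambda>_. 0) \<and> J (proj (\<lambda>x. u x - s * \<phi> x)) \<le> J u - s * \<alpha> * w / 4"
  show ?thesis unfolding descends_def by (intro exI[of _ s0] conjI[OF s0(1)] ballI allI impI) (rule s0(2))
qed

lemma descendsD:
  assumes "descends D \<alpha> s" "u \<in> nehari" "J u \<le> D" "\<phi> \<in> fin_supp" "0 \<le> w" "w \<le> 1" "l1norm \<phi> \<le> w"
    "\<alpha> * w \<le> (\<Sum>x | \<phi> x \<noteq> 0. residual u x * \<phi> x)"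
  shows "(\<lambda>x. u x - s * \<phi> x) \<noteq> (\<lambda>_. 0)" "J (proj (\<lambda>x. u x - s * \<phi> x)) \<le> J u - s * \<alpha> * w / 4"
  using assms(1)[unfolded descends_def, rule_format, OF assms(2,4,3,5-8)] by (rule conjunct1, rule conjunct2)

end

text \<open>The data for flowing an admissible family \<open>h\<close>, away from the solutions, from the level \<open>d + e\<close> to \<open>d - e\<close>
  in steps of length at most \<open>s\<close>.  The bound \<open>t\<close> comes from the dichotomy and is independent of \<open>h\<close>, therefore \<open>e\<close> can be
  chosen in terms of \<open>t\<close>; the bound \<open>t'\<close> depends on \<open>h\<close> and only makes the number of steps finite.\<close>
locale descent_flow = few_solutions T p pstar V f \<kappa>
  for T :: int and p pstar :: real and V :: "int ^ 'n \<Rightarrow> real" and f :: "int ^ 'n \<Rightarrow> real \<Rightarrow> real" and \<kappa> :: real +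
  fixes A :: "(nat \<Rightarrow> real) set" and h :: "(nat \<Rightarrow> real) \<Rightarrow> int ^ 'n \<Rightarrow> real" and d e t t' r s :: real
  assumes h: "admissible A h (d + e)" and e: "0 < e" "e \<le> 1" and t: "0 < t" and t': "0 < t'"
    and s: "0 < s" "s \<le> r / 4" and r: "16 / t * (3 * e) \<le> r / 4"
    and desc: "descends (d + 1) (t / 2) s" and desc': "descends (d + 1) (t' / 2) s"
    and steep: "\<And>a u. a \<in> A \<Longrightarrow> u \<in> nehari \<Longrightarrow> J u \<le> d + 1 \<Longrightarrow> \<bar>J u - d\<bar> \<le> 2 * e \<Longrightarrow>
      \<forall>x. \<bar>u x - h a x\<bar> \<le> 3 * \<kappa> / 64 \<Longrightarrow> \<exists>x. t' < \<bar>residual u x\<bar>"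
    and dich: "\<forall>u\<in>almost_critical (d + 1) t. \<forall>v\<in>almost_critical (d + 1) t.
       (\<forall>x. \<bar>u x - v x\<bar> \<le> \<kappa> / 2) \<longrightarrow> (\<forall>x. \<bar>u x - v x\<bar> \<le> \<kappa> / 64)"
    and near: "\<forall>u\<in>nehari. \<forall>w\<in>fin_supp. J u \<le> d + 1 \<longrightarrow> l1norm (\<lambda>x. w x - u x) < r \<longrightarrow>
       w \<noteq> (\<lambda>_. 0) \<and> 1 / 2 \<le> ray_scale w \<and> ray_scale w \<le> 2 \<and> (\<forall>x. \<bar>proj w x - u x\<bar> \<le> \<kappa> / 64)"
begin

text \<open>A reference point for the flow from \<open>h a\<close>: the start \<open>h a\<close> itself, or a point close to an
  almost critical function that lies near \<open>h a\<close>.\<close>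
definition anchored :: "(nat \<Rightarrow> real) \<Rightarrow> (int ^ 'n \<Rightarrow> real) \<Rightarrow> bool" where
  "anchored a b \<longleftrightarrow> b \<in> nehari \<and> J b \<le> d + 1 \<and> (b = h a \<or>
     (\<exists>g\<in>almost_critical (d + 1) t. (\<forall>x. \<bar>g x - h a x\<bar> \<le> \<kappa> / 64) \<and> (\<forall>x. \<bar>b x - g x\<bar> \<le> \<kappa> / 64)))"

text \<open>The current point is the projection of an anchor moved by \<open>\<psi>\<close>, where the length of \<open>\<psi>\<close> is controlled by the energy
  lost since the start.  This invariant confines the flow: while some residual exceeds \<open>t\<close>, energy is lost in proportion to
  the distance covered; whenever all residuals are at most \<open>t\<close>, the current point becomes the new anchor,
  and the dichotomy keeps all these anchors in one cluster.\<close>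
definition tracked :: "(nat \<Rightarrow> real) \<Rightarrow> (int ^ 'n \<Rightarrow> real) \<Rightarrow> bool" where
  "tracked a u \<longleftrightarrow> (\<exists>b \<psi>. anchored a b \<and> \<psi> \<in> fin_supp \<and> l1norm \<psi> \<le> s + 16 / t * (J (h a) - J u)
     \<and> u = proj (\<lambda>x. b x - \<psi> x))"

lemma start_bounds: assumes "a \<in> A" shows "h a \<in> nehari" "J (h a) \<le> d + e" "J (h a) \<le> d + 1"
  using h assms e(2) unfolding admissible_def by (auto intro: order_trans)

lemma tracked_start: assumes a: "a \<in> A" shows "tracked a (h a)"
proof -
  have "h a = proj (\<lambda>x. h a x - 0)" using start_bounds(1)[OF a] by (intro proj_eqI[symmetric, of _ 1]) auto
  moreover have "anchored a (h a)" unfolding anchored_def using start_bounds[OF a] by blast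
  moreover have "(\<lambda>_. 0) \<in> fin_supp" "l1norm (\<lambda>_. 0) \<le> s + 16 / t * (J (h a) - J (h a))"
    using s(1) by (auto simp: fin_supp_def l1norm_def)
  ultimately show ?thesis unfolding tracked_def by blast
qed

lemma tracked_anchor:
  assumes a: "a \<in> A" and u: "tracked a u" "d - 2 * e < J u"
  shows "\<exists>b \<psi>. anchored a b \<and> \<psi> \<in> fin_supp \<and> l1norm \<psi> \<le> s + 16 / t * (J (h a) - J u) \<and> u = proj (\<lambda>x. b x - \<psi> x)
     \<and> 1 / 2 \<le> ray_scale (\<lambda>x. b x - \<psi> x) \<and> (\<forall>x. \<bar>u x - b x\<bar> \<le> \<kappa> / 64)"
proof -
  obtain b \<psi> where b: "anchored a b" and psi: "\<psi> \<in> fin_supp" "l1norm \<psi> \<le> s + 16 / t * (J (h a) - J u)"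
    and ub: "u = proj (\<lambda>x. b x - \<psi> x)" using u(1) unfolding tracked_def by blast
  have bn: "b \<in> nehari" "J b \<le> d + 1" using b unfolding anchored_def by blast+
  have "16 / t * (J (h a) - J u) \<le> 16 / t * (3 * e)"
    using start_bounds(2)[OF a] u(2) t by (intro mult_left_mono) auto
  then have psi_r: "l1norm \<psi> < r" using psi(2) s r by linarith
  have wf: "(\<lambda>x. b x - \<psi> x) \<in> fin_supp" using fin_supp_add[OF nehariD(1)[OF bn(1)] psi(1), of "-1"] by simp
  have "l1norm (\<lambda>x. (b x - \<psi> x) - b x) < r" using psi_r by (simp add: l1norm_def)
  then have "1 / 2 \<le> ray_scale (\<lambda>x. b x - \<psi> x) \<and> (\<forall>x. \<bar>proj (\<lambda>x. b x - \<psi> x) x - b x\<bar> \<le> \<kappa> / 64)"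
    using near[rule_format, OF bn(1) wf bn(2)] by simp
  then show ?thesis using b psi ub by blast
qed

lemma anchored_cases:
  assumes b: "anchored a b"
  obtains "b = h a" | q where "q \<in> almost_critical (d + 1) t" "\<forall>x. \<bar>q x - h a x\<bar> \<le> \<kappa> / 64" "\<forall>x. \<bar>b x - q x\<bar> \<le> \<kappa> / 64"
  using b unfolding anchored_def by blast

lemma anchored_close:
  assumes b: "anchored a b" shows "\<bar>b x - h a x\<bar> \<le> \<kappa> / 32"
proof (rule anchored_cases[OF b])
  assume "b = h a" then show ?thesis using kappa by simp
next
  fix q assume "\<forall>x. \<bar>q x - h a x\<bar> \<le> \<kappa> / 64" "\<forall>x. \<bar>b x - q x\<bar> \<le> \<kappa> / 64"
  then have "\<bar>q x - h a x\<bar> \<le> \<kappa> / 64" "\<bar>b x - q x\<bar> \<le> \<kappa> / 64" by blast+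
  then show ?thesis by linarith
qed

text \<open>Two almost critical functions near the same anchor are within \<open>\<kappa> / 2\<close>, so the dichotomy brings them within
  \<open>\<kappa> / 64\<close>.  This is why repeated changes of the anchor do not accumulate an error.\<close>
lemma anchored_near_anchor:
  assumes b: "anchored a b" and u: "u \<in> almost_critical (d + 1) t" "\<forall>x. \<bar>u x - b x\<bar> \<le> \<kappa> / 64"
  shows "anchored a u"
proof (rule anchored_cases[OF b])
  assume "b = h a"
  then have "\<forall>x. \<bar>u x - h a x\<bar> \<le> \<kappa> / 64" using u(2) by simp
  moreover have "\<forall>x. \<bar>u x - u x\<bar> \<le> \<kappa> / 64" using kappa by simp
  ultimately show ?thesis using u(1) unfolding anchored_def by (auto simp: almost_critical_def)
next
  fix q assume q: "q \<in> almost_critical (d + 1) t" "\<forall>x. \<bar>q x - h a x\<bar> \<le> \<kappa> / 64" "\<forall>x. \<bar>b x - q x\<bar> \<le> \<kappa> / 64"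
  have "\<bar>u x - q x\<bar> \<le> \<kappa> / 2" for x
    using u(2)[rule_format, of x] q(3)[rule_format, of x] kappa by linarith
  then have "\<forall>x. \<bar>u x - q x\<bar> \<le> \<kappa> / 64" using dich u(1) q(1) by blast
  then show ?thesis using u(1) q(1,2) unfolding anchored_def by (auto simp: almost_critical_def)
qed

lemma tracked_steep:
  assumes a: "a \<in> A" and u: "u \<in> nehari" "tracked a u" "d - 2 * e < J u" "J u \<le> d + e"
  shows "\<exists>x. t' < \<bar>residual u x\<bar>"
proof (rule steep[OF a u(1)])
  show "J u \<le> d + 1" "\<bar>J u - d\<bar> \<le> 2 * e" using u e by auto
  obtain b where b: "anchored a b" "\<forall>x. \<bar>u x - b x\<bar> \<le> \<kappa> / 64" using tracked_anchor[OF a u(2,3)] by blast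
  show "\<forall>x. \<bar>u x - h a x\<bar> \<le> 3 * \<kappa> / 64"
  proof
    fix x show "\<bar>u x - h a x\<bar> \<le> 3 * \<kappa> / 64"
      using anchored_close[OF b(1), of x] b(2)[rule_format, of x] by linarith
  qed
qed

lemma l1norm_add_le:
  assumes "\<psi> \<in> fin_supp" "\<phi> \<in> fin_supp" "0 \<le> c"
  shows "l1norm (\<lambda>x. \<psi> x + c * \<phi> x) \<le> l1norm \<psi> + c * l1norm \<phi>"
proof -
  define P where "P = {x. \<psi> x \<noteq> 0} \<union> {x. \<phi> x \<noteq> 0}"
  have P: "finite P" using assms by (simp add: P_def fin_supp_def)
  have "l1norm (\<lambda>x. \<psi> x + c * \<phi> x) = (\<Sum>x\<in>P. \<bar>\<psi> x + c * \<phi> x\<bar>)"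
    by (rule l1norm_eq[OF P]) (simp add: P_def)
  also have "\<dots> \<le> (\<Sum>x\<in>P. \<bar>\<psi> x\<bar> + c * \<bar>\<phi> x\<bar>)"
  proof (rule sum_mono)
    fix x
    have "\<bar>c * \<phi> x\<bar> = c * \<bar>\<phi> x\<bar>" using assms(3) by (simp add: abs_mult)
    then show "\<bar>\<psi> x + c * \<phi> x\<bar> \<le> \<bar>\<psi> x\<bar> + c * \<bar>\<phi> x\<bar>"
      using abs_triangle_ineq[of "\<psi> x" "c * \<phi> x"] by simp
  qed
  also have "\<dots> = l1norm \<psi> + c * l1norm \<phi>"
  proof -
    have "l1norm \<psi> = (\<Sum>x\<in>P. \<bar>\<psi> x\<bar>)" by (rule l1norm_eq[OF P]) (simp add: P_def)
    moreover have "l1norm \<phi> = (\<Sum>x\<in>P. \<bar>\<phi> x\<bar>)" by (rule l1norm_eq[OF P]) (simp add: P_def)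
    ultimately show ?thesis by (simp add: sum.distrib sum_distrib_left)
  qed
  finally show ?thesis .
qed

text \<open>If \<open>u\<close> is almost critical, it becomes the anchor, and the step itself is the new displacement, of length at most
  \<open>s\<close>.  Otherwise the energy drops by at least \<open>s * (t / 2) * w / 4\<close>, while undoing the scaling by
  \<open>c \<ge> 1 / 2\<close> makes the displacement grow by at most \<open>2 * s * w\<close>, which is \<open>16 / t\<close> times that drop.\<close>
lemma tracked_step:
  assumes a: "a \<in> A" and u: "u \<in> nehari" "tracked a u" "d - 2 * e < J u" "J u \<le> J (h a)"
    and w: "0 < w" "w \<le> 1" and phi: "\<phi> \<in> fin_supp" "l1norm \<phi> \<le> w"
    and rate: "\<And>x. \<bar>residual u x\<bar> \<le> m" "t' \<le> m" "m / 2 * w \<le> (\<Sum>x | \<phi> x \<noteq> 0. residual u x * \<phi> x)"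
  shows "(\<lambda>x. u x - s * \<phi> x) \<noteq> (\<lambda>_. 0) \<and> J (proj (\<lambda>x. u x - s * \<phi> x)) \<le> J u - s * (t' / 2) * w / 4 \<and>
    tracked a (proj (\<lambda>x. u x - s * \<phi> x))"
proof -
  define u' where "u' = proj (\<lambda>x. u x - s * \<phi> x)"
  have uD: "J u \<le> d + 1" using u(4) start_bounds(3)[OF a] by linarith
  have "t' / 2 * w \<le> m / 2 * w" using rate(2) w by (intro mult_right_mono) auto
  then have "t' / 2 * w \<le> (\<Sum>x | \<phi> x \<noteq> 0. residual u x * \<phi> x)" using rate(3) by linarith
  note d1 = descendsD[OF desc' u(1) uD phi(1) less_imp_le[OF w(1)] w(2) phi(2) this, folded u'_def]
  have "0 \<le> s * (t' / 2) * w / 4" using s(1) t' w by simp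
  then have u'u: "J u' \<le> J u" using d1(2) by linarith
  obtain b \<psi> where b: "anchored a b" and psi: "\<psi> \<in> fin_supp" "l1norm \<psi> \<le> s + 16 / t * (J (h a) - J u)"
    and ub: "u = proj (\<lambda>x. b x - \<psi> x)" and sc: "1 / 2 \<le> ray_scale (\<lambda>x. b x - \<psi> x)" and close: "\<forall>x. \<bar>u x - b x\<bar> \<le> \<kappa> / 64"
    using tracked_anchor[OF a u(2,3)] by blast
  have bn: "b \<in> nehari" using b by (simp add: anchored_def)
  have "tracked a u'"
  proof (cases "u \<in> almost_critical (d + 1) t")
    case True
    have "anchored a u" by (rule anchored_near_anchor[OF b True close])
    moreover have "l1norm (\<lambda>x. s * \<phi> x) \<le> s + 16 / t * (J (h a) - J u')"
    proof -
      have "s * l1norm \<phi> \<le> s * 1" using phi(2) w(2) s(1) by (intro mult_left_mono) auto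
      moreover have "0 \<le> 16 / t * (J (h a) - J u')" using t u'u u(4) by (intro mult_nonneg_nonneg) auto
      ultimately show ?thesis unfolding l1norm_scale[OF s(1)] by linarith
    qed
    ultimately show ?thesis unfolding tracked_def u'_def using fin_supp_scale[OF phi(1)] by blast
  next
    case False
    then obtain x1 where "t < \<bar>residual u x1\<bar>" using u(1) uD by (auto simp: almost_critical_def not_le)
    then have "t \<le> m" using rate(1)[of x1] by simp
    then have "t / 2 * w \<le> m / 2 * w" using w by (intro mult_right_mono) auto
    then have "t / 2 * w \<le> (\<Sum>x | \<phi> x \<noteq> 0. residual u x * \<phi> x)" using rate(3) by linarith
    note d2 = descendsD(2)[OF desc u(1) uD phi(1) less_imp_le[OF w(1)] w(2) phi(2) this, folded u'_def]
    define c where "c = ray_scale (\<lambda>x. b x - \<psi> x)"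
    have c: "1 / 2 \<le> c" "0 < c" using sc by (auto simp: c_def)
    have sc0: "0 \<le> s / c" using s(1) c by simp
    define \<psi>' where "\<psi>' = (\<lambda>x. \<psi> x + (s / c) * \<phi> x)"
    have psi'f: "\<psi>' \<in> fin_supp" unfolding \<psi>'_def by (rule fin_supp_add[OF psi(1) phi(1)])
    have vw: "(\<lambda>x. u x - s * \<phi> x) = (\<lambda>x. c * (b x - \<psi>' x))"
    proof
      fix x
      have "u x = c * (b x - \<psi> x)" unfolding ub proj_def c_def ..
      moreover have "c * ((s / c) * \<phi> x) = s * \<phi> x" using c by simp
      ultimately show "u x - s * \<phi> x = c * (b x - \<psi>' x)" by (simp add: \<psi>'_def algebra_simps)
    qed
    have bpf: "(\<lambda>x. b x - \<psi>' x) \<in> fin_supp" using fin_supp_add[OF nehariD(1)[OF bn] psi'f, of "-1"] by simp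
    have bp0: "(\<lambda>x. b x - \<psi>' x) \<noteq> (\<lambda>_. 0)" using d1(1) unfolding vw by (auto simp: fun_eq_iff)
    have "u' = proj (\<lambda>x. b x - \<psi>' x)" unfolding u'_def vw by (rule proj_scale[OF bpf bp0 c(2)])
    moreover have "l1norm \<psi>' \<le> s + 16 / t * (J (h a) - J u')"
    proof -
      have "l1norm \<psi>' \<le> l1norm \<psi> + (s / c) * l1norm \<phi>"
        unfolding \<psi>'_def by (rule l1norm_add_le[OF psi(1) phi(1) sc0])
      also have "(s / c) * l1norm \<phi> \<le> (2 * s) * w"
      proof (rule mult_mono[OF _ phi(2)])
        show "s / c \<le> 2 * s" using c s(1) by (simp add: field_simps)
        show "0 \<le> l1norm \<phi>" by (simp add: l1norm_def sum_nonneg)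
      qed (use s(1) in auto)
      finally have "l1norm \<psi>' \<le> s + 16 / t * (J (h a) - J u) + 2 * s * w" using psi(2) by linarith
      moreover have "2 * s * w = 16 / t * (s * (t / 2) * w / 4)" using t by simp
      moreover have "16 / t * (J (h a) - J u) + 16 / t * (s * (t / 2) * w / 4) \<le> 16 / t * (J (h a) - J u')"
        unfolding distrib_left[symmetric] using d2 t by (intro mult_left_mono) auto
      ultimately show ?thesis by linarith
    qed
    ultimately show ?thesis unfolding tracked_def using b psi'f by blast
  qed
  then show ?thesis using d1 by (simp add: u'_def)
qed

definition on_track :: "((nat \<Rightarrow> real) \<Rightarrow> int ^ 'n \<Rightarrow> real) \<Rightarrow> bool" where
  "on_track g \<longleftrightarrow> admissible A g (d + e) \<and> (\<forall>a\<in>A. J (g a) \<le> J (h a) \<and> tracked a (g a))"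

lemma on_track_step:
  assumes g: "on_track g" and c: "\<forall>a\<in>A. J (g a) \<le> c"
  shows "\<exists>g'. on_track g' \<and> (\<forall>a\<in>A. J (g' a) \<le> max (d - e) (c - s * t' / 8))"
proof -
  have adm: "admissible A g (d + e)" using g by (simp add: on_track_def)
  obtain B where B: "finite B" "\<And>a x. a \<in> A \<Longrightarrow> x \<notin> B \<Longrightarrow> g a x = 0" using adm by (auto simp: admissible_def)
  have gc: "continuous_on A (\<lambda>a. g a x)" for x using adm by (simp add: admissible_def)
  have ga: "g a \<in> nehari" "J (g a) \<le> d + e" "antipode a \<in> A" "g (antipode a) = (\<lambda>x. - g a x)" if "a \<in> A" for a
    using adm that by (auto simp: admissible_def)
  have gJ: "J (g a) \<le> J (h a)" "tracked a (g a)" if "a \<in> A" for a using g that by (auto simp: on_track_def)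
  \<comment> \<open>The residual spreads from the support to its neighbours; the origin only ensures that the set is nonempty.\<close>
  define B' where "B' = insert 0 (B \<union> (\<Union>y\<in>B. {z. adj y z}))"
  have B': "finite B'" "B' \<noteq> {}" using B(1) finite_adj by (auto simp: B'_def)
  have res0: "residual (g a) x = 0" if "a \<in> A" "x \<notin> B'" for a x
    by (rule residual_support[where B = B]) (use B(2)[OF that(1)] that(2) in \<open>auto simp: B'_def\<close>)
  \<comment> \<open>The cut-off vanishes below the level \<open>d - 2 * e\<close>, where the slope is not controlled, and equals \<open>1\<close> above \<open>d - e\<close>.\<close>
  define chi where "chi a = min 1 (max 0 ((J (g a) - (d - 2 * e)) / e))" for a
  have chi: "0 \<le> chi a" "chi a \<le> 1" for a by (auto simp: chi_def)
  define df where "df a = descent_field B' (t' / 2) (g a)" for a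
  define \<phi> where "\<phi> a = (\<lambda>x. chi a * df a x)" for a
  define v where "v a = (\<lambda>x. g a x - s * \<phi> a x)" for a
  define g' where "g' a = proj (v a)" for a
  have slope_ge: "\<bar>residual (g a) x\<bar> \<le> slope B' (g a)" if a: "a \<in> A" for a x
  proof (cases "x \<in> B'")
    case True then show ?thesis unfolding slope_def using B'(1) by (intro Max_ge) auto
  next
    case False
    have "\<bar>residual (g a) 0\<bar> \<le> slope B' (g a)" unfolding slope_def using B'(1) by (intro Max_ge) (auto simp: B'_def)
    then show ?thesis using res0[OF a False] by simp
  qed
  have df0: "df a x = 0" if "a \<in> A" "x \<notin> B'" for a x
  proof -
    have "0 \<le> slope B' (g a)" using slope_ge[OF that(1), of 0] by linarith
    then show ?thesis by (simp add: df_def descent_field_def res0[OF that])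
  qed
  have v0: "v a x = 0" if "a \<in> A" "x \<notin> B'" for a x
    using B(2)[OF that(1), of x] df0[OF that] that(2) by (auto simp: v_def \<phi>_def B'_def)
  have vf: "v a \<in> fin_supp" if a: "a \<in> A" for a
    unfolding fin_supp_def using v0[OF a] by (auto intro!: finite_subset[OF _ B'(1)])
  have key: "v a \<noteq> (\<lambda>_. 0) \<and> J (g' a) \<le> J (g a) - s * (t' / 2) * chi a / 4 \<and> tracked a (g' a)" if a: "a \<in> A" for a
  proof (cases "chi a = 0")
    case True
    then have va: "v a = g a" by (auto simp: v_def \<phi>_def)
    have "g' a = g a" unfolding g'_def va by (rule proj_eqI[OF ga(1)[OF a], of 1]) auto
    then show ?thesis using True gJ(2)[OF a] nehariD[OF ga(1)[OF a]] by (simp add: va)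
  next
    case False
    then have chi0: "0 < chi a" using chi(1)[of a] by simp
    then have "0 < (J (g a) - (d - 2 * e)) / e" by (auto simp: chi_def less_max_iff_disj)
    then have low: "d - 2 * e < J (g a)" using e(1) by (simp add: zero_less_divide_iff)
    obtain x0 where x0: "t' < \<bar>residual (g a) x0\<bar>"
      using tracked_steep[OF a ga(1)[OF a] gJ(2)[OF a] low ga(2)[OF a]] by blast
    have sl: "2 * (t' / 2) \<le> slope B' (g a)" using slope_ge[OF a, of x0] x0 by simp
    have t2: "0 < t' / 2" using t' by simp
    note dfp = descent_field_props[OF B'(1) res0[OF a] t2 sl B'(2), folded df_def]
    have phf: "\<phi> a \<in> fin_supp" unfolding \<phi>_def by (rule fin_supp_scale[OF dfp(1)])
    have phl: "l1norm (\<phi> a) \<le> chi a" unfolding \<phi>_def using l1norm_scale[OF chi0, of "df a"] dfp(2) by simp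
    have "(\<Sum>x | \<phi> a x \<noteq> 0. residual (g a) x * \<phi> a x) = chi a * (\<Sum>x | df a x \<noteq> 0. residual (g a) x * df a x)"
      using chi0 by (simp add: \<phi>_def sum_distrib_left mult_ac)
    moreover have "chi a * (slope B' (g a) / 2) \<le> chi a * (\<Sum>x | df a x \<noteq> 0. residual (g a) x * df a x)"
      using dfp(3) chi0 by (intro mult_left_mono) auto
    ultimately have phs: "slope B' (g a) / 2 * chi a \<le> (\<Sum>x | \<phi> a x \<noteq> 0. residual (g a) x * \<phi> a x)"
      by (simp only: mult.commute[of "chi a" "slope B' (g a) / 2"])
    have slt: "t' \<le> slope B' (g a)" using sl by simp
    show ?thesis
      unfolding g'_def v_def
      by (rule tracked_step[OF a ga(1)[OF a] gJ(2)[OF a] low gJ(1)[OF a] chi0 chi(2) phf phl slope_ge[OF a] slt phs])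
  qed
  have e0: "e \<noteq> 0" using e by simp
  have chic: "continuous_on A chi"
    unfolding chi_def
    by (intro continuous_on_min continuous_on_max continuous_on_const continuous_on_divide continuous_on_diff J_cont[OF B gc] ballI e0)
  have t2: "0 < t' / 2" using t' by simp
  have dfc: "continuous_on A (\<lambda>a. df a x)" for x
    unfolding df_def by (rule descent_field_cont[OF B' gc t2])
  have vc: "continuous_on A (\<lambda>a. v a x)" for x
    unfolding v_def \<phi>_def by (intro continuous_on_diff continuous_on_mult continuous_on_const gc chic dfc)
  have vnz: "v a \<noteq> (\<lambda>_. 0)" if "a \<in> A" for a using key[OF that] by blast
  have g'c: "continuous_on A (\<lambda>a. g' a x)" for x
    unfolding g'_def by (rule proj_cont[OF B'(1) v0 vc vnz])
  have drop: "J (g' a) \<le> J (g a)" if "a \<in> A" for a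
  proof -
    have "0 \<le> s * (t' / 2) * chi a / 4" using s t' chi(1)[of a] by simp
    then show ?thesis using key[OF that] by linarith
  qed
  have "admissible A g' (d + e)"
    unfolding admissible_def
  proof (intro conjI ballI)
    show "compact A" using adm by (simp add: admissible_def)
    show "\<exists>B. finite B \<and> (\<forall>a\<in>A. \<forall>x. x \<notin> B \<longrightarrow> g' a x = 0)"
      using B'(1) v0 by (intro exI[of _ B']) (auto simp: g'_def proj_def)
    show "\<forall>x. continuous_on A (\<lambda>a. g' a x)" using g'c by blast
    fix a assume a: "a \<in> A"
    show "antipode a \<in> A" by (rule ga(3)[OF a])
    have "chi (antipode a) = chi a" by (simp add: chi_def ga(4)[OF a] J_minus)
    then have vm: "v (antipode a) = (\<lambda>x. - v a x)"
      by (auto simp: v_def \<phi>_def df_def ga(4)[OF a] descent_field_minus)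
    show "g' (antipode a) = (\<lambda>x. - g' a x)"
      unfolding g'_def vm by (rule proj_minus[OF vf[OF a] vnz[OF a]])
    show "g' a \<in> nehari" unfolding g'_def by (rule proj_nehari(2)[OF vf[OF a] vnz[OF a]])
    show "J (g' a) \<le> d + e" using drop[OF a] ga(2)[OF a] by linarith
  qed
  moreover have "J (g' a) \<le> J (h a) \<and> tracked a (g' a)" if "a \<in> A" for a
    using drop[OF that] gJ(1)[OF that] key[OF that] by linarith
  moreover have "J (g' a) \<le> max (d - e) (c - s * t' / 8)" if a: "a \<in> A" for a
  proof (cases "d - e \<le> J (g a)")
    case True
    then have "1 \<le> (J (g a) - (d - 2 * e)) / e" using e(1) by (simp add: field_simps)
    then have "chi a = 1" by (simp add: chi_def)
    then have "J (g' a) \<le> J (g a) - s * (t' / 2) * 1 / 4" using key[OF a] by (simp only:)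
    moreover have "J (g a) \<le> c" using c a by blast
    ultimately have "J (g' a) \<le> c - s * t' / 8" by simp
    then show ?thesis by simp
  next
    case False
    then show ?thesis using drop[OF a] by simp
  qed
  ultimately have "on_track g' \<and> (\<forall>a\<in>A. J (g' a) \<le> max (d - e) (c - s * t' / 8))" unfolding on_track_def by blast
  then show ?thesis by blast
qed

lemma flow_down: "\<exists>g. admissible A g (d - e)"
proof -
  define q where "q = s * t' / 8"
  have q: "0 < q" using s t' by (simp add: q_def)
  have iter: "\<exists>g. on_track g \<and> (\<forall>a\<in>A. J (g a) \<le> max (d - e) (d + e - real n * q))" for n
  proof (induction n)
    case 0
    have "on_track h" unfolding on_track_def using h tracked_start by blast
    moreover have "\<forall>a\<in>A. J (h a) \<le> max (d - e) (d + e - real 0 * q)" using start_bounds(2) by (simp add: le_max_iff_disj)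
    ultimately show ?case by blast
  next
    case (Suc n)
    then obtain g where g: "on_track g" "\<forall>a\<in>A. J (g a) \<le> max (d - e) (d + e - real n * q)" by blast
    obtain g' where g': "on_track g'" "\<forall>a\<in>A. J (g' a) \<le> max (d - e) (max (d - e) (d + e - real n * q) - s * t' / 8)"
      using on_track_step[OF g] by blast
    have "max (d - e) (max (d - e) (d + e - real n * q) - s * t' / 8) \<le> max (d - e) (d + e - real (Suc n) * q)"
      using q unfolding q_def[symmetric] by (auto simp: max_def algebra_simps)
    then have "\<forall>a\<in>A. J (g' a) \<le> max (d - e) (d + e - real (Suc n) * q)" using g'(2) by (meson order_trans)
    then show ?case using g'(1) by blast
  qed
  obtain n :: nat where n: "2 * e / q < real n" using reals_Archimedean2 by blast
  then have "2 * e < real n * q" using q by (simp add: pos_divide_less_eq)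
  then have mx: "max (d - e) (d + e - real n * q) = d - e" by simp
  obtain g where g: "on_track g" "\<forall>a\<in>A. J (g a) \<le> d - e" using iter[of n] unfolding mx by blast
  then have "admissible A g (d - e)" unfolding on_track_def admissible_def by blast
  then show ?thesis by blast
qed

end

context few_solutions
begin

lemma proj_near_ex:
  assumes e: "0 < c"
  shows "\<exists>r>0. \<forall>u\<in>nehari. \<forall>w\<in>fin_supp. J u \<le> D \<longrightarrow> l1norm (\<lambda>x. w x - u x) < r \<longrightarrow>
       w \<noteq> (\<lambda>_. 0) \<and> 1 / 2 \<le> ray_scale w \<and> ray_scale w \<le> 2 \<and> (\<forall>x. \<bar>proj w x - u x\<bar> \<le> c)"
proof (rule proj_near[OF e, of D])
  fix r assume r: "0 < r" "\<And>u w. u \<in> nehari \<Longrightarrow> J u \<le> D \<Longrightarrow> w \<in> fin_supp \<Longrightarrow> l1norm (\<lambda>x. w x - u x) < r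
     \<Longrightarrow> w \<noteq> (\<lambda>_. 0) \<and> 1 / 2 \<le> ray_scale w \<and> ray_scale w \<le> 2 \<and> \<bar>ray_scale w - 1\<bar> \<le> c \<and> (\<forall>x. \<bar>proj w x - u x\<bar> \<le> c)"
  show ?thesis
    by (intro exI[of _ r] conjI[OF r(1)] ballI impI) (use r(2) in blast)
qed

text \<open>All constants that depend on \<open>h\<close> are produced here; \<open>e\<close>, \<open>t\<close> and \<open>r\<close> are prescribed independently of it.\<close>
lemma deformation:
  assumes "0 < t" "0 < r" and dich: "\<forall>u\<in>almost_critical (d + 1) t. \<forall>v\<in>almost_critical (d + 1) t.
       (\<forall>x. \<bar>u x - v x\<bar> \<le> \<kappa> / 2) \<longrightarrow> (\<forall>x. \<bar>u x - v x\<bar> \<le> \<kappa> / 64)"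
    and near: "\<forall>u\<in>nehari. \<forall>w\<in>fin_supp. J u \<le> d + 1 \<longrightarrow> l1norm (\<lambda>x. w x - u x) < r \<longrightarrow>
       w \<noteq> (\<lambda>_. 0) \<and> 1 / 2 \<le> ray_scale w \<and> ray_scale w \<le> 2 \<and> (\<forall>x. \<bar>proj w x - u x\<bar> \<le> \<kappa> / 64)"
    and e: "0 < e" "e \<le> 1" "16 / t * (3 * e) \<le> r / 4"
    and gap: "\<And>l. l \<in> levels \<Longrightarrow> \<bar>l - d\<bar> \<le> 2 * e \<Longrightarrow> l = d"
    and h: "admissible A h (d + e)"
    and away: "\<And>a z. a \<in> A \<Longrightarrow> z \<in> critical_at d \<Longrightarrow> \<exists>x. \<kappa> / 8 < \<bar>h a x - z x\<bar>"
  shows "\<exists>g. admissible A g (d - e)"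
proof -
  have hD: "admissible A h (d + 1)" by (rule admissible_mono[OF h]) (use e in simp)
  obtain t' where t': "0 < t'" and slope: "\<forall>a u. a \<in> A \<and> u \<in> nehari \<and> J u \<le> d + 1 \<and> \<bar>J u - d\<bar> \<le> 2 * e \<and> (\<forall>x. \<bar>u x - h a x\<bar> \<le> \<kappa> / 16) \<and>
     (\<forall>z. z \<in> solutions p V f \<longrightarrow> z \<noteq> (\<lambda>_. 0) \<longrightarrow> level z = d \<longrightarrow> (\<exists>x. \<kappa> / 16 \<le> \<bar>u x - z x\<bar>))
     \<longrightarrow> (\<exists>x. t' < \<bar>residual u x\<bar>)"
    using slope_bound[OF hD gap] by blast
  have t2: "0 < t / 2" "0 < t' / 2" using assms(1) t' by auto
  obtain s0 where s0: "0 < s0" "\<forall>s. 0 < s \<longrightarrow> s \<le> s0 \<longrightarrow> descends (d + 1) (t / 2) s" using descends_ex[OF t2(1)] by blast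
  obtain s1 where s1: "0 < s1" "\<forall>s. 0 < s \<longrightarrow> s \<le> s1 \<longrightarrow> descends (d + 1) (t' / 2) s" using descends_ex[OF t2(2)] by blast
  define s where "s = Min {s0, s1, r / 4}"
  have s: "0 < s" "s \<le> s0" "s \<le> s1" "s \<le> r / 4" using s0(1) s1(1) assms(2) by (auto simp: s_def)
  have steep: "\<exists>x. t' < \<bar>residual u x\<bar>"
    if a: "a \<in> A" and u: "u \<in> nehari" "J u \<le> d + 1" "\<bar>J u - d\<bar> \<le> 2 * e" and close: "\<forall>x. \<bar>u x - h a x\<bar> \<le> 3 * \<kappa> / 64" for a u
  proof (rule slope[rule_format, of a u], intro conjI allI impI a u)
    fix x show "\<bar>u x - h a x\<bar> \<le> \<kappa> / 16" using close[rule_format, of x] kappa by linarith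
  next
    fix z assume "z \<in> solutions p V f" "z \<noteq> (\<lambda>_. 0)" "level z = d"
    then have "z \<in> critical_at d" by (simp add: critical_at_def)
    from away[OF a this] obtain x where "\<kappa> / 8 < \<bar>h a x - z x\<bar>" by blast
    then have "\<kappa> / 16 \<le> \<bar>u x - z x\<bar>" using close[rule_format, of x] kappa by linarith
    then show "\<exists>x. \<kappa> / 16 \<le> \<bar>u x - z x\<bar>" by blast
  qed
  interpret descent_flow T p pstar V f \<kappa> A h d e t t' r s
    by (unfold_locales; (fact h e assms(1) t' s(1,4) dich near | (rule s0(2)[rule_format, OF s(1,2)]) | (rule s1(2)[rule_format, OF s(1,3)]) | (rule steep; assumption)))
  show ?thesis by (rule flow_down)
qed

end

section \<open>Counting critical levels\<close>

lemma compact_nsphere: "compact (topspace (nsphere m))"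
proof -
  have cube: "compact (PiE UNIV (\<lambda>_::nat. {-1..1::real}))"
  proof -
    have "compactin (product_topology (\<lambda>_::nat. euclideanreal) UNIV) (PiE UNIV (\<lambda>_. {-1..1::real}))"
      unfolding compactin_PiE by simp
    then show ?thesis by (simp only: euclidean_product_topology compactin_euclidean_iff)
  qed
  have "closed ({x :: nat \<Rightarrow> real. (\<Sum>i\<le>m. x i ^ 2) = 1} \<inter> (\<Inter>i\<in>{m<..}. {x. x i = 0}))"
    by (intro closed_Int closed_INT ballI closed_Collect_eq continuous_on_sum continuous_on_power continuous_on_product_coordinates continuous_on_const)
  moreover have "topspace (nsphere m) = {x. (\<Sum>i\<le>m. x i ^ 2) = 1} \<inter> (\<Inter>i\<in>{m<..}. {x. x i = 0})"
    by (auto simp: nsphere)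
  ultimately have cl: "closed (topspace (nsphere m))" by simp
  have "topspace (nsphere m) \<subseteq> PiE UNIV (\<lambda>_. {-1..1})"
  proof
    fix x assume x: "x \<in> topspace (nsphere m)"
    have "x i \<in> {-1..1}" for i
    proof (cases "i \<le> m")
      case True
      have "(x i)\<^sup>2 \<le> (\<Sum>i\<le>m. x i ^ 2)" using True by (intro member_le_sum[of i]) auto
      then have "\<bar>x i\<bar> \<le> 1" using x by (simp add: nsphere abs_square_le_1)
      then show ?thesis by auto
    next
      case False then show ?thesis using x by (simp add: nsphere)
    qed
    then show "x \<in> PiE UNIV (\<lambda>_. {-1..1})" by auto
  qed
  then have "PiE UNIV (\<lambda>_. {-1..1}) \<inter> topspace (nsphere m) = topspace (nsphere m)" by blast
  then show ?thesis using compact_Int_closed[OF cube cl] by (simp only:)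
qed

context few_solutions
begin

text \<open>A family at level \<open>d + e\<close> splits into the part near solutions of level \<open>d\<close>, of index at most one, and a part that
  can be deformed to level \<open>d - e\<close>.  The map changes under the deformation but the parameter set does not, so its
  index is bounded by the hypothesis at the lower level.\<close>
lemma step_down:
  "\<exists>e>0. \<forall>A h m. admissible A h (d + e) \<longrightarrow> (\<forall>A' h'. admissible A' h' (d - e) \<longrightarrow> index_le A' m)
     \<longrightarrow> index_le A (of_bool (d \<in> levels) + m)"
proof -
  have k64: "0 < \<kappa> / 64" using kappa by simp
  obtain t where t: "0 < t" "\<forall>u\<in>almost_critical (d + 1) t. \<forall>v\<in>almost_critical (d + 1) t.
       (\<forall>x. \<bar>u x - v x\<bar> \<le> \<kappa> / 2) \<longrightarrow> (\<forall>x. \<bar>u x - v x\<bar> \<le> \<kappa> / 64)"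
    using almost_critical_dichotomy[OF k64, of "d + 1"] by blast
  obtain r where r: "0 < r" "\<forall>u\<in>nehari. \<forall>w\<in>fin_supp. J u \<le> d + 1 \<longrightarrow> l1norm (\<lambda>x. w x - u x) < r \<longrightarrow>
       w \<noteq> (\<lambda>_. 0) \<and> 1 / 2 \<le> ray_scale w \<and> ray_scale w \<le> 2 \<and> (\<forall>x. \<bar>proj w x - u x\<bar> \<le> \<kappa> / 64)"
    using proj_near_ex[OF k64, of "d + 1"] by blast
  obtain g where g: "0 < g" "\<forall>l\<in>levels. l \<noteq> d \<longrightarrow> g \<le> dist d l"
    using finite_set_avoid[OF finite_levels, of d] by blast
  \<comment> \<open>The middle bound amounts to \<open>16 / t * (3 * e) \<le> r / 4\<close>, the last one isolates \<open>d\<close> among the levels.\<close>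
  define e where "e = Min {1, r * t / 192, g / 3}"
  have e: "0 < e" "e \<le> 1" "e \<le> r * t / 192" "e \<le> g / 3" using t r g by (auto simp: e_def)
  have e4: "16 / t * (3 * e) \<le> r / 4" using e(3) t(1) by (simp add: field_simps)
  have gap: "l = d" if l: "l \<in> levels" "\<bar>l - d\<bar> \<le> 2 * e" for l
  proof (rule ccontr)
    assume "l \<noteq> d"
    then have "g \<le> dist d l" using g(2) l(1) by blast
    then show False using l(2) e(4) g(1) by (simp add: dist_real_def)
  qed
  have "index_le A (of_bool (d \<in> levels) + m)"
    if h: "admissible A h (d + e)" and below: "\<forall>A' h'. admissible A' h' (d - e) \<longrightarrow> index_le A' m" for A h m
  proof -
    define A' where "A' = closure (A - near_critical A h d)"
    note far = admissible_far[OF h, where d = d, folded A'_def]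
    obtain h' where "admissible A' h' (d - e)"
      using deformation[OF t(1) r(1) t(2) r(2) e(1,2) e4 gap far(1) far(3)] by blast
    then have "index_le A' m" using below by blast
    then show ?thesis by (rule index_le_union[OF near_critical_index[OF h] _ far(2)])
  qed
  then show ?thesis using e(1) by blast
qed

text \<open>Continuous induction on the level.  The statement holds vacuously for \<open>D \<le> 0\<close>, as \<open>J\<close> is positive on the
  Nehari manifold, and \<open>step_down\<close> carries it beyond the supremum of the levels up to which it holds.\<close>
lemma index_le_card_levels:
  assumes "admissible A h D" shows "index_le A (card {l \<in> levels. l \<le> D})"
proof -
  define P where "P c \<longleftrightarrow> (\<forall>A h. admissible A h c \<longrightarrow> index_le A (card {l \<in> levels. l \<le> c}))" for c
  define S where "S = {c. \<forall>c'\<le>c. P c'}"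
  have P0: "P c" if "c \<le> 0" for c
    unfolding P_def
  proof (intro allI impI)
    fix A h assume h: "admissible A h c"
    have "A = {}"
    proof (rule ccontr)
      assume "A \<noteq> {}"
      then obtain a where "a \<in> A" by blast
      then have "h a \<in> nehari" "J (h a) \<le> c" using h by (auto simp: admissible_def)
      then show False using J_nehari_pos[of "h a"] that by simp
    qed
    then show "index_le A (card {l \<in> levels. l \<le> c})" by (simp add: index_le_def exI[of _ "\<lambda>_. {}"])
  qed
  have S0: "0 \<in> S" unfolding S_def using P0 by blast
  have "P D"
  proof (rule ccontr)
    assume "\<not> P D"
    have bdd: "bdd_above S"
    proof (rule bdd_aboveI)
      fix c assume "c \<in> S" show "c \<le> D"
      proof (rule ccontr)
        assume "\<not> c \<le> D"
        then show False using \<open>c \<in> S\<close> \<open>\<not> P D\<close> by (auto simp: S_def)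
      qed
    qed
    define d where "d = Sup S"
    obtain e where e: "0 < e" "\<forall>A h m. admissible A h (d + e) \<longrightarrow> (\<forall>A' h'. admissible A' h' (d - e) \<longrightarrow> index_le A' m)
       \<longrightarrow> index_le A (of_bool (d \<in> levels) + m)" using step_down[of d] by blast
    have below: "P c" if c: "c < d" for c
    proof -
      have "S \<noteq> {}" using S0 by blast
      from less_cSup_iff[OF this bdd, of c] obtain c' where "c' \<in> S" "c < c'" using c unfolding d_def by blast
      then show ?thesis by (simp add: S_def)
    qed
    have "P c" if c: "c \<le> d + e" for c
    proof (cases "c < d")
      case True then show ?thesis by (rule below)
    next
      case False
      show ?thesis
        unfolding P_def
      proof (intro allI impI)
        fix A h assume h: "admissible A h c"
        have "\<forall>A' h'. admissible A' h' (d - e) \<longrightarrow> index_le A' (card {l \<in> levels. l \<le> d - e})"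
          using below[of "d - e"] e(1) unfolding P_def by simp
        then have ind: "index_le A (of_bool (d \<in> levels) + card {l \<in> levels. l \<le> d - e})"
          using e(2) admissible_mono[OF h c] by blast
        have "of_bool (d \<in> levels) + card {l \<in> levels. l \<le> d - e} \<le> card {l \<in> levels. l \<le> c}"
        proof (cases "d \<in> levels")
          case True
          have f: "finite {l \<in> levels. l \<le> d - e}" "finite {l \<in> levels. l \<le> c}" using finite_levels by auto
          have "card (insert d {l \<in> levels. l \<le> d - e}) \<le> card {l \<in> levels. l \<le> c}"
            by (rule card_mono[OF f(2)]) (use True \<open>\<not> c < d\<close> e(1) in auto)
          then show ?thesis using True f(1) e(1) by simp
        next
          case dn: False
          have "card {l \<in> levels. l \<le> d - e} \<le> card {l \<in> levels. l \<le> c}"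
            by (rule card_mono) (use finite_levels \<open>\<not> c < d\<close> e(1) in auto)
          then show ?thesis using dn by simp
        qed
        then show "index_le A (card {l \<in> levels. l \<le> c})" by (rule index_le_mono[OF ind])
      qed
    qed
    then have "d + e \<in> S" by (simp add: S_def)
    then have "d + e \<le> d" unfolding d_def by (rule cSup_upper[OF _ bdd])
    then show False using e(1) by simp
  qed
  then show ?thesis using assms unfolding P_def by blast
qed

text \<open>With \<open>m\<close> levels, send the \<open>m\<close>-sphere to combinations of \<open>m + 1\<close> point masses and project to the Nehari manifold:
  an admissible family of index greater than \<open>m\<close>.\<close>
lemma no_few_solutions: False
proof -
  define m where "m = card levels"
  define pt :: "nat \<Rightarrow> int ^ 'n" where "pt i = (\<chi> j. int i)" for i
  have pt: "pt i = pt j \<longleftrightarrow> i = j" for i j by (auto simp: pt_def vec_eq_iff)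
  define w where "w a = (\<lambda>x. \<Sum>i\<le>m. a i * of_bool (x = pt i))" for a :: "nat \<Rightarrow> real"
  define A where "A = topspace (nsphere m)"
  have w_pt: "w a (pt j) = a j" if "j \<le> m" for a j
    using that by (simp add: w_def pt of_bool_def if_distrib[of "(*) _"] cong: if_cong)
  have w_out: "w a x = 0" if "x \<notin> pt ` {..m}" for a x
    unfolding w_def by (rule sum.neutral) (use that in auto)
  have wc: "continuous_on A (\<lambda>a. w a x)" for x
    unfolding w_def by (intro continuous_on_sum continuous_on_mult_right
        continuous_on_subset[OF continuous_on_product_coordinates subset_UNIV])
  have wm: "w (antipode a) = (\<lambda>x. - w a x)" for a by (simp add: w_def antipode_def sum_negf)
  have w0: "w a \<noteq> (\<lambda>_. 0)" if a: "a \<in> A" for a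
  proof
    assume "w a = (\<lambda>_. 0)"
    then have "a j = 0" if "j \<le> m" for j using w_pt[OF that, of a] by simp
    then have "(\<Sum>i\<le>m. a i ^ 2) = 0" by (intro sum.neutral) auto
    then show False using a by (simp add: A_def nsphere)
  qed
  have fin: "finite (pt ` {..m})" by simp
  have wf: "w a \<in> fin_supp" for a
    unfolding fin_supp_def using w_out by (auto intro!: finite_subset[OF _ fin])
  define h where "h a = proj (w a)" for a
  have hc: "continuous_on A (\<lambda>a. h a x)" for x
    unfolding h_def by (rule proj_cont[OF fin w_out wc w0])
  have h_out: "h a x = 0" if "x \<notin> pt ` {..m}" for a x using w_out[OF that] by (simp add: h_def proj_def)
  have cA: "compact A" unfolding A_def by (rule compact_nsphere)
  have "compact ((\<lambda>a. J (h a)) ` A)"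
    by (rule compact_continuous_image[OF J_cont[OF fin h_out hc] cA])
  then have "bdd_above ((\<lambda>a. J (h a)) ` A)" by (intro bounded_imp_bdd_above compact_imp_bounded)
  then obtain D where D: "\<And>a. a \<in> A \<Longrightarrow> J (h a) \<le> D" by (auto simp: bdd_above_def)
  have "admissible A h D"
    unfolding admissible_def
  proof (intro conjI ballI allI)
    show "compact A" by (rule cA)
    show "\<exists>B. finite B \<and> (\<forall>a\<in>A. \<forall>x. x \<notin> B \<longrightarrow> h a x = 0)"
      by (intro exI[of _ "pt ` {..m}"] conjI fin ballI allI impI h_out)
    show "continuous_on A (\<lambda>a. h a x)" for x by (rule hc)
    fix a assume a: "a \<in> A"
    show "antipode a \<in> A" using a by (simp add: A_def)
    show "h (antipode a) = (\<lambda>x. - h a x)" unfolding h_def wm by (rule proj_minus[OF wf w0[OF a]])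
    show "h a \<in> nehari" unfolding h_def by (rule proj_nehari(2)[OF wf w0[OF a]])
    show "J (h a) \<le> D" by (rule D[OF a])
  qed
  from index_le_card_levels[OF this] have "index_le A m"
    by (rule index_le_mono) (auto simp: m_def intro!: card_mono finite_levels)
  then show False unfolding A_def using index_nsphere by blast
qed

end

section \<open>Orbits of solutions\<close>

context periodic_problem
begin

lemma orbit_eq_shifts: "orbit T u = range (\<lambda>k. shift k u)"
proof -
  have "(\<lambda>x. u (x - T *s k)) = shift (- k) u" for k
  proof -
    have "x - T *s k = x + T *s (- k)" for x by (simp add: vec_eq_iff)
    then show ?thesis by (simp only: shift_def)
  qed
  moreover have "range (\<lambda>k. shift (- k) u) = range (\<lambda>k. shift k u)"
    using image_image[of "\<lambda>k. shift k u" uminus UNIV] by (simp add: surj_uminus)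
  ultimately show ?thesis by (auto simp: orbit_def)
qed

lemma shift_shift: "shift k (shift l u) = shift (k + l) u"
proof -
  have "(x + T *s k) + T *s l = x + T *s (k + l)" for x by (simp add: vec_eq_iff algebra_simps)
  then show ?thesis by (simp only: shift_def)
qed

lemma orbit_self:
  fixes u :: "int ^ 'n \<Rightarrow> real" shows "u \<in> orbit T u"
  unfolding orbit_eq_shifts by (rule image_eqI[of _ _ 0]) (simp_all add: shift_def)

lemma orbit_shift: "orbit T (shift k u) = orbit T u"
proof -
  have "range (\<lambda>l. shift (l + k) u) = range (\<lambda>l. shift l u)"
    using image_image[of "\<lambda>l. shift l u" "\<lambda>l. l + k" UNIV] by simp
  then show ?thesis by (simp add: orbit_eq_shifts shift_shift)
qed

lemma geom_distinct_iff:
  fixes u :: "int ^ 'n \<Rightarrow> real" shows "geom_distinct T u v \<longleftrightarrow> orbit T u \<noteq> orbit T v"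
proof
  assume "geom_distinct T u v"
  then show "orbit T u \<noteq> orbit T v" using orbit_self[of u] by (auto simp: geom_distinct_def)
next
  assume ne: "orbit T u \<noteq> orbit T v"
  show "geom_distinct T u v"
    unfolding geom_distinct_def
  proof (rule ccontr)
    assume "orbit T u \<inter> orbit T v \<noteq> {}"
    then obtain k l where "shift k u = shift l v" by (auto simp: orbit_eq_shifts)
    then show False using orbit_shift[of k u] orbit_shift[of l v] ne by simp
  qed
qed

lemma level_shift: "level (shift k z) = level z"
proof -
  have "inj (\<lambda>x. x + T *s k)" by (simp add: inj_def)
  moreover have "range (\<lambda>x. x + T *s k) = UNIV" by (rule surj_plus_right)
  ultimately have "(\<Sum>\<^sub>\<infinity>x\<in>UNIV. G x (z x)) = (\<Sum>\<^sub>\<infinity>x\<in>UNIV. G (x + T *s k) (z (x + T *s k)))"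
    using infsum_reindex[of "\<lambda>x. x + T *s k" UNIV "\<lambda>x. G x (z x)"] by (simp add: o_def)
  then show ?thesis by (simp add: level_def shift_def G_shift)
qed

text \<open>Fix a site where \<open>z\<close> is nonzero.  Because \<open>w\<close> decays at infinity, all but finitely many of its translates are at most
  half as large there; each of the finitely many others contributes its own positive difference.\<close>
lemma shifts_separated:
  assumes z: "z \<in> E_space p V" and w: "w \<in> E_space p V"
  shows "\<exists>c>0. \<forall>m. z \<noteq> shift m w \<longrightarrow> (\<exists>y. c \<le> \<bar>z y - shift m w y\<bar>)"
proof (cases "z = (\<lambda>_. 0)")
  case z0: True
  show ?thesis
  proof (cases "w = (\<lambda>_. 0)")
    case True
    then show ?thesis using z0 by (intro exI[of _ 1]) (simp add: shift_def)
  next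
    case False
    then obtain y where y: "w y \<noteq> 0" by auto
    have "\<bar>w y\<bar> \<le> \<bar>z (y - T *s m) - shift m w (y - T *s m)\<bar>" for m by (simp add: z0 shift_def)
    then show ?thesis using y by (intro exI[of _ "\<bar>w y\<bar>"]) auto
  qed
next
  case False
  then obtain x where x: "z x \<noteq> 0" by auto
  define F where "F = {m. \<bar>z x\<bar> / 2 \<le> \<bar>shift m w x\<bar>}"
  have "finite F"
  proof -
    have "finite {y. \<bar>z x\<bar> / 2 \<le> \<bar>w y\<bar>}" using x by (intro E_space_decay[OF w]) simp
    moreover have "inj (\<lambda>m. x + T *s m)" using T_pos by (auto simp: inj_def vec_eq_iff)
    ultimately have "finite ((\<lambda>m. x + T *s m) -` {y. \<bar>z x\<bar> / 2 \<le> \<bar>w y\<bar>})" by (rule finite_vimageI)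
    then show ?thesis by (simp add: F_def shift_def vimage_def)
  qed
  define F' where "F' = {m \<in> F. z \<noteq> shift m w}"
  have F': "finite F'" using \<open>finite F\<close> by (simp add: F'_def)
  have "\<forall>m\<in>F'. \<exists>y. z y \<noteq> shift m w y" by (auto simp: F'_def fun_eq_iff)
  then obtain y where y: "\<And>m. m \<in> F' \<Longrightarrow> z (y m) \<noteq> shift m w (y m)" by metis
  define c where "c = Min (insert (\<bar>z x\<bar> / 2) ((\<lambda>m. \<bar>z (y m) - shift m w (y m)\<bar>) ` F'))"
  have c: "0 < c" using F' x y by (auto simp: c_def)
  have c_le: "c \<le> \<bar>z x\<bar> / 2" "\<And>m. m \<in> F' \<Longrightarrow> c \<le> \<bar>z (y m) - shift m w (y m)\<bar>"
    unfolding c_def by (rule Min_le; use F' in simp)+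
  have "\<exists>y. c \<le> \<bar>z y - shift m w y\<bar>" if m: "z \<noteq> shift m w" for m
  proof (cases "m \<in> F")
    case True
    then show ?thesis using c_le(2)[of m] m by (auto simp: F'_def)
  next
    case False
    then have "\<bar>shift m w x\<bar> < \<bar>z x\<bar> / 2" by (simp add: F_def)
    then have "c \<le> \<bar>z x - shift m w x\<bar>" using c_le(1) by linarith
    then show ?thesis by blast
  qed
  then show ?thesis using c by blast
qed

text \<open>Every solution is a translate of one of finitely many representatives.  Translating both functions reduces
  the separation of two solutions to that of one representative from the translates of another, and levels are
  invariant under translation.\<close>
lemma finitely_many_orbits_few_solutions:
  assumes fin: "finite (orbit T ` solutions p V f)"
  shows "\<exists>\<kappa>. few_solutions T p pstar V f \<kappa>"
proof -
  obtain R where R: "R \<subseteq> solutions p V f" "finite R" "orbit T ` solutions p V f = orbit T ` R"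
    using finite_subset_image[OF fin order_refl] by blast
  have rep: "\<exists>r\<in>R. \<exists>k. z = shift k r" if "z \<in> solutions p V f" for z
  proof -
    have "orbit T z \<in> orbit T ` R" unfolding R(3)[symmetric] by (rule imageI[OF that])
    then obtain r where "orbit T z = orbit T r" "r \<in> R" by (rule imageE)
    then have "z \<in> orbit T r" using orbit_self[of z] by simp
    then show ?thesis using \<open>r \<in> R\<close> by (auto simp: orbit_eq_shifts)
  qed
  have "\<forall>q\<in>R \<times> R. \<exists>c>0. \<forall>m. fst q \<noteq> shift m (snd q) \<longrightarrow> (\<exists>y. c \<le> \<bar>fst q y - shift m (snd q) y\<bar>)"
    using R(1) by (intro ballI shifts_separated) (auto simp: solutions_def)
  from bchoice[OF this] obtain c where c0: "\<forall>q\<in>R \<times> R. 0 < c q \<and>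
      (\<forall>m. fst q \<noteq> shift m (snd q) \<longrightarrow> (\<exists>y. c q \<le> \<bar>fst q y - shift m (snd q) y\<bar>))" ..
  have c: "0 < c q" "fst q \<noteq> shift m (snd q) \<Longrightarrow> \<exists>y. c q \<le> \<bar>fst q y - shift m (snd q) y\<bar>" if "q \<in> R \<times> R" for q m
    using bspec[OF c0 that] by blast+
  define \<kappa> where "\<kappa> = Min (insert 1 (c ` (R \<times> R)))"
  have k: "0 < \<kappa>" "\<And>q. q \<in> R \<times> R \<Longrightarrow> \<kappa> \<le> c q" using R(2) c(1) by (auto simp: \<kappa>_def)
  have "few_solutions T p pstar V f \<kappa>"
  proof unfold_locales
    show "0 < \<kappa>" by (rule k(1))
    fix z z' assume z: "z \<in> solutions p V f" "z' \<in> solutions p V f" "z \<noteq> z'"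
    obtain r l where r: "r \<in> R" "z = shift l r" using rep[OF z(1)] by blast
    obtain r' l' where r': "r' \<in> R" "z' = shift l' r'" using rep[OF z(2)] by blast
    have eq: "z' = shift l (shift (l' - l) r')" by (simp add: r' shift_shift)
    have "r \<noteq> shift (l' - l) r'" using z(3) unfolding r(2) eq by blast
    then obtain y where "c (r, r') \<le> \<bar>r y - shift (l' - l) r' y\<bar>" using c(2)[of "(r, r')" "l' - l"] r(1) r'(1) by (simp, blast)
    then have "\<kappa> \<le> \<bar>r y - shift (l' - l) r' y\<bar>" using k(2)[of "(r, r')"] r(1) r'(1) by simp
    then have "\<kappa> \<le> \<bar>z (y - T *s l) - z' (y - T *s l)\<bar>"
      unfolding r(2) eq by (simp add: shift_def[of l])
    then show "\<exists>x. \<kappa> \<le> \<bar>z x - z' x\<bar>" by blast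
  next
    have "level ` {z \<in> solutions p V f. z \<noteq> (\<lambda>_. 0)} \<subseteq> level ` R"
    proof
      fix b assume "b \<in> level ` {z \<in> solutions p V f. z \<noteq> (\<lambda>_. 0)}"
      then obtain z where "z \<in> solutions p V f" "b = level z" by blast
      with rep obtain r k where "r \<in> R" "b = level (shift k r)" by blast
      then show "b \<in> level ` R" by (simp add: level_shift)
    qed
    then show "finite (level ` {z \<in> solutions p V f. z \<noteq> (\<lambda>_. 0)})" using R(2) finite_surj by blast
  qed
  then show ?thesis ..
qed

lemma infinitely_many_orbits: "infinite (orbit T ` solutions p V f)"
proof
  assume "finite (orbit T ` solutions p V f)"
  then obtain \<kappa> where "few_solutions T p pstar V f \<kappa>" using finitely_many_orbits_few_solutions by blast
  then show False by (rule few_solutions.no_few_solutions)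
qed

end

theorem theorem1p5:
  fixes N :: nat and T :: int and p pstar :: real
    and V :: "int ^ 'n \<Rightarrow> real" and f :: "int ^ 'n \<Rightarrow> real \<Rightarrow> real"
  assumes N: "N = CARD('n)" "2 \<le> N"
    and p: "2 \<le> p" "p < real N"
    and pstar: "pstar = real N * p / (real N - p)"
    and S1: "0 < T" "lattice_periodic T V" "\<forall>t. lattice_periodic T (\<lambda>x. f x t)"
            "0 \<le> (INF x. V x)"
    and S2: "\<forall>x. continuous_on UNIV (f x)"
            "\<exists>a q. a > 0 \<and> q > pstar \<and> (\<forall>x t. \<bar>f x t\<bar> \<le> a * (1 + \<bar>t\<bar> powr (q - 1)))"
    and S3: "uniform_limit UNIV (\<lambda>t x. f x t / \<bar>t\<bar> powr (pstar - 1)) (\<lambda>x. 0) (at 0)"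
    and S4: "\<forall>x. strict_mono_on ({..<0} \<union> {0<..}) (\<lambda>t. f x t / \<bar>t\<bar> powr (p - 1))"
    and S5: "\<forall>M. \<forall>\<^sub>F t in at_infinity. \<forall>x. primitive f x t / \<bar>t\<bar> powr p \<ge> M"
    and f_odd: "\<forall>x u. f x (- u) = - f x u"
  shows "\<exists>S. infinite S \<and> S \<subseteq> solutions p V f \<and> pairwise (geom_distinct T) S"
proof -
  interpret periodic_problem T p pstar V f
    by (unfold_locales; fact p(1) p(2)[unfolded N(1)] pstar[unfolded N(1)] S1 S2 S3 S4 S5 f_odd)
  define rep where "rep w = (SOME u. u \<in> solutions p V f \<and> orbit T u = w)" for w
  have rep: "rep w \<in> solutions p V f" "orbit T (rep w) = w" if "w \<in> orbit T ` solutions p V f" for w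
  proof -
    have "\<exists>u. u \<in> solutions p V f \<and> orbit T u = w" using that by blast
    from someI_ex[OF this] show "rep w \<in> solutions p V f" "orbit T (rep w) = w" by (auto simp: rep_def)
  qed
  have "inj_on rep (orbit T ` solutions p V f)" by (rule inj_on_inverseI[of _ "orbit T"]) (rule rep(2))
  then have "infinite (rep ` (orbit T ` solutions p V f))"
    using infinitely_many_orbits finite_imageD by blast
  moreover have "rep ` (orbit T ` solutions p V f) \<subseteq> solutions p V f" using rep(1) by blast
  moreover have "pairwise (geom_distinct T) (rep ` (orbit T ` solutions p V f))"
  proof (rule pairwiseI)
    fix u v assume "u \<in> rep ` (orbit T ` solutions p V f)" "v \<in> rep ` (orbit T ` solutions p V f)" "u \<noteq> v"
    then obtain w w' where "u = rep w" "v = rep w'" "w \<in> orbit T ` solutions p V f" "w' \<in> orbit T ` solutions p V f" by blast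
    then show "geom_distinct T u v" using rep(2)[of w] rep(2)[of w'] \<open>u \<noteq> v\<close> by (auto simp: geom_distinct_iff)
  qed
  ultimately show ?thesis by blast
qed

end
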